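(* Let $p\ge1$ and $\phi\in\mathbf{C}_{[0,1]}$ be such that $n^{-2}L_{\phi,n}^p\sim_\lambda\xi_\phi^p$. If the sequence $(m(n))_{n>0}$ is bounded, then $$\liminf_{n\to+\infty}\delta_n^p\ \ge\ \gamma,\qquad\text{where}\quad \gamma=\frac{\pi}{\left(\Psi_\phi^{\sqrt{\ }}\right)'(0)}$$ is a positive constant.
   Context: $\mathbb{N}^*=\{1,2,\dots\}$. $\mathbf{C}_{[0,1]}$ is the set of $\phi\in C^2([0,1])$ with $\phi'>0$ on $[0,1]$, with either $\phi''>0$ on $[0,1]$ or $\phi''<0$ on $[0,1]$, and with $\phi(0)=0$, $\phi(1)=1$. B-splines: for $n,p\in\mathbb{N}^*$ take the knots $t_0=\dots=t_p=0$, $t_{p+i}=i/n$ for $1\le i\le n-1$, $t_{p+n}=\dots=t_{2p+n}=1$. Put $N_j^0=\chi_{[t_j,t_{j+1})}$ and, for $1\le q\le p$, $N_j^q(t)=\frac{t-t_j}{t_{j+q}-t_j}N_j^{q-1}(t)+\frac{t_{j+q+1}-t}{t_{j+q+1}-t_{j+1}}N_{j+1}^{q-1}(t)$, a fraction with zero denominator being taken to be $0$. The degree-$p$ B-splines are $N_0^p,\dots,N_{n+p-1}^p$. Matrices: let $N=n+p-2$ and $h=1/n$. For $\phi\in\mathbf{C}_{[0,1]}$ let $M_{\phi,n}^p,K_{\phi,n}^p$ be the $N\times N$ matrices $(M_{\phi,n}^p)_{i,j}=\int_0^1|\phi'(x)|N_i^p(x)N_j^p(x)\,dx$, $(K_{\phi,n}^p)_{i,j}=\int_0^1\frac{1}{|\phi'(x)|}(N_i^p)'(x)(N_j^p)'(x)\,dx$,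 $1\le i,j\le N$, and let $L_{\phi,n}^p=(M_{\phi,n}^p)^{-1}K_{\phi,n}^p$. Its eigenvalues, counted with multiplicity and listed in nondecreasing order, are $\lambda_{1,h}\le\dots\le\lambda_{N,h}$. Gap (for $n$ with $N\ge2$): $\delta_n^p=\inf_{1\le k\le N-1}\left(\sqrt{\lambda_{k+1,h}}-\sqrt{\lambda_{k,h}}\right)$, and $m(n)$ is the smallest index $k\in\{1,\dots,N-1\}$ at which $\sqrt{\lambda_{k+1,h}}-\sqrt{\lambda_{k,h}}$ attains this minimum. Symbol: the cardinal B-splines are $\mathcal{N}_0=\chi_{[0,1]}$, $\mathcal{N}_q(x)=\frac{x}{q}\mathcal{N}_{q-1}(x)+\frac{q+1-x}{q}\mathcal{N}_{q-1}(x-1)$ for $q\ge1$. For $\theta\in[0,\pi]$ let $f_p(\theta)=-\mathcal{N}_{2p+1}''(p+1)-2\sum_{k=1}^p\mathcal{N}_{2p+1}''(p+1-k)\cos(k\theta)$, $g_p(\theta)=\mathcal{N}_{2p+1}(p+1)+2\sum_{k=1}^p\mathcal{N}_{2p+1}(p+1-k)\cos(k\theta)$, $e_p=f_p/g_p$. Let $\omega_\phi^p(x,\theta)=e_p(\theta)/(\phi'(x))^2$ on $[0,1]\times[0,\pi]$. $Rg(\cdot)$ denotes the range (image) of a function and $\mu_2$ the Lebesgue measure on $\mathbb{R}^2$. Set $\Psi_\phi^{\sqrt{\ }}(y)=\mu_2(\{(x,\theta)\in[0,1]\times[0,\pi]:\sqrt{\omega_\phi^p(x,\theta)}\le y\})$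 for $y\ge0$; its derivative at $0$ is the right derivative. The monotone rearrangement $\xi_\phi^p:[0,1]\to Rg(\omega_\phi^p)$ of $\omega_\phi^p$ is the extension to $[0,1]$ by continuity of $\xi_\phi^p(x)=\inf\{y\in Rg(\omega_\phi^p):\ \mu_2(\{\omega_\phi^p\le y\})>\pi x\}$, $x\in(0,1)$. The notation $n^{-2}L_{\phi,n}^p\sim_\lambda\xi_\phi^p$ means: for every continuous compactly supported $F:\mathbb{R}\to\mathbb{R}$, $\lim_{n\to\infty}\frac1N\sum_{k=1}^NF(n^{-2}\lambda_{k,h})=\int_0^1F(\xi_\phi^p(x))\,dx$. This is a known fact for every $\phi\in\mathbf{C}_{[0,1]}$.
   Formalization: The degree-0 cardinal B-spline is the indicator of [0,1) instead of [0,1]; with the closed interval the recursion makes the cardinal B-splines discontinuous at integers, so the second derivatives in f_p would not exist. *)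

theory Defs
  imports
    "HOL-Analysis.Analysis"
    "Jordan_Normal_Form.Char_Poly"
    "Jordan_Normal_Form.Gauss_Jordan_Elimination"
begin

section \<open>Reparametrizations of the unit interval\<close>

text \<open>Derivatives on the closed interval are one-sided at the endpoints, so only the
  values of the function on \<open>[0,1]\<close> matter.\<close>

definition D01 :: "(real \<Rightarrow> real) \<Rightarrow> real \<Rightarrow> real" where
  "D01 f x = vector_derivative f (at x within {0..1})"

definition C2_01 :: "(real \<Rightarrow> real) set" where
  "C2_01 = {f. f differentiable_on {0..1} \<and> D01 f differentiable_on {0..1} \<and>
               continuous_on {0..1} (D01 (D01 f))}"

definition C01 :: "(real \<Rightarrow> real) set" where
  "C01 = {\<phi> \<in> C2_01. (\<forall>x\<in>{0..1}. D01 \<phi> x > 0) \<and>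
            ((\<forall>x\<in>{0..1}. D01 (D01 \<phi>) x > 0) \<or> (\<forall>x\<in>{0..1}. D01 (D01 \<phi>) x < 0)) \<and>
            \<phi> 0 = 0 \<and> \<phi> 1 = 1}"

section \<open>B-splines on the open uniform knot vector\<close>

definition knot :: "nat \<Rightarrow> nat \<Rightarrow> nat \<Rightarrow> real" where
  "knot n p i = (if i \<le> p then 0 else if i < p + n then real (i - p) / real n else 1)"

text \<open>\<open>bspline n p q j\<close> is the \<open>j\<close>-th B-spline of degree \<open>q\<close> on the knots \<open>knot n p\<close>.
  Fractions with zero denominator vanish since \<open>x / 0 = 0\<close>.\<close>

fun bspline :: "nat \<Rightarrow> nat \<Rightarrow> nat \<Rightarrow> nat \<Rightarrow> real \<Rightarrow> real" where
  "bspline n p 0 j t = indicator {knot n p j..<knot n p (j + 1)} t"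
| "bspline n p (Suc q) j t =
     (t - knot n p j) / (knot n p (j + Suc q) - knot n p j) * bspline n p q j t
   + (knot n p (j + Suc q + 1) - t) / (knot n p (j + Suc q + 1) - knot n p (j + 1))
       * bspline n p q (j + 1) t"

section \<open>Mass and stiffness matrices, eigenvalues, gap\<close>

definition dimN :: "nat \<Rightarrow> nat \<Rightarrow> nat" where
  "dimN p n = n + p - 2"

text \<open>Matrix entries are indexed from \<open>0\<close>, hence the shift of the spline indices.
  The derivative of a spline may fail to exist at the finitely many knots (and at
  \<open>0\<close> and \<open>1\<close>), where the value of \<open>deriv\<close> is irrelevant for the integral.\<close>

definition M_mat :: "nat \<Rightarrow> (real \<Rightarrow> real) \<Rightarrow> nat \<Rightarrow> real mat" where
  "M_mat p \<phi> n = Matrix.mat (dimN p n) (dimN p n) (\<lambda>(i, j).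
     integral {0..1} (\<lambda>x. \<bar>D01 \<phi> x\<bar> * bspline n p p (i + 1) x * bspline n p p (j + 1) x))"

definition K_mat :: "nat \<Rightarrow> (real \<Rightarrow> real) \<Rightarrow> nat \<Rightarrow> real mat" where
  "K_mat p \<phi> n = Matrix.mat (dimN p n) (dimN p n) (\<lambda>(i, j).
     integral {0..1} (\<lambda>x. 1 / \<bar>D01 \<phi> x\<bar> *
       deriv (bspline n p p (i + 1)) x * deriv (bspline n p p (j + 1)) x))"

definition L_mat :: "nat \<Rightarrow> (real \<Rightarrow> real) \<Rightarrow> nat \<Rightarrow> real mat" where
  "L_mat p \<phi> n = the (mat_inverse (M_mat p \<phi> n)) * K_mat p \<phi> n"

text \<open>The \<open>k\<close>-th eigenvalue (\<open>k \<ge> 1\<close>) in nondecreasing order: \<open>proots\<close> is the multiset of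
  real roots, counted with multiplicity; the spectrum of \<open>L_mat\<close> is real because \<open>M_mat\<close> is
  symmetric positive definite and \<open>K_mat\<close> symmetric.\<close>

definition lam :: "nat \<Rightarrow> (real \<Rightarrow> real) \<Rightarrow> nat \<Rightarrow> nat \<Rightarrow> real" where
  "lam p \<phi> n k = sorted_list_of_multiset (proots (char_poly (L_mat p \<phi> n))) ! (k - 1)"

definition sqrt_gap :: "nat \<Rightarrow> (real \<Rightarrow> real) \<Rightarrow> nat \<Rightarrow> nat \<Rightarrow> real" where
  "sqrt_gap p \<phi> n k = sqrt (lam p \<phi> n (k + 1)) - sqrt (lam p \<phi> n k)"

text \<open>\<open>min_gap\<close> and \<open>min_gap_index\<close> are meaningful only when \<open>dimN p n \<ge> 2\<close>.\<close>

definition min_gap :: "nat \<Rightarrow> (real \<Rightarrow> real) \<Rightarrow> nat \<Rightarrow> real" where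
  "min_gap p \<phi> n = (INF k\<in>{1..dimN p n - 1}. sqrt_gap p \<phi> n k)"

definition min_gap_index :: "nat \<Rightarrow> (real \<Rightarrow> real) \<Rightarrow> nat \<Rightarrow> nat" where
  "min_gap_index p \<phi> n =
     (LEAST k. k \<in> {1..dimN p n - 1} \<and> sqrt_gap p \<phi> n k = min_gap p \<phi> n)"

section \<open>The symbol\<close>

text \<open>The degree-0 cardinal B-spline is the indicator of the half-open interval \<open>[0,1)\<close>.
  With the closed interval the recursion would count integer points twice
  (e.g. the hat function would take the value 2 at 1), and the cardinal B-splines of
  higher degree would be discontinuous at the integers.\<close>

fun cardinal_bspline :: "nat \<Rightarrow> real \<Rightarrow> real" where
  "cardinal_bspline 0 x = indicator {0..<1} x"
| "cardinal_bspline (Suc q) x =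
     x / real (Suc q) * cardinal_bspline q x
   + (real (Suc q) + 1 - x) / real (Suc q) * cardinal_bspline q (x - 1)"

definition f_sym :: "nat \<Rightarrow> real \<Rightarrow> real" where
  "f_sym p \<theta> = - deriv (deriv (cardinal_bspline (2 * p + 1))) (real p + 1)
     - 2 * (\<Sum>k=1..p. deriv (deriv (cardinal_bspline (2 * p + 1))) (real p + 1 - real k)
                         * cos (real k * \<theta>))"

definition g_sym :: "nat \<Rightarrow> real \<Rightarrow> real" where
  "g_sym p \<theta> = cardinal_bspline (2 * p + 1) (real p + 1)
     + 2 * (\<Sum>k=1..p. cardinal_bspline (2 * p + 1) (real p + 1 - real k) * cos (real k * \<theta>))"

definition e_sym :: "nat \<Rightarrow> real \<Rightarrow> real" where
  "e_sym p \<theta> = f_sym p \<theta> / g_sym p \<theta>"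

definition omega :: "nat \<Rightarrow> (real \<Rightarrow> real) \<Rightarrow> real \<times> real \<Rightarrow> real" where
  "omega p \<phi> = (\<lambda>(x, \<theta>). e_sym p \<theta> / (D01 \<phi> x)\<^sup>2)"

abbreviation sym_domain :: "(real \<times> real) set" where
  "sym_domain \<equiv> {0..1} \<times> {0..pi}"

definition Psi_sqrt :: "nat \<Rightarrow> (real \<Rightarrow> real) \<Rightarrow> real \<Rightarrow> real" where
  "Psi_sqrt p \<phi> y = measure lebesgue {z \<in> sym_domain. sqrt (omega p \<phi> z) \<le> y}"

definition gam :: "nat \<Rightarrow> (real \<Rightarrow> real) \<Rightarrow> real" where
  "gam p \<phi> = pi / vector_derivative (Psi_sqrt p \<phi>) (at 0 within {0..})"

definition xi_inner :: "nat \<Rightarrow> (real \<Rightarrow> real) \<Rightarrow> real \<Rightarrow> real" where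
  "xi_inner p \<phi> x = Inf {y \<in> omega p \<phi> ` sym_domain.
     measure lebesgue {z \<in> sym_domain. omega p \<phi> z \<le> y} > pi * x}"

text \<open>The monotone rearrangement: \<open>xi_inner\<close> on \<open>(0,1)\<close>, extended by its one-sided limits.\<close>

definition xi :: "nat \<Rightarrow> (real \<Rightarrow> real) \<Rightarrow> real \<Rightarrow> real" where
  "xi p \<phi> x = (if x \<le> 0 then Lim (at_right 0) (xi_inner p \<phi>)
                else if x \<ge> 1 then Lim (at_left 1) (xi_inner p \<phi>)
                else xi_inner p \<phi> x)"

definition eig_distributed :: "nat \<Rightarrow> (real \<Rightarrow> real) \<Rightarrow> bool" where
  "eig_distributed p \<phi> \<longleftrightarrow>
     (\<forall>F :: real \<Rightarrow> real. continuous_on UNIV F \<longrightarrow> compact (closure {x. F x \<noteq> 0}) \<longrightarrow>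
        (\<lambda>n. (\<Sum>k=1..dimN p n. F (lam p \<phi> n k / (real n)\<^sup>2)) / real (dimN p n))
          \<longlonglongrightarrow> integral {0..1} (\<lambda>x. F (xi p \<phi> x)))"

end

theory Submission
  imports Defs "HOL-Real_Asymp.Real_Asymp"
begin

text \<open>
The constant is \<open>\<gamma> = \<pi>\<close>. The symbol satisfies \<open>e\<^sub>p \<theta> = \<theta>\<^sup>2 (1 + o(1))\<close> at 0 and is positive on \<open>(0,\<pi>]\<close>, so for
small \<open>y\<close> the set where \<open>sqrt \<omega> \<le> y\<close> is, up to a factor \<open>1 + o(1)\<close> in the direction of \<open>\<theta>\<close>, the region under
the graph of \<open>y \<phi>'\<close>. Its area is \<open>y\<close> times the integral of \<open>\<phi>'\<close>, which is 1, and therefore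
\<open>Psi_sqrt\<close> has derivative 1 at 0 (\<open>gam_eq_pi\<close>). Positivity of the symbol comes from writing the
trigonometric sums as polynomials with non-negative coefficients in the cotangent of \<open>\<theta> / 2\<close>
(\<open>spline_symbol_cotangent_polynomial\<close>).

The matrices are the Galerkin matrices of the problem \<open>- (u' / \<phi>')' = \<lambda> \<phi>' u\<close> with \<open>u(0) = u(1) = 0\<close> on the
spline space. The substitution \<open>s = \<phi>(x)\<close> turns it into \<open>- u'' = \<lambda> u\<close>, whose eigenvalues are \<open>(k \<pi>)\<^sup>2\<close>. For
a fixed \<open>k\<close> the discrete eigenvalue of index \<open>k\<close> converges to \<open>(k \<pi>)\<^sup>2\<close>, by two variational arguments:

\<^item> It is never smaller (\<open>lam_ge_laplace\<close>). The span of the first \<open>k\<close> discrete eigenfunctions contains a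
non-zero spline that vanishes at the \<open>k - 1\<close> points where \<open>\<phi>\<close> takes the values \<open>j / k\<close>. Between two such
points, Picone's identity with \<open>sin (k \<pi> \<phi>)\<close> bounds its Rayleigh quotient below by \<open>(k \<pi>)\<^sup>2\<close>
(\<open>picone_interval\<close>).

\<^item> It is not much larger for fine meshes (\<open>lam_eventually_le_laplace\<close>). Schoenberg's splines
approximate \<open>sin (j \<pi> \<phi>)\<close> uniformly together with the first derivative, and for \<open>j \<le> k\<close> they span a trial
space on which the Rayleigh quotient is at most \<open>(k \<pi>)\<^sup>2 + o(1)\<close>.

Hence every gap of fixed index is at least \<open>\<pi> - o(1)\<close>. If the index of the minimal gap stays bounded,
the minimal gap is always one of finitely many gaps of this kind, and its limes inferior is at least \<open>\<pi>\<close>.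
\<close>

section \<open>Symmetric pencils and the Rayleigh quotient\<close>

text \<open>Vectors are functions of which only the first \<open>N\<close> values count. This keeps the dimension, which
  varies with the mesh, out of the types.\<close>

definition qform :: "nat \<Rightarrow> (nat \<Rightarrow> nat \<Rightarrow> real) \<Rightarrow> (nat \<Rightarrow> real) \<Rightarrow> (nat \<Rightarrow> real) \<Rightarrow> real" where
  "qform N A v w = (\<Sum>i<N. \<Sum>j<N. A i j * v i * w j)"

lemma qform_sym:
  assumes "\<And>i j. i < N \<Longrightarrow> j < N \<Longrightarrow> A i j = A j i"
  shows "qform N A v w = qform N A w v"
proof -
  have "qform N A v w = (\<Sum>i<N. \<Sum>j<N. A j i * w j * v i)"
    unfolding qform_def by (intro sum.cong refl) (auto simp: assms)
  then show ?thesis unfolding qform_def by (subst (asm) sum.swap) auto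
qed

lemma qform_add_right: "qform N A v (\<lambda>i. w i + x i) = qform N A v w + qform N A v x"
  by (simp add: qform_def algebra_simps sum.distrib)

lemma qform_add_left: "qform N A (\<lambda>i. w i + x i) v = qform N A w v + qform N A x v"
  by (simp add: qform_def algebra_simps sum.distrib)

lemma qform_scale_right: "qform N A v (\<lambda>i. c * w i) = c * qform N A v w"
  by (simp add: qform_def algebra_simps sum_distrib_left)

lemma qform_scale_left: "qform N A (\<lambda>i. c * w i) v = c * qform N A w v"
  by (simp add: qform_def algebra_simps sum_distrib_left)

lemma qform_zero_right [simp]: "qform N A v (\<lambda>i. 0) = 0"
  by (simp add: qform_def)

lemma qform_zero_left [simp]: "qform N A (\<lambda>i. 0) v = 0"
  by (simp add: qform_def)

lemma qform_sum_right:
  fixes k :: nat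
  shows "qform N A v (\<lambda>i. \<Sum>j<k. y j * w j i) = (\<Sum>j<k. y j * qform N A v (w j))"
  by (induction k) (simp_all add: qform_add_right qform_scale_right)

lemma qform_sum_left:
  fixes k :: nat
  shows "qform N A (\<lambda>i. \<Sum>j<k. y j * w j i) v = (\<Sum>j<k. y j * qform N A (w j) v)"
  by (induction k) (simp_all add: qform_add_left qform_scale_left)

lemma qform_cong:
  "(\<And>i. i < N \<Longrightarrow> v i = v' i) \<Longrightarrow> (\<And>i. i < N \<Longrightarrow> w i = w' i) \<Longrightarrow> qform N A v w = qform N A v' w'"
  by (simp add: qform_def)

lemma continuous_on_qform [continuous_intros]:
  "continuous_on S (qform N A v)" "continuous_on S (\<lambda>w. qform N A w w)"
  unfolding qform_def
  by (intro continuous_intros continuous_on_subset[OF continuous_on_product_coordinates]; simp)+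

text \<open>Zero rows added to the coefficient matrix make it square and singular.\<close>

lemma homogeneous_system_nontrivial:
  fixes A :: "nat \<Rightarrow> nat \<Rightarrow> real"
  assumes "m < n"
  obtains y where "\<exists>j<n. y j \<noteq> 0" "\<And>i. i < m \<Longrightarrow> (\<Sum>j<n. A i j * y j) = 0"
proof -
  define B where "B = Matrix.mat n n (\<lambda>(i, j). if i < m then A i j else 0)"
  have B: "B \<in> carrier_mat n n" by (simp add: B_def)
  have Bt: "transpose_mat B \<in> carrier_mat n n" using B by simp
  have "transpose_mat B *\<^sub>v unit_vec n m = 0\<^sub>v n"
    using assms by (intro eq_vecI) (auto simp: B_def)
  moreover have "unit_vec n m \<noteq> (0\<^sub>v n :: real Matrix.vec)"
    using assms by (metis index_unit_vec(1) index_zero_vec(1) zero_neq_one)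
  ultimately have "Determinant.det (transpose_mat B) = 0"
    using det_0_iff_vec_prod_zero_field[OF Bt] unit_vec_carrier by blast
  then have "Determinant.det B = 0" using det_transpose[OF B] by simp
  then obtain v where v: "v \<in> carrier_vec n" "v \<noteq> 0\<^sub>v n" "B *\<^sub>v v = 0\<^sub>v n"
    using det_0_iff_vec_prod_zero_field[OF B] by blast
  have 1: "\<exists>j<n. vec_index v j \<noteq> 0"
    using v(1,2) by (metis carrier_vecD eq_vecI index_zero_vec)
  have "(\<Sum>j<n. A i j * vec_index v j) = 0" if "i < m" for i
  proof -
    have "(\<Sum>j<n. A i j * vec_index v j) = vec_index (B *\<^sub>v v) i"
      using that assms v(1)
      by (auto simp: B_def scalar_prod_def atLeast0LessThan intro!: sum.cong)
    then show ?thesis using v(3) that assms by simp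
  qed
  then show ?thesis using that[OF 1] by blast
qed

text \<open>First-order optimality: the quadratic polynomial in \<open>t\<close> attains its minimum at \<open>t = 0\<close>.\<close>

lemma psd_form_null_vector:
  fixes b c :: real
  assumes "\<And>t. 0 \<le> 2 * t * b + t\<^sup>2 * c"
  shows "b = 0"
proof (rule ccontr)
  assume b: "b \<noteq> 0"
  \<comment> \<open>Any \<open>s > 0\<close> with \<open>2 s > c\<close> makes the polynomial negative at \<open>- b / s\<close>.\<close>
  define s where "s = 1 + \<bar>c\<bar>"
  have s: "s > 0" "c < 2 * s" by (auto simp: s_def)
  have "0 \<le> 2 * (- b / s) * b + (- b / s)\<^sup>2 * c" by (rule assms)
  also have "\<dots> = (b / s)\<^sup>2 * (c - 2 * s)" using s by (simp add: field_simps power2_eq_square)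
  also have "\<dots> < 0" using s b by (simp add: mult_less_0_iff)
  finally show False by simp
qed

text \<open>The Euclidean unit sphere of the first \<open>N\<close> coordinates, cut by \<open>k\<close> linear conditions, is compact
  in the product topology once the other coordinates are set to zero, and it is non-empty because
  \<open>k < N\<close>. The Rayleigh quotient attains its minimum there, and homogeneity removes the normalisation.\<close>

lemma rayleigh_minimizer:
  fixes M K :: "nat \<Rightarrow> nat \<Rightarrow> real" and v :: "nat \<Rightarrow> nat \<Rightarrow> real"
  assumes pos: "\<And>w. \<exists>i<N. w i \<noteq> 0 \<Longrightarrow> 0 < qform N M w w" and kN: "k < N"
  obtains u l where "qform N M u u = 1" "\<And>i. i < k \<Longrightarrow> qform N M (v i) u = 0"
    "qform N K u u = l"
    "\<And>w. (\<And>i. i < k \<Longrightarrow> qform N M (v i) w = 0) \<Longrightarrow> l * qform N M w w \<le> qform N K w w"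
proof -
  define box where "box = (\<Pi>\<^sub>E i\<in>(UNIV::nat set). if i < N then {-1..1::real} else {0})"
  define S where "S = box \<inter> {w. (\<Sum>i<N. (w i)\<^sup>2) = 1} \<inter> {w. \<forall>i<k. qform N M (v i) w = 0}"
  define nrm where "nrm w = sqrt (\<Sum>i<N. (w i)\<^sup>2)" for w :: "nat \<Rightarrow> real"
  \<comment> \<open>Normalisation followed by truncation maps admissible vectors into the compact set \<open>S\<close>.\<close>
  define cut where "cut w = (\<lambda>i. if i < N then w i / nrm w else 0)" for w :: "nat \<Rightarrow> real"
  have nrm_pos: "nrm w > 0" if "\<exists>i<N. w i \<noteq> 0" for w
    using that unfolding nrm_def by (auto intro!: sum_pos2)
  have nrm_sq: "(nrm w)\<^sup>2 = (\<Sum>i<N. (w i)\<^sup>2)" for w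
    unfolding nrm_def by (simp add: sum_nonneg)
  have cutS: "cut w \<in> S" if w: "\<exists>i<N. w i \<noteq> 0" and o: "\<And>i. i < k \<Longrightarrow> qform N M (v i) w = 0" for w
  proof -
    have 1: "(\<Sum>i<N. (cut w i)\<^sup>2) = 1"
      using nrm_pos[OF w] by (simp add: cut_def power_divide sum_divide_distrib[symmetric] nrm_sq[symmetric])
    have "\<bar>cut w i\<bar> \<le> 1" if "i < N" for i
    proof -
      have "(cut w i)\<^sup>2 \<le> (\<Sum>i<N. (cut w i)\<^sup>2)" using that by (intro member_le_sum) auto
      then show ?thesis using 1 by (simp add: abs_square_le_1)
    qed
    then have "cut w i \<in> {-1..1}" if "i < N" for i
      using that by (fastforce dest: abs_le_D1 abs_le_D2)
    moreover have "cut w i = 0" if "\<not> i < N" for i using that by (simp add: cut_def)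
    ultimately have "cut w i \<in> (if i < N then {-1..1} else {0})" for i by simp
    then have 2: "cut w \<in> box" by (simp add: box_def PiE_def)
    have "qform N M (v i) (cut w) = 0" if "i < k" for i
    proof -
      have "qform N M (v i) (cut w) = qform N M (v i) (\<lambda>j. (1 / nrm w) * w j)"
        by (rule qform_cong) (auto simp: cut_def)
      then show ?thesis using o[OF that] by (simp only: qform_scale_right)
    qed
    with 1 2 show ?thesis by (simp add: S_def)
  qed
  have cutq: "qform N A (cut w) (cut w) = qform N A w w / (nrm w)\<^sup>2" for A w
  proof -
    have "qform N A (cut w) (cut w) = qform N A (\<lambda>j. (1 / nrm w) * w j) (\<lambda>j. (1 / nrm w) * w j)"
      by (rule qform_cong) (auto simp: cut_def)
    then show ?thesis by (simp only: qform_scale_right qform_scale_left) (simp add: power2_eq_square)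
  qed
  have "compactin (product_topology (\<lambda>i. euclidean) UNIV) box"
    unfolding box_def compactin_PiE by (auto simp: compactin_euclidean_iff)
  then have "compact box" by (simp add: euclidean_product_topology)
  moreover have "closed {w::nat \<Rightarrow> real. (\<Sum>i<N. (w i)\<^sup>2) = 1}"
    by (intro closed_Collect_eq continuous_intros continuous_on_product_coordinates)
  moreover have "{w. \<forall>i<k. qform N M (v i) w = 0} = (\<Inter>i\<in>{..<k}. {w. qform N M (v i) w = 0})" by auto
  then have "closed {w. \<forall>i<k. qform N M (v i) w = 0}"
    by (auto intro!: closed_INT closed_Collect_eq continuous_intros)
  ultimately have comp: "compact S" unfolding S_def by (intro compact_Int_closed)
  obtain y where y: "\<exists>j<N. y j \<noteq> 0"
    "\<And>i. i < k \<Longrightarrow> (\<Sum>j<N. (\<Sum>l<N. M l j * v i l) * y j) = 0"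
    by (rule homogeneous_system_nontrivial[OF kN, of "\<lambda>i j. \<Sum>l<N. M l j * v i l"]) blast
  have "qform N M (v i) y = 0" if "i < k" for i
    unfolding qform_def using y(2)[OF that] by (subst sum.swap) (simp add: sum_distrib_right)
  then have ne: "S \<noteq> {}" using cutS[OF y(1)] by blast
  have Snz: "\<exists>i<N. w i \<noteq> 0" if "w \<in> S" for w
  proof (rule ccontr)
    assume "\<not> (\<exists>i<N. w i \<noteq> 0)"
    then have "(\<Sum>i<N. (w i)\<^sup>2) = 0" by simp
    with that show False by (simp add: S_def)
  qed
  have "continuous_on S (\<lambda>w. qform N K w w / qform N M w w)"
    using pos Snz by (intro continuous_intros) force
  then obtain u where u: "u \<in> S" and
    min: "\<And>w. w \<in> S \<Longrightarrow> qform N K u u / qform N M u u \<le> qform N K w w / qform N M w w"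
    using continuous_attains_inf[OF comp ne] by blast
  define l where "l = qform N K u u / qform N M u u"
  define c where "c = 1 / sqrt (qform N M u u)"
  have Mu: "qform N M u u > 0" using pos Snz[OF u] by blast
  have cc: "c * c = 1 / qform N M u u" using Mu by (simp add: c_def)
  show ?thesis
  proof (rule that[of "\<lambda>i. c * u i" l])
    show "qform N M (\<lambda>i. c * u i) (\<lambda>i. c * u i) = 1"
      using cc Mu by (simp add: qform_scale_left qform_scale_right mult.assoc[symmetric])
    show "qform N K (\<lambda>i. c * u i) (\<lambda>i. c * u i) = l"
      using cc Mu by (simp add: qform_scale_left qform_scale_right mult.assoc[symmetric] l_def)
    show "qform N M (v i) (\<lambda>i. c * u i) = 0" if "i < k" for i
      using u that by (simp add: qform_scale_right S_def)
    show "l * qform N M w w \<le> qform N K w w" if o: "\<And>i. i < k \<Longrightarrow> qform N M (v i) w = 0" for w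
    proof (cases "\<exists>i<N. w i \<noteq> 0")
      case True
      have "l \<le> qform N K (cut w) (cut w) / qform N M (cut w) (cut w)"
        unfolding l_def using min cutS[OF True o] by blast
      also have "\<dots> = qform N K w w / qform N M w w"
        using nrm_pos[OF True] by (simp add: cutq)
      finally show ?thesis using pos[OF True] by (simp add: field_simps)
    next
      case False
      then have "qform N A w w = 0" for A by (simp add: qform_def)
      then show ?thesis by simp
    qed
  qed
qed

text \<open>Each minimiser over the complement of the earlier ones is an eigenvector: optimality gives the
  equation against the complement, and against an earlier eigenvector both sides vanish. The minimality
  of every step stays in the statement: it is the variational bound needed for the eigenvalues, and
  it shows that they are found in increasing order.\<close>

lemma generalized_eigenvectors:
  fixes M K :: "nat \<Rightarrow> nat \<Rightarrow> real"
  assumes symM: "\<And>i j. i < N \<Longrightarrow> j < N \<Longrightarrow> M i j = M j i"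
    and symK: "\<And>i j. i < N \<Longrightarrow> j < N \<Longrightarrow> K i j = K j i"
    and pos: "\<And>w. \<exists>i<N. w i \<noteq> 0 \<Longrightarrow> 0 < qform N M w w" and "k \<le> N"
  shows "\<exists>v d. (\<forall>i<k. \<forall>j<k. qform N M (v i) (v j) = (if i = j then 1 else 0))
    \<and> (\<forall>i<k. \<forall>w. qform N K (v i) w = d i * qform N M (v i) w)
    \<and> (\<forall>i<k. \<forall>w. (\<forall>j<i. qform N M (v j) w = 0) \<longrightarrow> d i * qform N M w w \<le> qform N K w w)"
  using \<open>k \<le> N\<close>
proof (induction k)
  case 0
  show ?case by simp
next
  case (Suc k)
  then obtain v d where
    on: "\<And>i j. i < k \<Longrightarrow> j < k \<Longrightarrow> qform N M (v i) (v j) = (if i = j then 1 else 0)" and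
    ev: "\<And>i w. i < k \<Longrightarrow> qform N K (v i) w = d i * qform N M (v i) w" and
    mn: "\<And>i w. i < k \<Longrightarrow> (\<forall>j<i. qform N M (v j) w = 0) \<Longrightarrow> d i * qform N M w w \<le> qform N K w w"
    by (metis Suc_leD)
  note sM = qform_sym[of N M, OF symM] and sK = qform_sym[of N K, OF symK]
  obtain u l where u: "qform N M u u = 1" "\<And>i. i < k \<Longrightarrow> qform N M (v i) u = 0"
    "qform N K u u = l"
    "\<And>w. (\<And>i. i < k \<Longrightarrow> qform N M (v i) w = 0) \<Longrightarrow> l * qform N M w w \<le> qform N K w w"
    using rayleigh_minimizer[of N M k v K] pos Suc.prems by (metis Suc_le_lessD)
  have crit: "qform N K u w = l * qform N M u w"
    if w: "\<And>i. i < k \<Longrightarrow> qform N M (v i) w = 0" for w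
  proof -
    have "0 \<le> 2 * t * (qform N K u w - l * qform N M u w) + t\<^sup>2 * (qform N K w w - l * qform N M w w)" for t
    proof -
      have "l * qform N M (\<lambda>i. u i + t * w i) (\<lambda>i. u i + t * w i)
          \<le> qform N K (\<lambda>i. u i + t * w i) (\<lambda>i. u i + t * w i)"
        by (rule u(4)) (simp add: qform_add_right qform_scale_right u(2) w)
      then show ?thesis
        using u(1,3) sM[of u w] sK[of u w]
        by (simp add: qform_add_right qform_scale_right qform_add_left qform_scale_left
            power2_eq_square algebra_simps)
    qed
    then have "qform N K u w - l * qform N M u w = 0" by (rule psd_form_null_vector)
    then show ?thesis by simp
  qed
  have evu: "qform N K u w = l * qform N M u w" for w
  proof -
    define a where "a j = qform N M (v j) w" for j
    \<comment> \<open>The component of \<open>w\<close> orthogonal to the earlier eigenvectors; the removed part does not see \<open>u\<close>.\<close>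
    define w' where "w' = (\<lambda>i. w i + (\<Sum>j<k. (- a j) * v j i))"
    have "qform N M (v i) w' = 0" if "i < k" for i
    proof -
      have "qform N M (v i) w' = a i + (\<Sum>j<k. (- a j) * qform N M (v i) (v j))"
        unfolding w'_def by (simp only: qform_add_right qform_sum_right a_def)
      also have "(\<Sum>j<k. (- a j) * qform N M (v i) (v j)) = (\<Sum>j<k. if i = j then - a j else 0)"
        using on[OF that] by (intro sum.cong) auto
      also have "a i + \<dots> = 0" using that by simp
      finally show ?thesis .
    qed
    from crit[OF this] have c: "qform N K u w' = l * qform N M u w'" .
    have M0: "qform N M u (v j) = 0" if "j < k" for j using u(2)[OF that] sM[of u "v j"] by simp
    have K0: "qform N K u (v j) = 0" if "j < k" for j
      using ev[OF that, of u] u(2)[OF that] sK[of u "v j"] by simp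
    have "qform N K u w' = qform N K u w" "qform N M u w' = qform N M u w"
      unfolding w'_def by (simp_all only: qform_add_right qform_sum_right) (simp_all add: M0 K0)
    with c show ?thesis by simp
  qed
  define v' where "v' = v(k := u)"
  define d' where "d' = d(k := l)"
  have "qform N M (v' i) (v' j) = (if i = j then 1 else 0)" if ij: "i < Suc k" "j < Suc k" for i j
    using ij on[of i j] u(1) u(2)[of i] u(2)[of j] sM[of u "v j"]
    by (cases "i = k"; cases "j = k") (simp_all add: v'_def less_Suc_eq)
  moreover have "qform N K (v' i) w = d' i * qform N M (v' i) w" if "i < Suc k" for i w
    using that ev[of i w] evu[of w] by (cases "i = k") (auto simp: v'_def d'_def less_Suc_eq)
  moreover have "d' i * qform N M w w \<le> qform N K w w"
    if "i < Suc k" "\<forall>j<i. qform N M (v' j) w = 0" for i w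
  proof (cases "i = k")
    case True
    then show ?thesis using that(2) u(4)[of w] by (simp add: v'_def d'_def)
  next
    case False
    then have "i < k" using that by simp
    then show ?thesis using that(2) mn[of i w] False by (simp add: v'_def d'_def)
  qed
  ultimately show ?case by blast
qed

lemma qform_eigen_combination:
  fixes k :: nat
  assumes on: "\<And>i j. i < k \<Longrightarrow> j < k \<Longrightarrow> qform N M (v i) (v j) = (if i = j then 1 else 0)"
    and ev: "\<And>i w. i < k \<Longrightarrow> qform N K (v i) w = d i * qform N M (v i) w"
  defines "w \<equiv> \<lambda>y i. \<Sum>j<k. y j * v j i"
  shows "qform N M (w y) (w y) = (\<Sum>j<k. (y j)\<^sup>2)" "qform N K (w y) (w y) = (\<Sum>j<k. d j * (y j)\<^sup>2)"
proof -
  have 1: "qform N M (v i) (w y) = y i" if "i < k" for i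
  proof -
    have "qform N M (v i) (w y) = (\<Sum>j<k. y j * qform N M (v i) (v j))"
      unfolding w_def by (rule qform_sum_right)
    also have "\<dots> = (\<Sum>j<k. if i = j then y j else 0)" using on[OF that] by (intro sum.cong) auto
    finally show ?thesis using that by simp
  qed
  have "qform N M (w y) (w y) = (\<Sum>j<k. y j * qform N M (v j) (w y))"
    by (subst (1) w_def) (rule qform_sum_left)
  then show "qform N M (w y) (w y) = (\<Sum>j<k. (y j)\<^sup>2)" using 1 by (simp add: power2_eq_square)
  have "qform N K (w y) (w y) = (\<Sum>j<k. y j * qform N K (v j) (w y))"
    by (subst (1) w_def) (rule qform_sum_left)
  then show "qform N K (w y) (w y) = (\<Sum>j<k. d j * (y j)\<^sup>2)"
    using 1 ev by (simp add: power2_eq_square algebra_simps)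
qed

text \<open>With the eigenvectors as columns of \<open>V\<close>, orthonormality reads \<open>V\<^sup>T M V = 1\<close> and the eigenvalue
  equations give \<open>V\<^sup>T K V = D\<close>. Hence \<open>V\<^sup>T M\<close> is the inverse of \<open>V\<close>, and \<open>M\<inverse> K = V D V\<inverse>\<close> is similar to
  the diagonal matrix \<open>D\<close>. This also shows that the spectrum is real.\<close>

lemma sorted_eigenvalues_of_pencil:
  fixes M K :: "nat \<Rightarrow> nat \<Rightarrow> real"
  assumes symM: "\<And>i j. i < N \<Longrightarrow> j < N \<Longrightarrow> M i j = M j i"
    and on: "\<And>i j. i < N \<Longrightarrow> j < N \<Longrightarrow> qform N M (v i) (v j) = (if i = j then 1 else 0)"
    and ev: "\<And>i w. i < N \<Longrightarrow> qform N K (v i) w = d i * qform N M (v i) w"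
    and mn: "\<And>i w. i < N \<Longrightarrow> (\<forall>j<i. qform N M (v j) w = 0) \<Longrightarrow> d i * qform N M w w \<le> qform N K w w"
  defines "MM \<equiv> Matrix.mat N N (\<lambda>(i, j). M i j)" and "KK \<equiv> Matrix.mat N N (\<lambda>(i, j). K i j)"
  shows "sorted_list_of_multiset (proots (char_poly (the (mat_inverse MM) * KK))) = map d [0..<N]"
proof -
  define V where "V = Matrix.mat N N (\<lambda>(i, j). v j i)"
  define D where "D = Matrix.mat N N (\<lambda>(i, j). if i = j then d i else 0)"
  have car [simp]: "MM \<in> carrier_mat N N" "KK \<in> carrier_mat N N" "V \<in> carrier_mat N N"
    "D \<in> carrier_mat N N" "transpose_mat V \<in> carrier_mat N N"
    by (auto simp: MM_def KK_def V_def D_def)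
  have entry: "(transpose_mat V * (Matrix.mat N N (\<lambda>(i, j). A i j) * V)) $$ (i, j) = qform N A (v i) (v j)"
    if "i < N" "j < N" for A i j
    using that
    by (simp add: V_def scalar_prod_def qform_def sum_distrib_left atLeast0LessThan algebra_simps)
  have VMV: "transpose_mat V * (MM * V) = 1\<^sub>m N"
    using on by (intro eq_matI) (auto simp: MM_def entry carrier_matD[OF car(5)] carrier_matD[OF car(3)] simp del: index_mult_mat(1))
  have VKV: "transpose_mat V * (KK * V) = D"
    using on ev by (intro eq_matI) (auto simp: D_def KK_def entry carrier_matD[OF car(5)] carrier_matD[OF car(3)] simp del: index_mult_mat(1))
  note [simp] = mult_carrier_mat[of _ N N _ N]
  define W where "W = transpose_mat V * MM"
  have W [simp]: "W \<in> carrier_mat N N" unfolding W_def by (rule mult_carrier_mat[OF car(5) car(1)])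
  have WV: "W * V = 1\<^sub>m N"
    unfolding W_def using VMV by (subst assoc_mult_mat[of _ N N _ N _ N]) auto
  have VW: "V * W = 1\<^sub>m N" using mat_mult_left_right_inverse[OF W car(3) WV] .
  have X: "V * transpose_mat V * MM = 1\<^sub>m N"
    using VW unfolding W_def by (subst assoc_mult_mat[of _ N N _ N _ N]) auto
  have X': "MM * (V * transpose_mat V) = 1\<^sub>m N"
    by (rule mat_mult_left_right_inverse[OF mult_carrier_mat[OF car(3) car(5)] car(1) X])
  have "mat_inverse MM \<noteq> None"
  proof
    assume "mat_inverse MM = None"
    from mat_inverse(1)[OF car(1) this, of "()"] have "MM \<notin> Units (ring_mat TYPE(real) N ())" .
    moreover have "MM \<in> Units (ring_mat TYPE(real) N ())"
      unfolding Units_def using X X' by (auto simp: ring_mat_def intro!: bexI[of _ "V * transpose_mat V"] mult_carrier_mat[OF car(3) car(5)])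
    ultimately show False by simp
  qed
  then obtain B where B: "mat_inverse MM = Some B" by auto
  from mat_inverse(2)[OF car(1) B] have BM: "MM * B = 1\<^sub>m N" "B * MM = 1\<^sub>m N" and [simp]: "B \<in> carrier_mat N N"
    by auto
  define L where "L = B * KK"
  have L [simp]: "L \<in> carrier_mat N N" unfolding L_def by (rule mult_carrier_mat[OF _ car(2)]) simp
  have "W * (L * V) = D"
  proof -
    have "W * (L * V) = transpose_mat V * (MM * (B * (KK * V)))"
      unfolding W_def L_def by (simp add: assoc_mult_mat[of _ N N _ N _ N])
    also have "MM * (B * (KK * V)) = (MM * B) * (KK * V)" by (simp add: assoc_mult_mat[of _ N N _ N _ N])
    also have "\<dots> = KK * V" using BM left_mult_one_mat[of "KK * V" N N] by simp
    finally show ?thesis using VKV by simp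
  qed
  then have "V * D * W = V * (W * (L * V)) * W" by simp
  also have "\<dots> = (V * W) * L * (V * W)" by (simp add: assoc_mult_mat[of _ N N _ N _ N])
  also have "\<dots> = L" unfolding VW left_mult_one_mat[OF L] right_mult_one_mat[OF L] ..
  finally have "similar_mat L D"
    using VW WV by (intro similar_matI[of L D V W N]) auto
  then have "char_poly L = char_poly D" by (rule char_poly_similar)
  also have "\<dots> = (\<Prod>a\<leftarrow>diag_mat D. [:- a, 1:])"
    by (rule char_poly_upper_triangular[OF car(4)]) (auto simp: upper_triangular_def D_def)
  also have "diag_mat D = map d [0..<N]" by (auto simp: diag_mat_def D_def)
  finally have char: "char_poly L = (\<Prod>a\<leftarrow>map d [0..<N]. [:- a, 1:])" .
  have roots: "proots (\<Prod>a\<leftarrow>xs. [:- a, 1:]) = mset xs" for xs :: "real list"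
  proof (induction xs)
    case (Cons a xs)
    have "(\<Prod>a\<leftarrow>xs. [:- a, 1:]) \<noteq> 0" by auto
    then show ?case using Cons by (simp del: mult_pCons_left add: proots_mult)
  qed simp
  have "sorted (map d [0..<N])"
    unfolding sorted_iff_nth_mono_less
  proof (intro allI impI)
    fix i j assume ij: "i < j" "j < length (map d [0..<N])"
    then have "d i * qform N M (v j) (v j) \<le> qform N K (v j) (v j)"
      using on by (intro mn) auto
    then show "map d [0..<N] ! i \<le> map d [0..<N] ! j" using ij on[of j j] ev[of j "v j"] by simp
  qed
  moreover have "the (mat_inverse MM) * KK = L" using B by (simp add: L_def)
  ultimately show ?thesis
    by (simp only: char roots sorted_list_of_multiset_mset sorted_sort_id)
qed

section \<open>B-splines on the open uniform knot vector\<close>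

lemma knot_mid: "n \<ge> 1 \<Longrightarrow> p \<le> i \<Longrightarrow> i \<le> p + n \<Longrightarrow> knot n p i = real (i - p) / real n"
  by (auto simp: knot_def le_less)

lemma knot_low: "i \<le> p \<Longrightarrow> knot n p i = 0"
  and knot_high: "n \<ge> 1 \<Longrightarrow> p + n \<le> i \<Longrightarrow> knot n p i = 1"
  by (auto simp: knot_def)

lemma knot_Suc_le: "n \<ge> 1 \<Longrightarrow> knot n p i \<le> knot n p (Suc i) \<and> knot n p (Suc i) \<le> knot n p i + 1 / real n"
proof -
  assume n: "n \<ge> 1"
  consider "Suc i \<le> p" | "p \<le> i" "Suc i \<le> p + n" | "p + n \<le> i" by linarith
  then show ?thesis
  proof cases
    case 2
    then have "knot n p i = real (i - p) / real n" "knot n p (Suc i) = real (i - p) / real n + 1 / real n"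
      by (simp_all add: knot_mid[OF n 2(1)] knot_mid[OF n _ 2(2)] Suc_diff_le add_divide_distrib)
    then show ?thesis by simp
  qed (use n in \<open>auto simp: knot_low knot_high\<close>)
qed

lemma knot_mono: "n \<ge> 1 \<Longrightarrow> i \<le> j \<Longrightarrow> knot n p i \<le> knot n p j"
  using knot_Suc_le by (metis lift_Suc_mono_le)

lemma knot_range: "n \<ge> 1 \<Longrightarrow> 0 \<le> knot n p i" "n \<ge> 1 \<Longrightarrow> knot n p i \<le> 1"
  using knot_mono[of n 0 i p] knot_mono[of n i "i + p + n" p]
  by (auto simp: knot_low knot_high)

lemma knot_add_le: "n \<ge> 1 \<Longrightarrow> knot n p (i + m) \<le> knot n p i + real m / real n"
proof (induction m)
  case (Suc m)
  then show ?case using knot_Suc_le[of n p "i + m"] by (simp add: add_divide_distrib)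
qed simp

lemma knot_strict: "n \<ge> 1 \<Longrightarrow> i < p + n \<Longrightarrow> p < j \<Longrightarrow> i < j \<Longrightarrow> knot n p i < knot n p j"
proof -
  assume *: "n \<ge> 1" "i < p + n" "p < j" "i < j"
  define i' where "i' = max i p"
  define j' where "j' = min j (p + n)"
  have "knot n p i \<le> knot n p i'" "knot n p j' \<le> knot n p j" using * by (auto simp: i'_def j'_def intro: knot_mono)
  moreover have "knot n p i' < knot n p j'"
  proof -
    have "p \<le> i'" "i' < j'" "j' \<le> p + n" using * by (auto simp: i'_def j'_def)
    then have "knot n p i' = real (i' - p) / real n" "knot n p j' = real (j' - p) / real n" "i' - p < j' - p"
      using *(1) by (auto intro!: knot_mid simp del: of_nat_diff)
    then show ?thesis using *(1) by (simp only:) (intro divide_strict_right_mono, auto)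
  qed
  ultimately show ?thesis by simp
qed

lemma finite_knots: "n \<ge> 1 \<Longrightarrow> finite (range (knot n p))"
proof -
  assume n: "n \<ge> 1"
  have "range (knot n p) \<subseteq> knot n p ` {..p + n}"
  proof safe
    fix i show "knot n p i \<in> knot n p ` {..p + n}"
    proof (cases "i \<le> p + n")
      case False
      then have "knot n p i = knot n p (p + n)" using knot_high[OF n, of p i] knot_high[OF n, of p "p + n"] by simp
      then show ?thesis by blast
    qed auto
  qed
  then show ?thesis using finite_subset by blast
qed

lemma bspline_support:
  assumes n: "n \<ge> 1" and "t \<notin> {knot n p j..<knot n p (j + q + 1)}"
  shows "bspline n p q j t = 0"
  using assms(2)
proof (induction q arbitrary: j)
  case (Suc q)
  have "knot n p (j + q + 1) \<le> knot n p (j + Suc q + 1)" "knot n p j \<le> knot n p (j + 1)"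
    by (rule knot_mono[OF n], simp)+
  then have "t \<notin> {knot n p j..<knot n p (j + q + 1)}" "t \<notin> {knot n p (j + 1)..<knot n p (j + 1 + q + 1)}"
    using Suc.prems by auto
  then show ?case using Suc.IH[of j] Suc.IH[of "j + 1"] by simp
qed auto

lemma bspline_empty: "n \<ge> 1 \<Longrightarrow> knot n p (j + q + 1) = knot n p j \<Longrightarrow> bspline n p q j t = 0"
  by (rule bspline_support) auto

text \<open>On the support of \<open>b\<close> both affine weights of the B-spline recursion lie in \<open>[0,1]\<close>.\<close>

lemma affine_weight_bounds:
  assumes b: "0 \<le> b" and s: "t \<notin> {x..<y} \<Longrightarrow> b = 0"
  shows "0 \<le> (t - x) / (y - x) * b" "(t - x) / (y - x) * b \<le> b"
    "0 \<le> (y - t) / (y - x) * b" "(y - t) / (y - x) * b \<le> (b::real)"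
proof -
  have "0 \<le> (t - x) / (y - x) * b \<and> (t - x) / (y - x) * b \<le> b \<and> 0 \<le> (y - t) / (y - x) * b \<and> (y - t) / (y - x) * b \<le> b"
  proof (cases "t \<in> {x..<y}")
    case False
    then have "b = 0" by (rule s)
    then show ?thesis by simp
  next
    case True
    then have c: "0 \<le> (t - x) / (y - x)" "(t - x) / (y - x) \<le> 1" "0 \<le> (y - t) / (y - x)" "(y - t) / (y - x) \<le> 1"
      by (simp_all add: divide_le_eq_1)
    show ?thesis
      using mult_nonneg_nonneg[OF c(1) b] mult_right_mono[OF c(2) b] mult_nonneg_nonneg[OF c(3) b] mult_right_mono[OF c(4) b]
      unfolding mult_1_left by blast
  qed
  then show "0 \<le> (t - x) / (y - x) * b" "(t - x) / (y - x) * b \<le> b"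
    "0 \<le> (y - t) / (y - x) * b" "(y - t) / (y - x) * b \<le> b" by blast+
qed

text \<open>Each weight of the recursion is at most 1 on the support of its spline, so a bound at most doubles
  with the degree.\<close>

lemma bspline_bounds:
  assumes n: "n \<ge> 1"
  shows "0 \<le> bspline n p q j t \<and> bspline n p q j t \<le> 2 ^ q"
proof (induction q arbitrary: j)
  case 0
  show ?case by (simp add: indicator_def)
next
  case (Suc q)
  have s: "t \<notin> {knot n p j..<knot n p (j + Suc q)} \<Longrightarrow> bspline n p q j t = 0"
    "t \<notin> {knot n p (j + 1)..<knot n p (j + Suc q + 1)} \<Longrightarrow> bspline n p q (j + 1) t = 0"
    by (rule bspline_support[OF n]; simp)+
  define A where "A = (t - knot n p j) / (knot n p (j + Suc q) - knot n p j) * bspline n p q j t"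
  define B where "B = (knot n p (j + Suc q + 1) - t) / (knot n p (j + Suc q + 1) - knot n p (j + 1)) * bspline n p q (j + 1) t"
  have "0 \<le> A" "A \<le> bspline n p q j t" "0 \<le> B" "B \<le> bspline n p q (j + 1) t"
    unfolding A_def B_def
    by (rule affine_weight_bounds(1)[OF conjunct1[OF Suc] s(1)] affine_weight_bounds(2)[OF conjunct1[OF Suc] s(1)]
        affine_weight_bounds(3)[OF conjunct1[OF Suc] s(2)] affine_weight_bounds(4)[OF conjunct1[OF Suc] s(2)], assumption)+
  moreover have "bspline n p (Suc q) j t = A + B" by (simp add: A_def B_def)
  ultimately show ?case using Suc[of j] Suc[of "j + 1"] unfolding power_Suc by linarith
qed

lemmas bspline_nonneg = bspline_bounds[THEN conjunct1]

lemma bspline_Suc_le: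
  assumes n: "n \<ge> 1"
  shows "(t - knot n p j) / (knot n p (j + Suc q) - knot n p j) * bspline n p q j t \<le> bspline n p q j t"
    "(knot n p (j + Suc q + 1) - t) / (knot n p (j + Suc q + 1) - knot n p (j + 1)) * bspline n p q (j + 1) t \<le> bspline n p q (j + 1) t"
proof -
  have s: "t \<notin> {knot n p j..<knot n p (j + Suc q)} \<Longrightarrow> bspline n p q j t = 0"
    "t \<notin> {knot n p (j + 1)..<knot n p (j + Suc q + 1)} \<Longrightarrow> bspline n p q (j + 1) t = 0"
    by (rule bspline_support[OF n]; simp)+
  show "(t - knot n p j) / (knot n p (j + Suc q) - knot n p j) * bspline n p q j t \<le> bspline n p q j t"
    by (rule affine_weight_bounds(2)[OF bspline_nonneg[OF n] s(1)])
  show "(knot n p (j + Suc q + 1) - t) / (knot n p (j + Suc q + 1) - knot n p (j + 1)) * bspline n p q (j + 1) t \<le> bspline n p q (j + 1) t"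
    by (rule affine_weight_bounds(4)[OF bspline_nonneg[OF n] s(2)])
qed

text \<open>The splines of index below \<open>p - q\<close> have empty support. In the recursion the two weights that
  multiply one spline of degree \<open>q\<close> add up to 1, so the sum for degree \<open>q + 1\<close> collapses to the one for
  degree \<open>q\<close>.\<close>

lemma bspline_partition_of_unity:
  assumes n: "n \<ge> 1" and t: "t \<in> {0..<1}" and "q \<le> p"
  shows "(\<Sum>j = p - q..<p + n. bspline n p q j t) = 1"
  using \<open>q \<le> p\<close>
proof (induction q)
  case 0
  have "(\<Sum>j = p..<p + m. indicator {knot n p j..<knot n p (j + 1)} t :: real)
      = indicator {knot n p p..<knot n p (p + m)} t" for m
  proof (induction m)
    case (Suc m)
    have "knot n p p \<le> knot n p (p + m)" "knot n p (p + m) \<le> knot n p (p + Suc m)"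
      using n by (auto intro: knot_mono)
    then show ?case using Suc by (auto simp: indicator_def)
  qed simp
  from this[of n] show ?case using t n by (simp add: knot_low knot_high)
next
  case (Suc q)
  define s where "s = p - Suc q"
  have s: "p - q = Suc s" "s < p + n" "s + q + 1 = p" using Suc.prems n by (auto simp: s_def)
  define B where "B j = bspline n p q j t" for j
  define a where "a j = (t - knot n p j) / (knot n p (j + Suc q) - knot n p j)" for j
  have rec: "bspline n p (Suc q) j t = a j * B j + (B (Suc j) - a (Suc j) * B (Suc j))" for j
  proof (cases "knot n p (j + q + 2) = knot n p (j + 1)")
    case True
    then have "B (Suc j) = 0" unfolding B_def by (intro bspline_empty[OF n]) auto
    then show ?thesis by (simp add: a_def B_def)
  next
    case False
    define d where "d = knot n p (j + q + 2) - knot n p (j + 1)"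
    have d: "d \<noteq> 0" using False by (simp add: d_def)
    have "(knot n p (j + q + 2) - t) / d = 1 - (t - knot n p (j + 1)) / d"
      using d by (simp add: field_simps) (simp add: d_def)
    then have "(knot n p (j + q + 2) - t) / d * B (Suc j) = B (Suc j) - (t - knot n p (j + 1)) / d * B (Suc j)"
      by (simp add: left_diff_distrib)
    then show ?thesis by (simp add: a_def B_def d_def)
  qed
  have B0: "B s = 0" "B (p + n) = 0"
    unfolding B_def using n s by (auto intro!: bspline_empty simp: knot_low knot_high)
  have tel: "(\<Sum>j = s..<m. bspline n p (Suc q) j t) = a s * B s - a m * B m + (\<Sum>j = Suc s..<Suc m. B j)"
    if "s \<le> m" for m using that
    by (induction m rule: dec_induct) (simp_all add: rec del: bspline.simps)
  have "(\<Sum>j = s..<p + n. bspline n p (Suc q) j t) = (\<Sum>j = Suc s..<p + n. B j)"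
    using s(2) by (subst tel) (auto simp: B0)
  then show ?case using Suc s by (simp add: B_def s_def)
qed

definition bspline_diff :: "nat \<Rightarrow> nat \<Rightarrow> nat \<Rightarrow> nat \<Rightarrow> real \<Rightarrow> real" where
  "bspline_diff n p q j t = (if q = 0 then 0 else
     real q * (bspline n p (q - 1) j t / (knot n p (j + q) - knot n p j)
       - bspline n p (q - 1) (j + 1) t / (knot n p (j + q + 1) - knot n p (j + 1))))"

lemma eventually_less_iff:
  fixes t a :: real
  assumes "t \<noteq> a"
  shows "\<forall>\<^sub>F x in nhds t. (x < a) = (t < a)"
proof (cases "t < a")
  case True
  then have "\<forall>\<^sub>F x in nhds t. x < a" by (rule order_tendstoD(2)[OF filterlim_ident])
  then show ?thesis by eventually_elim (use True in simp)
next
  case False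
  then have "t > a" using assms by simp
  then have "\<forall>\<^sub>F x in nhds t. x > a" by (rule order_tendstoD(1)[OF filterlim_ident])
  then show ?thesis by eventually_elim (use False in simp)
qed

text \<open>Induction on the degree. After differentiation of the recursion, the terms of the two outer
  splines of the lower degree agree directly. For the middle spline the two sides differ by the factor
  \<open>d2 / d2 - d1 / d1\<close>, and one of the spans \<open>d1\<close>, \<open>d2\<close> can only be 0 if that spline has empty support.\<close>

lemma bspline_has_derivative:
  assumes n: "n \<ge> 1" and t: "t \<notin> range (knot n p)"
  shows "(bspline n p q j has_real_derivative bspline_diff n p q j t) (at t)"
proof (induction q arbitrary: j)
  case 0
  have "\<forall>\<^sub>F x in nhds t. (x < knot n p j) = (t < knot n p j) \<and> (x < knot n p (j + 1)) = (t < knot n p (j + 1))"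
    using t by (intro eventually_conj eventually_less_iff) auto
  then have "\<forall>\<^sub>F x in nhds t. bspline n p 0 j x = bspline n p 0 j t"
    by eventually_elim (simp add: indicator_def not_less[symmetric])
  then have "(bspline n p 0 j has_real_derivative 0) (at t) = ((\<lambda>_. bspline n p 0 j t) has_real_derivative 0) (at t)"
    by (intro DERIV_cong_ev refl)
  then have "(bspline n p 0 j has_real_derivative 0) (at t)" by (simp del: bspline.simps)
  moreover have "bspline_diff n p 0 j t = 0" by (simp add: bspline_diff_def)
  ultimately show ?case by (simp only:)
next
  case (Suc q)
  define d1 where "d1 = knot n p (j + Suc q) - knot n p j"
  define d2 where "d2 = knot n p (j + Suc q + 1) - knot n p (j + 1)"
  define B where "B = bspline n p q"
  have D: "((\<lambda>t. (t - knot n p j) / d1 * B j t + (knot n p (j + Suc q + 1) - t) / d2 * B (j + 1) t)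
    has_real_derivative
      (1 / d1 * B j t + (t - knot n p j) / d1 * bspline_diff n p q j t)
      + (- 1 / d2 * B (j + 1) t + (knot n p (j + Suc q + 1) - t) / d2 * bspline_diff n p q (j + 1) t)) (at t)"
    unfolding B_def
    by (rule DERIV_cong[OF DERIV_add[OF DERIV_mult[OF DERIV_cdivide[OF DERIV_diff[OF DERIV_ident DERIV_const]] Suc]
          DERIV_mult[OF DERIV_cdivide[OF DERIV_diff[OF DERIV_const DERIV_ident]] Suc]]]) (simp add: mult.commute)
  have key: "(t - knot n p j) / d1 * bspline_diff n p q j t
      + (knot n p (j + Suc q + 1) - t) / d2 * bspline_diff n p q (j + 1) t
      = real q * (B j t / d1 - B (j + 1) t / d2)"
  proof (cases q)
    case 0
    then show ?thesis by (simp add: bspline_diff_def)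
  next
    case (Suc r)
    define X where "X i = bspline n p r (j + i) t / (knot n p (j + i + q) - knot n p (j + i))" for i
    have B0: "B j t = (t - knot n p j) * X 0 + (knot n p (j + q + 1) - t) * X 1"
      and B1: "B (j + 1) t = (t - knot n p (j + 1)) * X 1 + (knot n p (j + q + 2) - t) * X 2"
      by (simp_all add: B_def X_def Suc numeral_2_eq_2)
    have dB: "bspline_diff n p q j t = real q * (X 0 - X 1)"
      "bspline_diff n p q (j + 1) t = real q * (X 1 - X 2)"
      by (simp_all add: bspline_diff_def X_def Suc numeral_2_eq_2)
    show ?thesis
    proof (cases "X 1 = 0")
      case True
      show ?thesis unfolding dB B0 B1 True by (simp add: algebra_simps add_divide_distrib diff_divide_distrib)
    next
      case False
      then have "knot n p (j + 1 + q) \<noteq> knot n p (j + 1)" by (auto simp: X_def)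
      with knot_mono[OF n, of "j + 1" "j + 1 + q" p] have "knot n p (j + 1) < knot n p (j + 1 + q)" by simp
      with knot_mono[OF n, of j "j + 1" p] knot_mono[OF n, of "j + 1 + q" "j + Suc q + 1" p]
      have d: "d1 > 0" "d2 > 0" by (auto simp: d1_def d2_def)
      have T: "knot n p (j + q + 1) = d1 + knot n p j" "knot n p (j + q + 2) = d2 + knot n p (j + 1)"
        "knot n p (j + Suc q + 1) = d2 + knot n p (j + 1)"
        by (simp_all add: d1_def d2_def)
      show ?thesis unfolding dB B0 B1 T using d by (simp add: field_simps)
    qed
  qed
  have "bspline_diff n p (Suc q) j t = (1 + real q) * (B j t / d1 - B (j + 1) t / d2)"
    by (simp add: bspline_diff_def B_def d1_def d2_def)
  also have "\<dots> = (1 / d1 * B j t + (t - knot n p j) / d1 * bspline_diff n p q j t)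
      + (- 1 / d2 * B (j + 1) t + (knot n p (j + Suc q + 1) - t) / d2 * bspline_diff n p q (j + 1) t)"
  proof -
    have u: "1 / d1 * B j t = B j t / d1" "- 1 / d2 * B (j + 1) t = - (B (j + 1) t / d2)" by simp_all
    show ?thesis unfolding u using key by (simp only: distrib_right mult_1_left)
  qed
  finally have "\<dots> = bspline_diff n p (Suc q) j t" by simp
  with D show ?case by (simp add: B_def d1_def d2_def fun_eq_iff[symmetric])
qed

lemma sum_abel:
  fixes c x :: "nat \<Rightarrow> real"
  assumes "s < m"
  shows "(\<Sum>j = s..<m. c j * (x j - x (Suc j))) = c s * x s - c (m - 1) * x m + (\<Sum>j = Suc s..<m. (c j - c (j - 1)) * x j)"
proof -
  have "Suc s \<le> m" using assms by simp
  then show ?thesis by (induction m rule: dec_induct) (simp_all add: algebra_simps)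
qed

text \<open>Summation by parts: the derivative of a spline is a spline whose coefficients are scaled
  differences. The boundary terms disappear because they belong to splines with empty support.\<close>

lemma spline_derivative:
  assumes n: "n \<ge> 1" and t: "t \<notin> range (knot n p)" and q: "Suc q \<le> p"
  shows "((\<lambda>t. \<Sum>j = p - Suc q..<p + n. c j * bspline n p (Suc q) j t) has_real_derivative
    (\<Sum>j = p - q..<p + n. (c j - c (j - 1)) * (real (Suc q) / (knot n p (j + Suc q) - knot n p j) * bspline n p q j t))) (at t)"
proof -
  define s where "s = p - Suc q"
  have s: "p - q = Suc s" "s < p + n" "s + q + 1 = p" using q n by (auto simp: s_def)
  define x where "x j = real (Suc q) / (knot n p (j + Suc q) - knot n p j) * bspline n p q j t" for j
  have x0: "x s = 0" "x (p + n) = 0"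
    unfolding x_def using n s by (auto simp: knot_low knot_high)
  have "((\<lambda>t. \<Sum>j = s..<p + n. c j * bspline n p (Suc q) j t) has_real_derivative
     (\<Sum>j = s..<p + n. c j * bspline_diff n p (Suc q) j t)) (at t)"
    by (intro DERIV_sum DERIV_cmult bspline_has_derivative n t)
  also have "(\<Sum>j = s..<p + n. c j * bspline_diff n p (Suc q) j t) = (\<Sum>j = s..<p + n. c j * (x j - x (Suc j)))"
    by (intro sum.cong refl) (simp add: bspline_diff_def x_def right_diff_distrib)
  also have "\<dots> = (\<Sum>j = Suc s..<p + n. (c j - c (j - 1)) * x j)"
    by (subst sum_abel[OF s(2)]) (simp add: x0)
  finally show ?thesis using s by (simp add: s_def x_def)
qed

text \<open>A vanishing combination has a vanishing derivative, so by induction on the degree neighbouring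
  coefficients coincide; by the partition of unity their common value is 0.\<close>

lemma bspline_independent:
  assumes n: "n \<ge> 1" and "q \<le> p"
    and "\<And>t. t \<in> {0<..<1} \<Longrightarrow> t \<notin> range (knot n p) \<Longrightarrow> (\<Sum>j = p - q..<p + n. c j * bspline n p q j t) = 0"
    and "j \<in> {p - q..<p + n}"
  shows "c j = 0"
  using assms(2-)
proof (induction q arbitrary: c j)
  case 0
  then have j: "p \<le> j" "j < p + n" by auto
  define t where "t = (knot n p j + knot n p (Suc j)) / 2"
  have "knot n p j < knot n p (Suc j)" using j n by (intro knot_strict) auto
  then have t1: "knot n p j < t" "t < knot n p (Suc j)" by (auto simp: t_def)
  then have t2: "t \<in> {0<..<1}" using knot_range[OF n, of p j] knot_range[OF n, of p "Suc j"] by auto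
  have t3: "t \<notin> range (knot n p)"
  proof
    assume "t \<in> range (knot n p)"
    then obtain i where "t = knot n p i" by auto
    then show False using t1 knot_mono[OF n, of i j p] knot_mono[OF n, of "Suc j" i p]
      by (cases "i \<le> j") auto
  qed
  have "(\<Sum>i = p..<p + n. c i * bspline n p 0 i t) = (\<Sum>i = p..<p + n. if i = j then c i else 0)"
  proof (intro sum.cong refl)
    fix i
    show "c i * bspline n p 0 i t = (if i = j then c i else 0)"
      using t1 knot_mono[OF n, of "Suc i" j p] knot_mono[OF n, of "Suc j" i p]
      by (cases i j rule: linorder_cases) (auto simp: indicator_def)
  qed
  also have "\<dots> = c j" using j by simp
  finally show ?case using 0(2)[OF t2 t3] by simp
next
  case (Suc q)
  define s where "s = p - Suc q"
  have s: "p - q = Suc s" "s < p + n" "s + q + 1 = p" using Suc.prems n by (auto simp: s_def)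
  have op: "open ({0<..<1} - range (knot n p))" using finite_knots[OF n] by (intro open_Diff finite_imp_closed) auto
  have step: "(c i - c (i - 1)) * (real (Suc q) / (knot n p (i + Suc q) - knot n p i)) = 0"
    if "i \<in> {p - q..<p + n}" for i
  proof (rule Suc.IH)
    show "q \<le> p" using Suc.prems by simp
    show "i \<in> {p - q..<p + n}" by fact
    fix t :: real assume t: "t \<in> {0<..<1}" "t \<notin> range (knot n p)"
    let ?S = "(\<lambda>t. \<Sum>j = p - Suc q..<p + n. c j * bspline n p (Suc q) j t)"
    have "(?S has_real_derivative 0) (at t)"
      by (rule has_field_derivative_transform_within_open[of "\<lambda>_. 0" _ _ "{0<..<1} - range (knot n p)"])
        (use t op Suc.prems(2) in \<open>auto simp del: bspline.simps\<close>)
    from DERIV_unique[OF spline_derivative[OF n t(2) Suc.prems(1)] this]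
    show "(\<Sum>j = p - q..<p + n. (c j - c (j - 1)) * (real (Suc q) / (knot n p (j + Suc q) - knot n p j)) * bspline n p q j t) = 0"
      by (simp add: mult.assoc)
  qed
  have eq: "c i = c (i - 1)" if "i \<in> {Suc s..<p + n}" for i
  proof -
    have "knot n p i < knot n p (i + Suc q)" using that n s by (intro knot_strict) auto
    then show ?thesis using step[of i] that s by auto
  qed
  have const: "c i = c s" if "s \<le> i" "i < p + n" for i
    using that
  proof (induction i rule: dec_induct)
    case (step i)
    then show ?case using eq[of "Suc i"] by auto
  qed simp
  obtain t where t: "t \<in> {0<..<1} - range (knot n p)"
  proof -
    have "infinite ({0<..<1} - range (knot n p))"
      using finite_knots[OF n, of p] infinite_Ioo[of 0 "1::real"] by (intro Diff_infinite_finite) auto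
    then show ?thesis using that by (metis finite.emptyI ex_in_conv)
  qed
  have "0 = (\<Sum>i = p - Suc q..<p + n. c i * bspline n p (Suc q) i t)" using Suc.prems(2) t by (simp del: bspline.simps)
  also have "\<dots> = (\<Sum>i = p - Suc q..<p + n. c s * bspline n p (Suc q) i t)"
    by (intro sum.cong refl arg_cong2[where f = "(*)"] const) (auto simp: s_def)
  also have "\<dots> = c s" using bspline_partition_of_unity[OF n _ Suc.prems(1), of t] t
    by (simp add: sum_distrib_left[symmetric] del: bspline.simps)
  finally show ?case using const[of j] Suc.prems(3) by (simp add: s_def)
qed

text \<open>The hypothesis says that at most \<open>q\<close> of the knots \<open>t\<^sub>j, \<dots>, t\<^sub>j\<^sub>+\<^sub>q\<^sub>+\<^sub>1\<close> are equal to 0. It passes to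
  the second term of the recursion, and to the first one unless \<open>t\<^sub>j = 0\<close> has too high a multiplicity; then
  the weight itself has the factor \<open>t\<close>.\<close>

lemma bspline_near_0:
  assumes n: "n \<ge> 1" and "p + 1 \<le> j + q"
  shows "\<exists>C. \<forall>t. bspline n p q j t \<le> C * \<bar>t\<bar>"
  using assms(2)
proof (induction q arbitrary: j)
  case 0
  have k: "knot n p (p + 1) = 1 / n" using n by (simp add: knot_mid)
  have "bspline n p 0 j t \<le> real n * \<bar>t\<bar>" for t
  proof (cases "t \<in> {knot n p j..<knot n p (j + 1)}")
    case True
    then have "1 / n \<le> t" using knot_mono[OF n, of "p + 1" j p] 0 k by auto
    then have "1 / n \<le> \<bar>t\<bar>" by linarith
    then show ?thesis using True n by (simp add: field_simps)
  qed (auto simp: indicator_def)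
  then show ?case by blast
next
  case (Suc q)
  let ?w = "\<lambda>t. (t - knot n p j) / (knot n p (j + Suc q) - knot n p j)"
  obtain C1 where C1: "\<And>t. bspline n p q (j + 1) t \<le> C1 * \<bar>t\<bar>" using Suc.IH[of "j + 1"] Suc.prems by auto
  have "\<exists>C. \<forall>t. ?w t * bspline n p q j t \<le> C * \<bar>t\<bar>"
  proof (cases "p + 1 \<le> j + q")
    case True
    then obtain C where "\<forall>t. bspline n p q j t \<le> C * \<bar>t\<bar>" using Suc.IH by blast
    then show ?thesis using bspline_Suc_le(1)[OF n, of _ p j q] by (meson order_trans)
  next
    case False
    then have "j \<le> p" by simp
    then have k: "knot n p j = 0" "knot n p (j + Suc q) \<ge> 0" using knot_range[OF n] by (auto simp: knot_low)
    have "t / knot n p (j + Suc q) * bspline n p q j t \<le> (1 / knot n p (j + Suc q) * 2 ^ q) * \<bar>t\<bar>" for t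
    proof -
      have "t / knot n p (j + Suc q) * bspline n p q j t = t * (bspline n p q j t / knot n p (j + Suc q))" by simp
      also have "\<dots> \<le> \<bar>t\<bar> * (2 ^ q / knot n p (j + Suc q))"
        using bspline_bounds[OF n, of p q j t] k by (intro mult_mono divide_right_mono) auto
      finally show ?thesis by (simp add: mult.commute)
    qed
    then show ?thesis using k(1) by (metis diff_zero)
  qed
  then obtain C2 where C2: "\<And>t. ?w t * bspline n p q j t \<le> C2 * \<bar>t\<bar>" by blast
  have "bspline n p (Suc q) j t \<le> (C2 + C1) * \<bar>t\<bar>" for t
    using C2[of t] C1[of t] bspline_Suc_le(2)[OF n, of p j q t] by (simp add: distrib_right)
  then show ?case by blast
qed

text \<open>The mirror image of the estimate at 0. The hypothesis excludes the last non-zero spline, which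
  has left limit 1 at the point 1.\<close>

lemma bspline_near_1:
  assumes n: "n \<ge> 1" and "j + 2 \<le> p + n"
  shows "\<exists>C. \<forall>t. bspline n p q j t \<le> C * \<bar>1 - t\<bar>"
  using assms(2)
proof (induction q arbitrary: j)
  case 0
  have k: "knot n p (p + (n - 1)) = 1 - 1 / n" using n by (simp add: knot_mid field_simps of_nat_diff)
  have "bspline n p 0 j t \<le> real n * \<bar>1 - t\<bar>" for t
  proof (cases "t \<in> {knot n p j..<knot n p (j + 1)}")
    case True
    moreover have "knot n p (j + 1) \<le> knot n p (p + (n - 1))" using 0 n by (intro knot_mono) auto
    ultimately have "1 / n \<le> \<bar>1 - t\<bar>" using k by auto
    then show ?thesis using True n by (simp add: field_simps)
  qed (auto simp: indicator_def)
  then show ?case by blast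
next
  case (Suc q)
  let ?w = "\<lambda>t. (knot n p (j + Suc q + 1) - t) / (knot n p (j + Suc q + 1) - knot n p (j + 1))"
  obtain C1 where C1: "\<And>t. bspline n p q j t \<le> C1 * \<bar>1 - t\<bar>" using Suc.IH[of j] Suc.prems by auto
  have "\<exists>C. \<forall>t. ?w t * bspline n p q (j + 1) t \<le> C * \<bar>1 - t\<bar>"
  proof (cases "j + 3 \<le> p + n")
    case True
    then obtain C where "\<forall>t. bspline n p q (j + 1) t \<le> C * \<bar>1 - t\<bar>" using Suc.IH[of "j + 1"] by auto
    then show ?thesis using bspline_Suc_le(2)[OF n, of p j q] by (meson order_trans)
  next
    case False
    then have j: "p + n \<le> j + 2" by simp
    define d where "d = knot n p (j + Suc q + 1) - knot n p (j + 1)"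
    have k: "knot n p (j + Suc q + 1) = 1" "d \<ge> 0" using knot_mono[OF n, of "j + 1" "j + Suc q + 1" p] j n
      by (auto simp: d_def knot_high)
    have "(1 - t) / d * bspline n p q (j + 1) t \<le> (1 / d * 2 ^ q) * \<bar>1 - t\<bar>" for t
    proof -
      have "(1 - t) / d * bspline n p q (j + 1) t = (1 - t) * (bspline n p q (j + 1) t / d)" by simp
      also have "\<dots> \<le> \<bar>1 - t\<bar> * (2 ^ q / d)"
        using bspline_bounds[OF n, of p q "j + 1" t] k by (intro mult_mono divide_right_mono) auto
      finally show ?thesis by (simp add: mult.commute)
    qed
    then show ?thesis using k(1) unfolding d_def by metis
  qed
  then obtain C2 where C2: "\<And>t. ?w t * bspline n p q (j + 1) t \<le> C2 * \<bar>1 - t\<bar>" by blast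
  have "bspline n p (Suc q) j t \<le> (C1 + C2) * \<bar>1 - t\<bar>" for t
    using C2[of t] C1[of t] bspline_Suc_le(1)[OF n, of t p j q] by (simp add: distrib_right)
  then show ?case by blast
qed

text \<open>Degree one is where continuity starts: the indicator functions of degree zero jump. The two side
  conditions say that \<open>\<tau>\<close> is not a double knot, at which a hat function jumps too.\<close>

lemma hat_isCont:
  fixes a b c \<tau> :: real
  assumes "a \<le> b" "b \<le> c" "\<not> (a = b \<and> \<tau> = b)" "\<not> (b = c \<and> \<tau> = b)"
  shows "isCont (\<lambda>t. (t - a) / (b - a) * indicator {a..<b} t + (c - t) / (c - b) * indicator {b..<c} t) \<tau>"
    (is "isCont ?h \<tau>")
proof -
  have left: "?h t = max 0 ((t - a) * inverse (b - a))" if "t < b" for t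
    using that assms(1) by (cases "a \<le> t") (auto simp: indicator_def divide_inverse max_def mult_le_0_iff zero_le_mult_iff)
  have right: "?h t = max 0 ((c - t) * inverse (c - b))" if "b \<le> t" for t
    using that assms(2) by (cases "t < c") (auto simp: indicator_def divide_inverse max_def mult_le_0_iff zero_le_mult_iff)
  show ?thesis
  proof (cases "\<tau> = b")
    case True
    then have abc: "a < b" "b < c" using assms by auto
    have "?h = (\<lambda>t. max 0 (min ((t - a) * inverse (b - a)) ((c - t) * inverse (c - b))))"
    proof
      fix t
      show "?h t = max 0 (min ((t - a) * inverse (b - a)) ((c - t) * inverse (c - b)))"
      proof (cases "t < b")
        case True
        have "(t - a) * inverse (b - a) \<le> 1" "1 \<le> (c - t) * inverse (c - b)"
          using True abc by (simp_all add: divide_inverse[symmetric])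
        then have "min ((t - a) * inverse (b - a)) ((c - t) * inverse (c - b)) = (t - a) * inverse (b - a)" by linarith
        then show ?thesis using left[OF True] by (simp only:)
      next
        case False
        have "1 \<le> (t - a) * inverse (b - a)" "(c - t) * inverse (c - b) \<le> 1"
          using False abc by (simp_all add: divide_inverse[symmetric])
        then have "min ((t - a) * inverse (b - a)) ((c - t) * inverse (c - b)) = (c - t) * inverse (c - b)" by linarith
        then show ?thesis using right[of t] False by simp
      qed
    qed
    then show ?thesis by (simp only:) (intro continuous_intros)
  next
    case False
    let ?g = "\<lambda>t. if \<tau> < b then max 0 ((t - a) * inverse (b - a)) else max 0 ((c - t) * inverse (c - b))"
    have "\<forall>\<^sub>F t in nhds \<tau>. ?h t = ?g t"
      using eventually_less_iff[OF False]
    proof eventually_elim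
      case (elim t)
      show ?case
      proof (cases "\<tau> < b")
        case True
        then have "t < b" using elim by blast
        from left[OF this] True show ?thesis by (simp only: if_True)
      next
        case False
        then have "b \<le> t" using elim by linarith
        from right[OF this] False show ?thesis by (simp only: if_False)
      qed
    qed
    moreover have "isCont ?g \<tau>"
      by (cases "\<tau> < b") (simp_all only: if_True if_False, (intro continuous_max continuous_mult continuous_diff continuous_const continuous_ident)+)
    ultimately show ?thesis by (simp only: isCont_cong)
  qed
qed

text \<open>Interior knots are simple, so the hat functions are continuous there, and the recursion preserves
  continuity.\<close>

lemma bspline_isCont_interior:
  assumes n: "n \<ge> 1" and \<tau>: "\<tau> \<in> {0<..<1}"
  shows "isCont (bspline n p (Suc q) j) \<tau>"
proof (induction q arbitrary: j)
  case 0
  have simple: "\<not> (knot n p i = knot n p (i + 1) \<and> \<tau> = knot n p (i + 1))" for i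
    using \<tau> n knot_strict[OF n, of i p "i + 1"]
    by (cases "i + 1 \<le> p"; cases "i < p + n") (auto simp: knot_low knot_high)
  show ?case
    using hat_isCont[of "knot n p j" "knot n p (j + 1)" "knot n p (j + 2)" \<tau>] simple[of j] simple[of "j + 1"]
      knot_mono[OF n, of j "j + 1" p] knot_mono[OF n, of "j + 1" "j + 2" p]
    by (simp add: numeral_2_eq_2)
next
  case (Suc q)
  have "bspline n p (Suc (Suc q)) j = (\<lambda>t. (t - knot n p j) * inverse (knot n p (j + Suc (Suc q)) - knot n p j) * bspline n p (Suc q) j t
   + (knot n p (j + Suc (Suc q) + 1) - t) * inverse (knot n p (j + Suc (Suc q) + 1) - knot n p (j + 1)) * bspline n p (Suc q) (j + 1) t)"
    by (rule ext) (simp only: bspline.simps(2)[of n p "Suc q"] divide_inverse)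
  then show ?case
    by (simp only:) (intro continuous_mult continuous_add continuous_diff continuous_const continuous_ident Suc)
qed

lemma isCont_linear_bound:
  fixes f :: "real \<Rightarrow> real"
  assumes "\<And>t. 0 \<le> f t" "\<And>t. f t \<le> C * \<bar>a - t\<bar>"
  shows "isCont f a" "f a = 0"
proof -
  show 0: "f a = 0" using assms(1,2)[of a] by simp
  have "((\<lambda>t. C * \<bar>a - t\<bar>) \<longlongrightarrow> C * \<bar>a - a\<bar>) (at a)" by (intro tendsto_intros)
  then have "(f \<longlongrightarrow> 0) (at a)" using assms by (intro tendsto_sandwich[of "\<lambda>_. 0" f _ "\<lambda>t. C * \<bar>a - t\<bar>"]) auto
  then show "isCont f a" by (simp add: isCont_def 0)
qed

lemma bspline_vanish_ends:
  assumes n: "n \<ge> 1" and j: "1 \<le> j" "j + 2 \<le> p + n"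
  shows "bspline n p p j 0 = 0" "bspline n p p j 1 = 0" "isCont (bspline n p p j) 0" "isCont (bspline n p p j) 1"
proof -
  obtain C1 C2 where "\<And>t. bspline n p p j t \<le> C1 * \<bar>t\<bar>" "\<And>t. bspline n p p j t \<le> C2 * \<bar>1 - t\<bar>"
    using bspline_near_0[OF n, of p j p] bspline_near_1[OF n j(2), of p] j by auto
  then show "bspline n p p j 0 = 0" "bspline n p p j 1 = 0" "isCont (bspline n p p j) 0" "isCont (bspline n p p j) 1"
    using isCont_linear_bound[of "bspline n p p j" C1 0] isCont_linear_bound[of "bspline n p p j" C2 1]
      bspline_nonneg[OF n, of p p j] by auto
qed

lemma continuous_on_bspline:
  assumes n: "n \<ge> 1" and p: "p \<ge> 1" and j: "1 \<le> j" "j + 2 \<le> p + n"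
  shows "continuous_on {0..1} (bspline n p p j)"
proof (intro continuous_at_imp_continuous_on ballI)
  fix x :: real assume "x \<in> {0..1}"
  then consider "x = 0" | "x = 1" | "x \<in> {0<..<1}" by fastforce
  then show "isCont (bspline n p p j) x"
    using bspline_vanish_ends[OF n j] bspline_isCont_interior[OF n, of x p "p - 1" j] p by cases auto
qed

lemma borel_measurable_bspline [measurable]: "bspline n p q j \<in> borel_measurable borel"
proof (induction q arbitrary: j)
  case 0
  have "bspline n p 0 j = indicator {knot n p j..<knot n p (j + 1)}" by (simp add: fun_eq_iff)
  then show ?case by simp
next
  case (Suc q)
  note [measurable] = Suc
  have "bspline n p (Suc q) j = (\<lambda>t. (t - knot n p j) / (knot n p (j + Suc q) - knot n p j) * bspline n p q j t
   + (knot n p (j + Suc q + 1) - t) / (knot n p (j + Suc q + 1) - knot n p (j + 1)) * bspline n p q (j + 1) t)"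
    by (simp add: fun_eq_iff)
  also have "\<dots> \<in> borel_measurable borel" by measurable
  finally show ?case .
qed

section \<open>Schoenberg's spline approximation\<close>

text \<open>The Greville abscissae, at which Schoenberg's operator samples a function.\<close>

definition greville :: "nat \<Rightarrow> nat \<Rightarrow> nat \<Rightarrow> real" where
  "greville n p j = (\<Sum>i = 1..p. knot n p (j + i)) / real p"

lemma greville_bounds:
  assumes n: "n \<ge> 1" and p: "p \<ge> 1"
  shows "knot n p (j + 1) \<le> greville n p j" "greville n p j \<le> knot n p (j + p)"
proof -
  have "(\<Sum>i = 1..p. knot n p (j + 1)) \<le> (\<Sum>i = 1..p. knot n p (j + i))"
    by (intro sum_mono knot_mono n) auto
  then show "knot n p (j + 1) \<le> greville n p j" using p by (simp add: greville_def field_simps)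
  have "(\<Sum>i = 1..p. knot n p (j + i)) \<le> (\<Sum>i = 1..p. knot n p (j + p))"
    by (intro sum_mono knot_mono n) auto
  then show "greville n p j \<le> knot n p (j + p)" using p by (simp add: greville_def field_simps)
qed

text \<open>This spacing is what turns the coefficients of the derivative of Schoenberg's spline into
  difference quotients.\<close>

lemma greville_Suc:
  "p \<ge> 1 \<Longrightarrow> greville n p (Suc j) - greville n p j = (knot n p (Suc j + p) - knot n p (Suc j)) / real p"
proof -
  assume p: "p \<ge> 1"
  have "(\<Sum>i = 1..m. knot n p (Suc j + i)) - (\<Sum>i = 1..m. knot n p (j + i)) = knot n p (Suc j + m) - knot n p (Suc j)" for m
    by (induction m) auto
  from this[of p] show ?thesis by (simp only: greville_def diff_divide_distrib[symmetric])
qed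

lemma greville_range: "n \<ge> 1 \<Longrightarrow> p \<ge> 1 \<Longrightarrow> greville n p j \<in> {0..1}"
  using greville_bounds[of n p j] knot_range[of n p "j + 1"] knot_range[of n p "j + p"] by auto

lemma greville_ends: 
  assumes "n \<ge> 1" "p \<ge> 1"
  shows "greville n p 0 = 0" "greville n p (p + n - 1) = 1"
  using assms greville_bounds[of n p 0] greville_bounds[of n p "p + n - 1"] by (auto simp: knot_low knot_high)

lemma convex_combination_close:
  fixes b :: "nat \<Rightarrow> real"
  assumes "finite J" "\<And>j. j \<in> J \<Longrightarrow> 0 \<le> b j" "(\<Sum>j\<in>J. b j) = 1" "\<And>j. j \<in> J \<Longrightarrow> b j \<noteq> 0 \<Longrightarrow> \<bar>x j - y\<bar> \<le> e"
  shows "\<bar>(\<Sum>j\<in>J. x j * b j) - y\<bar> \<le> e"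
proof -
  have "(\<Sum>j\<in>J. x j * b j) - y = (\<Sum>j\<in>J. (x j - y) * b j)"
    using assms(3) by (simp add: left_diff_distrib sum_subtractf sum_distrib_left[symmetric])
  also have "\<bar>\<dots>\<bar> \<le> (\<Sum>j\<in>J. \<bar>(x j - y) * b j\<bar>)" by (rule sum_abs)
  also have "\<dots> \<le> (\<Sum>j\<in>J. e * b j)"
  proof (intro sum_mono)
    fix j assume "j \<in> J"
    then show "\<bar>(x j - y) * b j\<bar> \<le> e * b j" using assms(2,4)[of j]
      by (cases "b j = 0") (auto simp: abs_mult intro!: mult_right_mono)
  qed
  also have "\<dots> = e" using assms(3) by (simp add: sum_distrib_left[symmetric])
  finally show ?thesis .
qed

text \<open>The value of Schoenberg's spline at \<open>t\<close> is a convex combination of samples taken at points that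
  share a spline support with \<open>t\<close>.\<close>

lemma schoenberg_value:
  assumes n: "n \<ge> 1" and p: "p \<ge> 1" and t: "t \<in> {0..<1}"
    and f: "\<And>x. x \<in> {0..1} \<Longrightarrow> \<bar>x - t\<bar> \<le> real (p + 1) / real n \<Longrightarrow> \<bar>f x - f t\<bar> \<le> e"
  shows "\<bar>(\<Sum>j = 0..<p + n. f (greville n p j) * bspline n p p j t) - f t\<bar> \<le> e"
proof (rule convex_combination_close)
  show "(\<Sum>j = 0..<p + n. bspline n p p j t) = 1" using bspline_partition_of_unity[OF n t, of p p] by simp
  fix j assume "bspline n p p j t \<noteq> 0"
  then have "knot n p j \<le> t" "t < knot n p (j + p + 1)" using bspline_support[OF n, of t p j p] by force+
  moreover have "knot n p (j + p + 1) \<le> knot n p j + real (p + 1) / real n" using knot_add_le[OF n, of p j "p + 1"] by simp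
  moreover have "knot n p j \<le> knot n p (j + 1)" "knot n p (j + p) \<le> knot n p (j + p + 1)" by (auto intro: knot_mono[OF n])
  ultimately have "\<bar>greville n p j - t\<bar> \<le> real (p + 1) / real n"
    using greville_bounds[OF n p, of j] by linarith
  then show "\<bar>f (greville n p j) - f t\<bar> \<le> e" using greville_range[OF n p] by (intro f) 
qed (auto intro: bspline_nonneg n)

text \<open>The derivative of Schoenberg's spline is a convex combination of difference quotients of \<open>f\<close>, and
  each of them is, by the mean value theorem, a value of \<open>f'\<close> at a point near \<open>t\<close>.\<close>

lemma schoenberg_derivative:
  assumes n: "n \<ge> 1" and p: "p \<ge> 1" and t: "t \<in> {0<..<1}" "t \<notin> range (knot n p)"
    and cont: "continuous_on {0..1} f"
    and der: "\<And>x. x \<in> {0<..<1} \<Longrightarrow> (f has_real_derivative f' x) (at x)"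
    and f': "\<And>x. x \<in> {0..1} \<Longrightarrow> \<bar>x - t\<bar> \<le> real (p + 1) / real n \<Longrightarrow> \<bar>f' x - f' t\<bar> \<le> e"
  obtains D where "((\<lambda>t. \<Sum>j = 0..<p + n. f (greville n p j) * bspline n p p j t) has_real_derivative D) (at t)"
    "\<bar>D - f' t\<bar> \<le> e"
proof -
  define q where "q = p - 1"
  have pq: "p = Suc q" using p by (simp add: q_def)
  define x where "x j = (f (greville n p j) - f (greville n p (j - 1))) * (real p / (knot n p (j + p) - knot n p j))" for j
  have D: "((\<lambda>t. \<Sum>j = 0..<p + n. f (greville n p j) * bspline n p p j t) has_real_derivative
     (\<Sum>j = 1..<p + n. x j * bspline n p q j t)) (at t)"
    using spline_derivative[OF n t(2), of q "\<lambda>j. f (greville n p j)"] pq by (simp add: x_def mult.assoc)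
  have "\<bar>(\<Sum>j = 1..<p + n. x j * bspline n p q j t) - f' t\<bar> \<le> e"
  proof (rule convex_combination_close)
    show "(\<Sum>j = 1..<p + n. bspline n p q j t) = 1"
      using bspline_partition_of_unity[OF n, of t q p] t(1) pq by simp
    fix j assume j: "j \<in> {1..<p + n}" and "bspline n p q j t \<noteq> 0"
    then have "knot n p j \<le> t" "t < knot n p (j + q + 1)" using bspline_support[OF n, of t p j q] by force+
    then have kt: "knot n p j \<le> t" "t < knot n p (j + p)" by (auto simp: pq)
    have kle: "knot n p (j + p) \<le> knot n p j + real (p + 1) / real n"
      using knot_add_le[OF n, of p j p] divide_right_mono[of "real p" "real (p + 1)" "real n"] by simp
    have g: "greville n p j - greville n p (j - 1) = (knot n p (j + p) - knot n p j) / real p"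
      using greville_Suc[OF p, of n "j - 1"] j by simp
    have "0 < (knot n p (j + p) - knot n p j) / real p" using kt p by (intro divide_pos_pos) auto
    with g have lt: "greville n p (j - 1) < greville n p j" by linarith
    obtain z where z: "greville n p (j - 1) < z" "z < greville n p j"
      "f (greville n p j) - f (greville n p (j - 1)) = f' z * (greville n p j - greville n p (j - 1))"
    proof (rule mvt[OF lt, of f "\<lambda>z. (*) (f' z)"])
      show "continuous_on {greville n p (j - 1)..greville n p j} f"
        using greville_range[OF n p, of j] greville_range[OF n p, of "j - 1"]
        by (intro continuous_on_subset[OF cont]) auto
      show "(f has_derivative (*) (f' z)) (at z)" if "greville n p (j - 1) < z" "z < greville n p j" for z
        using der[of z] that greville_range[OF n p, of j] greville_range[OF n p, of "j - 1"]
        by (simp add: has_field_derivative_def)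
    qed blast
    have "x j = f' z" unfolding x_def z(3) g using kt p by (simp add: field_simps)
    moreover have "\<bar>f' z - f' t\<bar> \<le> e"
    proof (rule f')
      show "z \<in> {0..1}" using z greville_range[OF n p, of j] greville_range[OF n p, of "j - 1"] by simp
      show "\<bar>z - t\<bar> \<le> real (p + 1) / real n"
        using z kt kle greville_bounds[OF n p, of j] greville_bounds[OF n p, of "j - 1"] j by simp
    qed
    ultimately show "\<bar>x j - f' t\<bar> \<le> e" by simp
  qed (auto intro: bspline_nonneg n)
  with D show ?thesis by (rule that)
qed

section \<open>Cardinal B-splines and the symbol\<close>

lemma cardinal_bspline_support: "x \<notin> {0..<real q + 1} \<Longrightarrow> cardinal_bspline q x = 0"
  by (induction q arbitrary: x) (auto simp: indicator_def)

lemma cardinal_bspline_1: "cardinal_bspline (Suc 0) x = max 0 x - 2 * max 0 (x - 1) + max 0 (x - 2)"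
  by (auto simp: indicator_def max_def)

lemma cardinal_bspline_2:
  "cardinal_bspline (Suc (Suc 0)) x
    = ((max 0 x)\<^sup>2 - 3 * (max 0 (x - 1))\<^sup>2 + 3 * (max 0 (x - 2))\<^sup>2 - (max 0 (x - 3))\<^sup>2) / 2"
  unfolding cardinal_bspline.simps(2)[of "Suc 0"] cardinal_bspline_1
  by (auto simp: max_def power2_eq_square field_simps)

lemma DERIV_max_square: "((\<lambda>x::real. (max 0 (x - a))\<^sup>2) has_real_derivative 2 * max 0 (x - a)) (at x)"
proof -
  consider "x < a" | "x = a" | "x > a" by linarith
  then show ?thesis
  proof cases
    case 1
    have "((\<lambda>x. (max 0 (x - a))\<^sup>2) has_real_derivative 0) (at x)"
      by (rule has_field_derivative_transform_within_open[of "\<lambda>_. 0" _ _ "{..<a}"]) (use 1 in auto)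
    then show ?thesis using 1 by simp
  next
    case 2
    have "((\<lambda>h. max 0 h) \<longlongrightarrow> max 0 (0::real)) (at 0)" by (intro tendsto_intros)
    moreover have "\<forall>\<^sub>F h in at (0::real). max 0 h = ((max 0 (a + h - a))\<^sup>2 - (max 0 (a - a))\<^sup>2) / h"
      by (auto simp: eventually_at_filter max_def power2_eq_square)
    ultimately have "((\<lambda>h. ((max 0 (a + h - a))\<^sup>2 - (max 0 (a - a))\<^sup>2) / h) \<longlongrightarrow> 0) (at 0)"
      using Lim_transform_eventually by force
    then show ?thesis using 2 by (simp add: DERIV_def)
  next
    case 3
    have "((\<lambda>x. (x - a)\<^sup>2) has_real_derivative 2 * (x - a)) (at x)"
      by (rule derivative_eq_intros refl | simp)+
    then have "((\<lambda>x. (max 0 (x - a))\<^sup>2) has_real_derivative 2 * (x - a)) (at x)"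
      by (rule has_field_derivative_transform_within_open[of _ _ _ "{a<..}"]) (use 3 in auto)
    then show ?thesis using 3 by simp
  qed
qed

text \<open>For degree two, where the lower splines have corners, the formula is read off from the truncated
  powers; above that, differentiation of the recursion reproduces the recursion.\<close>

lemma cardinal_bspline_has_derivative:
  "(cardinal_bspline (Suc (Suc r)) has_real_derivative
     cardinal_bspline (Suc r) x - cardinal_bspline (Suc r) (x - 1)) (at x)"
proof (induction r arbitrary: x)
  case 0
  have "((\<lambda>x. ((max 0 x)\<^sup>2 - 3 * (max 0 (x - 1))\<^sup>2 + 3 * (max 0 (x - 2))\<^sup>2 - (max 0 (x - 3))\<^sup>2) / 2)
    has_real_derivative (2 * max 0 (x - 0) - 3 * (2 * max 0 (x - 1)) + 3 * (2 * max 0 (x - 2)) - 2 * max 0 (x - 3)) / 2) (at x)"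
    by (intro DERIV_cdivide DERIV_add DERIV_diff DERIV_cmult DERIV_max_square DERIV_max_square[of 0, simplified])
       (use DERIV_max_square[of 0 x] in simp)
  moreover have "(2 * max 0 (x - 0) - 3 * (2 * max 0 (x - 1)) + 3 * (2 * max 0 (x - 2)) - 2 * max 0 (x - 3)) / 2
      = cardinal_bspline (Suc 0) x - cardinal_bspline (Suc 0) (x - 1)"
    unfolding cardinal_bspline_1 by (simp add: field_simps)
  ultimately show ?case unfolding cardinal_bspline_2[abs_def] by (simp only:)
next
  case (Suc r)
  define q where "q = Suc (Suc r)"
  define c where "c = real (Suc q)"
  define N where "N = cardinal_bspline q"
  define N1 where "N1 = cardinal_bspline (Suc r)"
  have c: "c > 0" "c = real q + 1" by (simp_all add: c_def)
  have D: "(N has_real_derivative N1 x - N1 (x - 1)) (at x)" for x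
    unfolding N_def N1_def q_def by (rule Suc.IH)
  have D1: "((\<lambda>x. N (x - 1)) has_real_derivative (N1 (x - 1) - N1 (x - 2))) (at x)"
    using DERIV_shift[of N "N1 (x - 1) - N1 (x - 2)" x "-1"] D[of "x - 1"] by simp
  have rec: "real q * N y = y * N1 y + (real q + 1 - y) * N1 (y - 1)" for y
  proof -
    have "real q \<noteq> 0" by (simp add: q_def)
    moreover have "N y = y / real q * N1 y + (real q + 1 - y) / real q * N1 (y - 1)"
      unfolding N_def N1_def by (simp add: q_def del: cardinal_bspline.simps add: cardinal_bspline.simps(2)[of "Suc r"])
    ultimately show ?thesis by (simp add: distrib_left)
  qed
  have "((\<lambda>x. x / c * N x + (c + 1 - x) / c * N (x - 1)) has_real_derivative
      (1 / c * N x + x / c * (N1 x - N1 (x - 1)))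
      + (- 1 / c * N (x - 1) + (c + 1 - x) / c * (N1 (x - 1) - N1 (x - 2)))) (at x)"
    by (rule DERIV_cong[OF DERIV_add[OF DERIV_mult[OF DERIV_cdivide[OF DERIV_ident] D]
          DERIV_mult[OF DERIV_cdivide[OF DERIV_diff[OF DERIV_const DERIV_ident]] D1]]]) (simp add: mult.commute)
  moreover have "(1 / c * N x + x / c * (N1 x - N1 (x - 1)))
      + (- 1 / c * N (x - 1) + (c + 1 - x) / c * (N1 (x - 1) - N1 (x - 2)))
      = (N x + real q * N x - N (x - 1) - real q * N (x - 1)) / c"
    unfolding rec using c(2) by (simp add: add_divide_distrib diff_divide_distrib algebra_simps)
  moreover have "\<dots> = N x - N (x - 1)" using c by (simp add: field_simps)
  moreover have "(\<lambda>x. x / c * N x + (c + 1 - x) / c * N (x - 1)) = cardinal_bspline (Suc q)"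
    by (simp add: fun_eq_iff c_def N_def)
  ultimately show ?case unfolding N_def q_def by (simp only:)
qed

lemma cardinal_bspline_sym: "cardinal_bspline (Suc r) (real r + 2 - x) = cardinal_bspline (Suc r) x"
proof (induction r arbitrary: x)
  case 0
  show ?case unfolding cardinal_bspline_1 by (auto simp: max_def)
next
  case (Suc r)
  have 1: "cardinal_bspline (Suc r) (real (Suc r) + 2 - x) = cardinal_bspline (Suc r) (x - 1)"
    using Suc.IH[of "x - 1"] by (simp add: algebra_simps)
  have 2: "cardinal_bspline (Suc r) (real (Suc r) + 2 - x - 1) = cardinal_bspline (Suc r) x"
    using Suc.IH[of x] by (simp add: algebra_simps)
  show ?case
    unfolding cardinal_bspline.simps(2)[of "Suc r"] 1 2 by (simp add: algebra_simps)
qed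

lemma cardinal_bspline_second_derivative:
  "deriv (deriv (cardinal_bspline (Suc (Suc (Suc r))))) x =
     cardinal_bspline (Suc r) x - 2 * cardinal_bspline (Suc r) (x - 1) + cardinal_bspline (Suc r) (x - 2)"
proof -
  define N where "N = cardinal_bspline (Suc (Suc r))"
  define N1 where "N1 = cardinal_bspline (Suc r)"
  have D: "(N has_real_derivative N1 x - N1 (x - 1)) (at x)" for x
    unfolding N_def N1_def by (rule cardinal_bspline_has_derivative)
  have D1: "((\<lambda>x. N (x - 1)) has_real_derivative (N1 (x - 1) - N1 (x - 2))) (at x)"
    using DERIV_shift[of N "N1 (x - 1) - N1 (x - 2)" x "-1"] D[of "x - 1"] by simp
  have "deriv (cardinal_bspline (Suc (Suc (Suc r)))) = (\<lambda>x. N x - N (x - 1))"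
    unfolding N_def by (intro ext DERIV_imp_deriv cardinal_bspline_has_derivative)
  moreover have "deriv (\<lambda>x. N x - N (x - 1)) x = (N1 x - N1 (x - 1)) - (N1 (x - 1) - N1 (x - 2))"
    by (intro DERIV_imp_deriv DERIV_diff D D1)
  ultimately show ?thesis by (simp add: N1_def)
qed

text \<open>The trigonometric sum of the values of the cardinal B-spline at the integers, centred at the midpoint
  of the support so that it satisfies a real recursion; for odd degrees \<open>2 p + 1\<close> it is \<open>g\<^sub>p\<close>.\<close>

definition spline_symbol :: "nat \<Rightarrow> real \<Rightarrow> real" where
  "spline_symbol q \<theta> = (\<Sum>k=0..q+1. cardinal_bspline q (real k) * cos ((real k - (real q + 1) / 2) * \<theta>))"

lemma sum_centered:
  "(\<Sum>k=0..2*m. G (real k - real m)) = G 0 + (\<Sum>k=1..m. G (real k) + G (- real k))"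
  for G :: "real \<Rightarrow> real"
proof (induction m)
  case (Suc m)
  have "(\<Sum>k=0..2 * Suc m. G (real k - real (Suc m))) = (\<Sum>k=0..Suc (Suc (2 * m)). G (real k - real (Suc m)))" by simp
  also have "\<dots> = G (- real (Suc m)) + (\<Sum>k=0..Suc (2 * m). G (real k - real m))"
    by (subst sum.atLeast0_atMost_Suc_shift) (simp add: o_def)
  also have "\<dots> = G (- real (Suc m)) + (\<Sum>k=0..2 * m. G (real k - real m)) + G (real (Suc m))"
    by (simp add: algebra_simps)
  finally show ?case using Suc by simp
qed simp

text \<open>Folds a sum over the support about its centre \<open>p + 1\<close>.\<close>

lemma symmetric_cosine_sum:
  fixes F :: "real \<Rightarrow> real"
  assumes "\<And>x. F (2 * real p + 2 - x) = F x" "F 0 = 0"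
  shows "F (real p + 1) + 2 * (\<Sum>k=1..p. F (real p + 1 - real k) * cos (real k * \<theta>))
    = (\<Sum>k=0..2*p+2. F (real k) * cos ((real k - (real p + 1)) * \<theta>))"
proof -
  define G where "G y = F (real (p + 1) + y) * cos (y * \<theta>)" for y
  have sym: "G y + G (- y) = 2 * (F (real p + 1 - y) * cos (y * \<theta>))" for y
    using assms(1)[of "real p + 1 - y"] by (simp add: G_def algebra_simps)
  have "(\<Sum>k=0..2*p+2. F (real k) * cos ((real k - (real p + 1)) * \<theta>)) = (\<Sum>k=0..2*(p+1). G (real k - real (p + 1)))"
    by (intro sum.cong) (auto simp: G_def algebra_simps)
  also have "\<dots> = G 0 + (\<Sum>k=1..p+1. 2 * (F (real p + 1 - real k) * cos (real k * \<theta>)))"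
    unfolding sum_centered sym ..
  also have "\<dots> = F (real p + 1) + 2 * (\<Sum>k=1..p. F (real p + 1 - real k) * cos (real k * \<theta>))"
    using assms(2) by (simp add: G_def sum_distrib_left add.commute)
  finally show ?thesis by simp
qed

lemma g_sym_eq: "g_sym p \<theta> = spline_symbol (2 * p + 1) \<theta>"
proof -
  have "g_sym p \<theta> = (\<Sum>k=0..2*p+2. cardinal_bspline (2 * p + 1) (real k) * cos ((real k - (real p + 1)) * \<theta>))"
    unfolding g_sym_def
    by (rule symmetric_cosine_sum)
      (use cardinal_bspline_sym[of "2 * p"] cardinal_bspline.simps(2)[of "2 * p" 0] cardinal_bspline_support[of "-1" "2 * p"] in \<open>auto simp del: cardinal_bspline.simps\<close>)
  also have "\<dots> = spline_symbol (2 * p + 1) \<theta>"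
    unfolding spline_symbol_def
    by (intro sum.cong) (auto simp: add_divide_distrib add_ac simp del: cardinal_bspline.simps)
  finally show ?thesis .
qed

text \<open>The second derivative of the spline of degree \<open>2 p + 1\<close> is the second difference of the one of degree
  \<open>2 p - 1\<close>, and under the trigonometric sum a second difference becomes the factor \<open>2 cos \<theta> - 2\<close>.\<close>

lemma f_sym_eq:
  assumes "p = Suc r"
  shows "f_sym p \<theta> = (2 - 2 * cos \<theta>) * spline_symbol (2 * r + 1) \<theta>"
proof -
  define a where "a = cardinal_bspline (Suc (2 * r))"
  define F where "F x = a x - 2 * a (x - 1) + a (x - 2)" for x
  have sup: "a x = 0" if "x \<le> 0 \<or> x \<ge> 2 * real r + 2" for x
  proof (cases "x = 0")
    case True
    then show ?thesis using cardinal_bspline_support[of "-1" "2 * r"] by (simp add: a_def)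
  next
    case False
    then show ?thesis using that unfolding a_def by (intro cardinal_bspline_support) auto
  qed
  have sym: "a (2 * real r + 2 - x) = a x" for x
    using cardinal_bspline_sym[of "2 * r" x] by (simp add: a_def del: cardinal_bspline.simps)
  have dd: "deriv (deriv (cardinal_bspline (2 * p + 1))) x = F x" for x
    using cardinal_bspline_second_derivative[of "2 * r" x] assms
    by (simp add: F_def a_def del: cardinal_bspline.simps)
  have "F (2 * real p + 2 - x) = F x" for x
    using sym[of "x - 2"] sym[of "x - 1"] sym[of x] assms by (simp add: F_def algebra_simps)
  moreover have "F 0 = 0" by (simp add: F_def sup)
  ultimately have *: "- f_sym p \<theta> = (\<Sum>k=0..2*p+2. F (real k) * cos ((real k - (real p + 1)) * \<theta>))"
    unfolding f_sym_def dd by (subst symmetric_cosine_sum[symmetric]) auto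
  define c where "c j = cos ((j - (real p + 1)) * \<theta>)" for j
  have s0: "(\<Sum>k=0..2*p+2. a (real k) * c (real k)) = (\<Sum>k=0..2*p. a (real k) * c (real k))"
    by (simp add: sup assms)
  have s1: "(\<Sum>k=0..2*p+2. a (real k - 1) * c (real k)) = (\<Sum>k=0..2*p. a (real k) * c (real k + 1))"
  proof -
    have "(\<Sum>k=0..2*p+2. a (real k - 1) * c (real k)) = (\<Sum>k=0..Suc (2*p+1). a (real k - 1) * c (real k))" by simp
    also have "\<dots> = a (- 1) * c 0 + (\<Sum>k=0..2*p+1. a (real k) * c (real k + 1))"
      by (subst sum.atLeast0_atMost_Suc_shift) (simp add: o_def add.commute)
    also have "\<dots> = (\<Sum>k=0..2*p. a (real k) * c (real k + 1))" by (simp add: sup assms)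
    finally show ?thesis .
  qed
  have s2: "(\<Sum>k=0..2*p+2. a (real k - 2) * c (real k)) = (\<Sum>k=0..2*p. a (real k) * c (real k + 2))"
  proof -
    have "(\<Sum>k=0..2*p+2. a (real k - 2) * c (real k)) = (\<Sum>k=0..Suc (2*p+1). a (real k - 2) * c (real k))" by simp
    also have "\<dots> = a (- 2) * c 0 + (\<Sum>k=0..Suc (2*p). a (real k - 1) * c (real k + 1))"
      by (subst sum.atLeast0_atMost_Suc_shift) (simp add: o_def add.commute)
    also have "\<dots> = a (- 2) * c 0 + a (- 1) * c 1 + (\<Sum>k=0..2*p. a (real k) * c (real k + 2))"
      by (subst sum.atLeast0_atMost_Suc_shift) (simp add: o_def add.commute)
    finally show ?thesis by (simp add: sup)
  qed
  have "- f_sym p \<theta> = (\<Sum>k=0..2*p+2. a (real k) * c (real k)) - 2 * (\<Sum>k=0..2*p+2. a (real k - 1) * c (real k))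
      + (\<Sum>k=0..2*p+2. a (real k - 2) * c (real k))"
    unfolding * F_def c_def[symmetric] sum_distrib_left sum_subtractf[symmetric] sum.distrib[symmetric]
    by (intro sum.cong) (auto simp: algebra_simps)
  also have "\<dots> = (\<Sum>k=0..2*p. a (real k) * (c (real k) - 2 * c (real k + 1) + c (real k + 2)))"
    unfolding s0 s1 s2 sum_distrib_left sum_subtractf[symmetric] sum.distrib[symmetric]
    by (intro sum.cong) (auto simp: algebra_simps)
  also have "\<dots> = (\<Sum>k=0..2*p. (2 * cos \<theta> - 2) * (a (real k) * cos ((real k - real p) * \<theta>)))"
  proof (intro sum.cong refl)
    fix k
    define y where "y = (real k - real p) * \<theta>"
    have "c (real k) = cos (y - \<theta>)" "c (real k + 1) = cos y" "c (real k + 2) = cos (y + \<theta>)"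
      by (simp_all add: c_def y_def algebra_simps)
    then have "c (real k) - 2 * c (real k + 1) + c (real k + 2) = (2 * cos \<theta> - 2) * cos y"
      by (simp add: cos_add cos_diff algebra_simps)
    then show "a (real k) * (c (real k) - 2 * c (real k + 1) + c (real k + 2)) = (2 * cos \<theta> - 2) * (a (real k) * cos ((real k - real p) * \<theta>))"
      by (simp add: y_def)
  qed
  also have "\<dots> = (2 * cos \<theta> - 2) * spline_symbol (2 * r + 1) \<theta>"
    unfolding sum_distrib_left[symmetric] spline_symbol_def a_def
    by (intro arg_cong2[where f = "(*)"] sum.cong) (auto simp: assms add_divide_distrib simp del: cardinal_bspline.simps)
  finally show ?thesis by (simp add: algebra_simps)
qed

definition spline_symbol_deriv :: "nat \<Rightarrow> real \<Rightarrow> real" where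
  "spline_symbol_deriv q \<theta> = - (\<Sum>k=0..q+1. cardinal_bspline q (real k) * (real k - (real q + 1) / 2)
     * sin ((real k - (real q + 1) / 2) * \<theta>))"

lemma spline_symbol_has_derivative:
  "(spline_symbol q has_real_derivative spline_symbol_deriv q \<theta>) (at \<theta>)"
  unfolding spline_symbol_def[abs_def] spline_symbol_deriv_def sum_negf[symmetric]
  by (rule derivative_eq_intros refl | simp add: mult_ac)+

text \<open>In the B-spline recursion the weights are affine in the point of evaluation; in the trigonometric sum
  multiplication by that point is differentiation in \<open>\<theta>\<close>.\<close>

lemma spline_symbol_Suc:
  "spline_symbol (Suc q) \<theta> = cos (\<theta> / 2) * spline_symbol q \<theta> - 2 / (real q + 1) * sin (\<theta> / 2) * spline_symbol_deriv q \<theta>"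
proof -
  define a where "a = cardinal_bspline q"
  define c where "c j = cos ((j - (real q + 2) / 2) * \<theta>)" for j
  have rec: "(real q + 1) * cardinal_bspline (Suc q) x = x * a x + (real q + 2 - x) * a (x - 1)" for x
  proof -
    define c where "c = real q + 1"
    have "c \<noteq> 0" by (simp add: c_def)
    moreover have "cardinal_bspline (Suc q) x = x / c * a x + (c + 1 - x) / c * a (x - 1)"
      by (simp add: c_def a_def add.commute)
    ultimately have "c * cardinal_bspline (Suc q) x = x * a x + (c + 1 - x) * a (x - 1)"
      by (simp add: distrib_left)
    then show ?thesis by (simp add: c_def)
  qed
  have "(real q + 1) * spline_symbol (Suc q) \<theta> = (\<Sum>k=0..q+2. (real k * a (real k) + (real q + 2 - real k) * a (real k - 1)) * c (real k))"
    unfolding spline_symbol_def sum_distrib_left rec[symmetric]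
    by (intro sum.cong) (auto simp: c_def algebra_simps)
  also have "\<dots> = (\<Sum>k=0..q+2. real k * a (real k) * c (real k)) + (\<Sum>k=0..Suc (q+1). (real q + 2 - real k) * a (real k - 1) * c (real k))"
    by (simp add: distrib_right sum.distrib)
  also have "(\<Sum>k=0..q+2. real k * a (real k) * c (real k)) = (\<Sum>k=0..q+1. real k * a (real k) * c (real k))"
    using cardinal_bspline_support[of "real q + 2" q] by (simp add: a_def add.commute)
  also have "(\<Sum>k=0..Suc (q+1). (real q + 2 - real k) * a (real k - 1) * c (real k))
      = (\<Sum>k=0..q+1. (real q + 1 - real k) * a (real k) * c (real k + 1))"
    using cardinal_bspline_support[of "-1" q]
    by (subst sum.atLeast0_atMost_Suc_shift) (simp add: a_def o_def algebra_simps)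
  also have "(\<Sum>k=0..q+1. real k * a (real k) * c (real k)) + (\<Sum>k=0..q+1. (real q + 1 - real k) * a (real k) * c (real k + 1))
     = (\<Sum>k=0..q+1. (real q + 1) * cos (\<theta> / 2) * (a (real k) * cos ((real k - (real q + 1) / 2) * \<theta>))
          + 2 * sin (\<theta> / 2) * (a (real k) * (real k - (real q + 1) / 2) * sin ((real k - (real q + 1) / 2) * \<theta>)))"
    unfolding sum.distrib[symmetric]
  proof (intro sum.cong refl)
    fix k
    define y where "y = (real k - (real q + 1) / 2) * \<theta>"
    have "c (real k) = cos (y - \<theta> / 2)" "c (real k + 1) = cos (y + \<theta> / 2)"
      unfolding c_def y_def by (intro arg_cong[where f = cos]; simp add: field_simps)+
    then show "real k * a (real k) * c (real k) + (real q + 1 - real k) * a (real k) * c (real k + 1)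
      = (real q + 1) * cos (\<theta> / 2) * (a (real k) * cos ((real k - (real q + 1) / 2) * \<theta>))
          + 2 * sin (\<theta> / 2) * (a (real k) * (real k - (real q + 1) / 2) * sin ((real k - (real q + 1) / 2) * \<theta>))"
      unfolding y_def[symmetric] by (simp only: cos_add cos_diff) (simp add: field_simps)
  qed
  also have "\<dots> = (real q + 1) * cos (\<theta> / 2) * spline_symbol q \<theta> - 2 * sin (\<theta> / 2) * spline_symbol_deriv q \<theta>"
    unfolding sum.distrib sum_distrib_left[symmetric]
    by (simp add: spline_symbol_def spline_symbol_deriv_def a_def del: sum.cl_ivl_Suc)
  finally have *: "(real q + 1) * spline_symbol (Suc q) \<theta>
    = (real q + 1) * cos (\<theta> / 2) * spline_symbol q \<theta> - 2 * sin (\<theta> / 2) * spline_symbol_deriv q \<theta>" .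
  then have "spline_symbol (Suc q) \<theta> = ((real q + 1) * cos (\<theta> / 2) * spline_symbol q \<theta> - 2 * sin (\<theta> / 2) * spline_symbol_deriv q \<theta>) / (real q + 1)"
    by (simp add: field_simps)
  then show ?thesis by (simp add: diff_divide_distrib)
qed

lemma spline_symbol_1: "spline_symbol (Suc 0) \<theta> = 1"
  unfolding spline_symbol_def cardinal_bspline_1 by (simp add: numeral_2_eq_2)

lemma spline_symbol_0: "spline_symbol (Suc q) 0 = 1"
  by (induction q) (simp_all add: spline_symbol_1 spline_symbol_Suc[of "Suc _"])

text \<open>The cosine sum hides its sign. Written as a polynomial \<open>T\<close> in \<open>t = cot (\<theta> / 2)\<close>, the recursion becomes,
  up to a positive factor, \<open>T \<mapsto> 2 t T + (1 + t\<^sup>2) T'\<close>, which preserves non-negative coefficients. The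
  constant term is positive at every second step; in between, the linear coefficient carries the
  positivity on.\<close>

lemma spline_symbol_cotangent_polynomial:
  "\<exists>T :: real poly. (\<forall>i. 0 \<le> coeff T i) \<and> (if even q then 0 < coeff T 0 else 0 < coeff T 1)
     \<and> (\<forall>\<theta>\<in>{0<..<2*pi}. spline_symbol (Suc q) \<theta> = sin (\<theta> / 2) ^ q * poly T (cot (\<theta> / 2)))"
proof (induction q)
  case 0
  show ?case by (intro exI[of _ 1]) (auto simp: spline_symbol_1)
next
  case (Suc q)
  then obtain T :: "real poly" where nn: "\<And>i. 0 \<le> coeff T i" and pos: "if even q then 0 < coeff T 0 else 0 < coeff T 1"
    and eq: "\<And>\<theta>. \<theta> \<in> {0<..<2*pi} \<Longrightarrow> spline_symbol (Suc q) \<theta> = sin (\<theta> / 2) ^ q * poly T (cot (\<theta> / 2))"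
    by blast
  define T' where "T' = Polynomial.smult (1 / (real q + 2)) (pCons 0 (Polynomial.smult 2 T) + pderiv T + pCons 0 (pCons 0 (pderiv T)))"
  have nn': "0 \<le> coeff T' i" for i
    using nn by (auto simp: T'_def coeff_pCons coeff_pderiv split: nat.splits)
  have pos': "if even (Suc q) then 0 < coeff T' 0 else 0 < coeff T' 1"
    using pos nn by (auto simp: T'_def coeff_pCons coeff_pderiv add_pos_nonneg split: nat.splits if_splits)
  have "spline_symbol (Suc (Suc q)) \<theta> = sin (\<theta> / 2) ^ Suc q * poly T' (cot (\<theta> / 2))" if \<theta>: "\<theta> \<in> {0<..<2*pi}" for \<theta>
  proof -
    define s where "s = sin (\<theta> / 2)"
    define c where "c = cos (\<theta> / 2)"
    define t where "t = cot (\<theta> / 2)"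
    have s: "s > 0" using \<theta> unfolding s_def by (intro sin_gt_zero) auto
    have ct: "c = s * t" using s by (simp add: t_def cot_def s_def c_def)
    have cs: "c\<^sup>2 + s\<^sup>2 = 1" by (simp add: c_def s_def)
    have s2: "1 = s\<^sup>2 * (1 + t\<^sup>2)" using cs by (simp add: ct power_mult_distrib algebra_simps)
    have "((\<lambda>\<theta>. sin (\<theta> / 2) ^ q * poly T (cos (\<theta> / 2) / sin (\<theta> / 2))) has_real_derivative
      real q * s ^ (q - 1) * (c / 2) * poly T t - s ^ q * (poly (pderiv T) t * ((1 + t\<^sup>2) / 2))) (at \<theta>)"
    proof -
      have d1: "((\<lambda>\<theta>. sin (\<theta> / 2)) has_real_derivative c / 2) (at \<theta>)"
        by (rule derivative_eq_intros refl | simp add: c_def)+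
      have d1': "((\<lambda>\<theta>. cos (\<theta> / 2)) has_real_derivative - s / 2) (at \<theta>)"
        by (rule derivative_eq_intros refl | simp add: s_def)+
      have eq: "(- s / 2 * s - c * (c / 2)) / (s * s) = - (1 + t\<^sup>2) / 2"
        unfolding ct using s by (simp add: field_simps power2_eq_square)
      have "sin (\<theta> / 2) \<noteq> 0" using s by (simp add: s_def)
      from DERIV_divide[OF d1' d1 this]
      have d2: "((\<lambda>\<theta>. cos (\<theta> / 2) / sin (\<theta> / 2)) has_real_derivative - (1 + t\<^sup>2) / 2) (at \<theta>)"
        unfolding s_def[symmetric] c_def[symmetric] eq .
      have t: "cos (\<theta> / 2) / sin (\<theta> / 2) = t" by (simp add: t_def cot_def)
      show ?thesis
        by (rule DERIV_cong[OF DERIV_mult[OF DERIV_power[OF d1, of q] DERIV_chain2[OF poly_DERIV d2, of T]]],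
            unfold t, unfold s_def[symmetric]) (simp add: algebra_simps add_divide_distrib diff_divide_distrib)
    qed
    then have "((\<lambda>\<theta>. sin (\<theta> / 2) ^ q * poly T (cot (\<theta> / 2))) has_real_derivative
      real q * s ^ (q - 1) * (c / 2) * poly T t - s ^ q * (poly (pderiv T) t * ((1 + t\<^sup>2) / 2))) (at \<theta>)"
      by (simp add: cot_def)
    then have "(spline_symbol (Suc q) has_real_derivative
      real q * s ^ (q - 1) * (c / 2) * poly T t - s ^ q * (poly (pderiv T) t * ((1 + t\<^sup>2) / 2))) (at \<theta>)"
      by (rule has_field_derivative_transform_within_open[of _ _ _ "{0<..<2*pi}"]) (use \<theta> eq in auto)
    then have D: "spline_symbol_deriv (Suc q) \<theta> = real q * s ^ (q - 1) * (c / 2) * poly T t - s ^ q * (poly (pderiv T) t * ((1 + t\<^sup>2) / 2))"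
      using DERIV_unique[OF spline_symbol_has_derivative] by blast
    have qs: "real q * s ^ (q - 1) * c = real q * s ^ q * t" by (cases q) (simp_all add: ct)
    have D': "spline_symbol_deriv (Suc q) \<theta> = s ^ q / 2 * (real q * t * poly T t - (1 + t\<^sup>2) * poly (pderiv T) t)"
    proof -
      have "real q * s ^ (q - 1) * (c / 2) * poly T t = real q * s ^ (q - 1) * c * (poly T t / 2)" by simp
      then show ?thesis unfolding D qs by (simp add: algebra_simps add_divide_distrib diff_divide_distrib)
    qed
    have "spline_symbol (Suc (Suc q)) \<theta> = c * (s ^ q * poly T t)
        - 2 / (real q + 2) * s * (s ^ q / 2 * (real q * t * poly T t - (1 + t\<^sup>2) * poly (pderiv T) t))"
      unfolding spline_symbol_Suc[of "Suc q"] D' eq[OF \<theta>] by (simp add: s_def c_def t_def add.commute)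
    also have "\<dots> = s ^ Suc q * (1 / (real q + 2) * (t * (2 * poly T t) + poly (pderiv T) t + t * (t * poly (pderiv T) t)))"
      unfolding ct by (simp add: field_simps power2_eq_square)
    also have "\<dots> = s ^ Suc q * poly T' t" by (simp add: T'_def)
    finally show ?thesis by (simp add: s_def t_def)
  qed
  with nn' pos' show ?case by blast
qed

text \<open>On \<open>(0,\<pi>]\<close> the cotangent of \<open>\<theta> / 2\<close> is non-negative, so the polynomial is at least its constant term.\<close>

lemma spline_symbol_pos:
  assumes "\<theta> \<in> {0..pi}"
  shows "0 < spline_symbol (2 * r + 1) \<theta>"
proof (cases "\<theta> = 0")
  case True
  then show ?thesis using spline_symbol_0[of "2 * r"] by simp
next
  case False
  then have \<theta>: "\<theta> \<in> {0<..<2*pi}" using assms by auto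
  obtain T :: "real poly" where T: "\<And>i. 0 \<le> coeff T i" "0 < coeff T 0"
    "spline_symbol (Suc (2 * r)) \<theta> = sin (\<theta> / 2) ^ (2 * r) * poly T (cot (\<theta> / 2))"
    using spline_symbol_cotangent_polynomial[of "2 * r"] \<theta> by (metis dvd_triv_left)
  have s: "sin (\<theta> / 2) > 0" using \<theta> by (intro sin_gt_zero) auto
  have "cos (\<theta> / 2) \<ge> 0" using assms by (intro cos_ge_zero) auto
  then have c: "cot (\<theta> / 2) \<ge> 0" using s by (simp add: cot_def)
  have "0 < coeff T 0 * cot (\<theta> / 2) ^ 0" using T by simp
  also have "\<dots> \<le> (\<Sum>i\<le>degree T. coeff T i * cot (\<theta> / 2) ^ i)"
    using T c by (intro member_le_sum) auto
  finally have "0 < poly T (cot (\<theta> / 2))" by (simp add: poly_altdef)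
  then show ?thesis using s T(3) by simp
qed

lemma continuous_on_spline_symbol [continuous_intros]: "continuous_on A (spline_symbol q)"
  by (intro DERIV_continuous_on[OF DERIV_subset[OF spline_symbol_has_derivative]]) auto

lemma e_sym_eq:
  "e_sym (Suc r) \<theta> = (2 - 2 * cos \<theta>) * spline_symbol (2 * r + 1) \<theta> / spline_symbol (2 * r + 3) \<theta>"
  by (simp add: e_sym_def g_sym_eq f_sym_eq[OF refl] numeral_3_eq_3)

lemma spline_symbol_pos': "\<theta> \<in> {0..pi} \<Longrightarrow> 0 < spline_symbol (2 * r + 3) \<theta>"
  using spline_symbol_pos[of \<theta> "Suc r"] by (simp add: numeral_3_eq_3)

lemma continuous_on_e_sym: "continuous_on {0..pi} (e_sym (Suc r))"
  unfolding e_sym_eq[abs_def] using spline_symbol_pos'[of _ r]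
  by (intro continuous_intros) force

lemma e_sym_pos: "\<theta> \<in> {0<..pi} \<Longrightarrow> 0 < e_sym (Suc r) \<theta>"
proof -
  assume \<theta>: "\<theta> \<in> {0<..pi}"
  then have "cos \<theta> < cos 0" by (intro cos_monotone_0_pi) auto
  then show ?thesis unfolding e_sym_eq
    using spline_symbol_pos[of \<theta> r] spline_symbol_pos'[of \<theta> r] \<theta> by simp
qed

lemma e_sym_0: "e_sym (Suc r) 0 = 0"
  by (simp add: e_sym_eq)

lemma e_sym_asymp: "((\<lambda>\<theta>. e_sym (Suc r) \<theta> / \<theta>\<^sup>2) \<longlongrightarrow> 1) (at_right 0)"
proof -
  have sinc: "((\<lambda>\<theta>::real. sin (\<theta> / 2) / (\<theta> / 2)) \<longlongrightarrow> 1) (at_right 0)"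
    by real_asymp
  have c: "((\<lambda>\<theta>. spline_symbol q \<theta>) \<longlongrightarrow> spline_symbol q 0) (at_right 0)" for q
    using DERIV_isCont[OF spline_symbol_has_derivative[of q 0]] unfolding isCont_def
    by (rule tendsto_within_subset) auto
  have "((\<lambda>\<theta>. (sin (\<theta> / 2) / (\<theta> / 2))\<^sup>2 * spline_symbol (2 * r + 1) \<theta> / spline_symbol (2 * r + 3) \<theta>) \<longlongrightarrow> 1\<^sup>2 * spline_symbol (2 * r + 1) 0 / spline_symbol (2 * r + 3) 0) (at_right 0)"
    using spline_symbol_0[of "2 * r + 2"]
    by (intro tendsto_intros sinc c) (simp add: numeral_3_eq_3)
  moreover have "(sin (\<theta> / 2) / (\<theta> / 2))\<^sup>2 * spline_symbol (2 * r + 1) \<theta> / spline_symbol (2 * r + 3) \<theta> = e_sym (Suc r) \<theta> / \<theta>\<^sup>2" for \<theta>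
  proof -
    have "2 - 2 * cos \<theta> = 4 * (sin (\<theta> / 2))\<^sup>2" using cos_double_sin[of "\<theta> / 2"] by simp
    then show ?thesis unfolding e_sym_eq by (simp add: power_divide mult_ac)
  qed
  ultimately show ?thesis using spline_symbol_0[of "2 * r"] spline_symbol_0[of "2 * r + 2"] by (simp add: numeral_3_eq_3)
qed

text \<open>The root of the symbol behaves like \<open>\<theta>\<close> at 0. The lower estimate is needed wherever the symbol is small,
  not just for small \<open>\<theta>\<close>; this is where positivity of the symbol away from 0 enters.\<close>

lemma sqrt_e_sym_near_0:
  assumes "0 < \<eta>" "\<eta> < 1"
  obtains \<delta> where "\<delta> > 0" "\<delta> < pi"
    "\<And>\<theta>. \<theta> \<in> {0..\<delta>} \<Longrightarrow> sqrt (e_sym (Suc r) \<theta>) \<le> (1 + \<eta>) * \<theta>"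
    "\<And>\<theta>. \<theta> \<in> {0..pi} \<Longrightarrow> sqrt (e_sym (Suc r) \<theta>) \<le> \<delta> \<Longrightarrow> (1 - \<eta>) * \<theta> \<le> sqrt (e_sym (Suc r) \<theta>)"
proof -
  let ?e = "e_sym (Suc r)"
  have lt: "(1 - \<eta>)\<^sup>2 < 1" "1 < (1 + \<eta>)\<^sup>2"  proof -
    have "(1 - \<eta>)\<^sup>2 = 1 - 2 * \<eta> + \<eta> * \<eta>" "(1 + \<eta>)\<^sup>2 = 1 + 2 * \<eta> + \<eta> * \<eta>"
      by (simp_all add: power2_eq_square algebra_simps)
    moreover have "\<eta> * \<eta> < \<eta> * 1" "0 < \<eta> * \<eta>"
      using assms by (intro mult_strict_left_mono mult_pos_pos; simp)+
    ultimately show "(1 - \<eta>)\<^sup>2 < 1" "1 < (1 + \<eta>)\<^sup>2" using assms by linarith+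
  qed
  have "\<forall>\<^sub>F \<theta> in at_right 0. (1 - \<eta>)\<^sup>2 < ?e \<theta> / \<theta>\<^sup>2 \<and> ?e \<theta> / \<theta>\<^sup>2 < (1 + \<eta>)\<^sup>2"
    using order_tendstoD(1)[OF e_sym_asymp lt(1)] order_tendstoD(2)[OF e_sym_asymp lt(2)] by eventually_elim auto
  then obtain d where d: "d > 0" and near: "\<And>\<theta>. 0 < \<theta> \<Longrightarrow> \<theta> < d \<Longrightarrow> (1 - \<eta>)\<^sup>2 < ?e \<theta> / \<theta>\<^sup>2 \<and> ?e \<theta> / \<theta>\<^sup>2 < (1 + \<eta>)\<^sup>2"
    unfolding eventually_at_right_field by auto
  have lo: "(1 - \<eta>) * \<theta> \<le> sqrt (?e \<theta>)" and up: "sqrt (?e \<theta>) \<le> (1 + \<eta>) * \<theta>" if "0 \<le> \<theta>" "\<theta> < d" for \<theta>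
  proof -
    have "((1 - \<eta>) * \<theta>)\<^sup>2 \<le> ?e \<theta> \<and> ?e \<theta> \<le> ((1 + \<eta>) * \<theta>)\<^sup>2"
    proof (cases "\<theta> = 0")
      case True
      then show ?thesis by (simp add: e_sym_0)
    next
      case False
      then have "(1 - \<eta>)\<^sup>2 < ?e \<theta> / \<theta>\<^sup>2" "?e \<theta> / \<theta>\<^sup>2 < (1 + \<eta>)\<^sup>2" "0 < \<theta>\<^sup>2"
        using near[of \<theta>] that by auto
      then show ?thesis unfolding power_mult_distrib by (simp add: pos_less_divide_eq pos_divide_less_eq)
    qed
    then show "(1 - \<eta>) * \<theta> \<le> sqrt (?e \<theta>)" "sqrt (?e \<theta>) \<le> (1 + \<eta>) * \<theta>"
      using assms that by (auto intro: real_le_rsqrt real_le_lsqrt)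
  qed
  define d' where "d' = min (d / 2) (pi / 2)"
  have d': "d' > 0" "d' < pi" "d' < d" using d pi_gt_zero by (auto simp: d'_def min_def)
  have "\<exists>x\<in>{d'..pi}. \<forall>y\<in>{d'..pi}. sqrt (?e x) \<le> sqrt (?e y)"
    using d' by (intro continuous_attains_inf continuous_intros continuous_on_subset[OF continuous_on_e_sym]) auto
  then obtain x where x: "x \<in> {d'..pi}" "\<And>y. y \<in> {d'..pi} \<Longrightarrow> sqrt (?e x) \<le> sqrt (?e y)" by blast
  define m where "m = sqrt (?e x)"
  have m: "m > 0" unfolding m_def using x(1) d' e_sym_pos[of x r] by simp
  \<comment> \<open>Below \<open>m\<close> the root of the symbol forces \<open>\<theta> < d'\<close>.\<close>
  define \<delta> where "\<delta> = min d' (m / 2)"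
  show ?thesis
  proof (rule that[of \<delta>])
    show "\<delta> > 0" "\<delta> < pi" using d' m by (auto simp: \<delta>_def)
    show "sqrt (?e \<theta>) \<le> (1 + \<eta>) * \<theta>" if "\<theta> \<in> {0..\<delta>}" for \<theta>
      using that d' by (intro up) (auto simp: \<delta>_def)
    show "(1 - \<eta>) * \<theta> \<le> sqrt (?e \<theta>)" if "\<theta> \<in> {0..pi}" "sqrt (?e \<theta>) \<le> \<delta>" for \<theta>
    proof (cases "\<theta> < d'")
      case True
      then show ?thesis using that d' by (intro lo) auto
    next
      case False
      then have "m \<le> sqrt (?e \<theta>)" unfolding m_def using that by (intro x(2)) auto
      then show ?thesis using that(2) m by (auto simp: \<delta>_def)
    qed
  qed
qed

section \<open>Area of the sublevel sets of the symbol\<close>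

text \<open>The derivative has integral \<open>\<phi> 1 - \<phi> 0 = 1\<close>; this normalisation is what makes the limit constant
  independent of \<open>\<phi>\<close>.\<close>

lemma C01D:
  assumes "\<phi> \<in> C01"
  shows "\<And>x. x \<in> {0..1} \<Longrightarrow> (\<phi> has_vector_derivative D01 \<phi> x) (at x within {0..1})"
    "continuous_on {0..1} (D01 \<phi>)" "\<And>x. x \<in> {0..1} \<Longrightarrow> 0 < D01 \<phi> x" "\<phi> 0 = 0" "\<phi> 1 = 1"
    "(D01 \<phi> has_integral 1) {0..1}"
proof -
  have d: "\<phi> differentiable_on {0..1}" "D01 \<phi> differentiable_on {0..1}"
    using assms by (auto simp: C01_def C2_01_def)
  show v: "(\<phi> has_vector_derivative D01 \<phi> x) (at x within {0..1})" if "x \<in> {0..1}" for x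
    using d(1) that unfolding D01_def differentiable_on_def by (simp add: vector_derivative_works)
  show "continuous_on {0..1} (D01 \<phi>)" using d(2) by (rule differentiable_imp_continuous_on)
  show "0 < D01 \<phi> x" if "x \<in> {0..1}" for x using assms that by (auto simp: C01_def)
  show e: "\<phi> 0 = 0" "\<phi> 1 = 1" using assms by (auto simp: C01_def)
  show "(D01 \<phi> has_integral 1) {0..1}"
    using fundamental_theorem_of_calculus[of 0 1 \<phi> "D01 \<phi>"] v e by simp
qed

lemma measure_under_graph:
  fixes D :: "real \<Rightarrow> real"
  assumes cont: "continuous_on {0..1} D" and pos: "\<And>x. x \<in> {0..1} \<Longrightarrow> 0 < D x"
    and int: "(D has_integral 1) {0..1}" and c: "0 \<le> c"
  defines "U \<equiv> {(x, \<theta>). x \<in> {0..1} \<and> \<theta> \<in> {0..c * D x}}"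
  shows "U \<in> sets borel" "emeasure lborel U = ennreal c" "measure lebesgue U = c"
proof -
  have "closed U"
  proof -
    have "U = {z \<in> {0..1} \<times> UNIV. 0 \<le> snd z} \<inter> {z \<in> {0..1} \<times> UNIV. snd z \<le> c * D (fst z)}"
      by (auto simp: U_def)
    moreover have "closed {z \<in> {0..1::real} \<times> (UNIV::real set). 0 \<le> snd z}"
      by (intro continuous_on_closed_Collect_le continuous_intros closed_Times; auto)
    moreover have "closed {z \<in> {0..1::real} \<times> (UNIV::real set). snd z \<le> c * D (fst z)}"
      by (intro continuous_on_closed_Collect_le continuous_intros closed_Times continuous_on_compose2[OF cont]; auto)
    ultimately show ?thesis by auto
  qed
  then show U: "U \<in> sets borel" by simp
  then have U': "U \<in> sets (lborel \<Otimes>\<^sub>M lborel)" by (simp only: lborel_prod sets_lborel)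
  have m: "(\<lambda>x. indicator {0..1} x *\<^sub>R (c * D x)) \<in> borel_measurable borel"
    by (intro borel_measurable_continuous_on_indicator continuous_intros cont) auto
  have "emeasure lborel U = emeasure (lborel \<Otimes>\<^sub>M lborel) U" by (simp add: lborel_prod)
  also have "\<dots> = (\<integral>\<^sup>+x. emeasure lborel (Pair x -` U) \<partial>lborel)"
    by (rule lborel.emeasure_pair_measure_alt[OF U'])
  also have "\<dots> = (\<integral>\<^sup>+x. ennreal (indicator {0..1} x *\<^sub>R (c * D x)) \<partial>lborel)"
  proof (intro nn_integral_cong)
    fix x :: real
    show "emeasure lborel (Pair x -` U) = ennreal (indicator {0..1} x *\<^sub>R (c * D x))"
    proof (cases "x \<in> {0..1}")
      case True
      then have "Pair x -` U = {0..c * D x}" by (auto simp: U_def)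
      then show ?thesis using True c pos[OF True] by simp
    next
      case False
      then have "Pair x -` U = {}" by (auto simp: U_def)
      then show ?thesis using False by simp
    qed
  qed
  also have "\<dots> = ennreal c"
  proof (rule nn_integral_has_integral_lborel[OF m])
    show "0 \<le> indicator {0..1} x *\<^sub>R (c * D x)" for x
      using c pos[of x] by (cases "x \<in> {0..1}") (auto simp: indicator_def)
    have "((\<lambda>x. c * D x) has_integral c * 1) {0..1}" by (intro has_integral_mult_right int)
    then have "((\<lambda>x. if x \<in> {0..1} then c * D x else 0) has_integral c) UNIV"
      by (simp only: has_integral_restrict_UNIV mult_1_right)
    moreover have "(\<lambda>x. if x \<in> {0..1} then c * D x else 0) = (\<lambda>x. indicator {0..1} x *\<^sub>R (c * D x))"
      by (auto simp: indicator_def fun_eq_iff)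
    ultimately show "((\<lambda>x. indicator {0..1} x *\<^sub>R (c * D x)) has_integral c) UNIV" by simp
  qed
  finally show e: "emeasure lborel U = ennreal c" .
  show "measure lebesgue U = c"
    using U c e by (simp add: measure_completion measure_def)
qed

text \<open>The condition \<open>sqrt \<omega> \<le> y\<close> reads \<open>sqrt (e\<^sub>p \<theta>) \<le> y \<phi>'(x)\<close>. Since the left side is close to \<open>\<theta>\<close>, the sublevel
  set lies between the regions under the graphs of \<open>y \<phi>' / (1 + \<eta>)\<close> and \<open>y \<phi>' / (1 - \<eta>)\<close>.\<close>

lemma Psi_sqrt_bounds:
  assumes \<phi>: "\<phi> \<in> C01" and \<eta>: "0 < \<eta>" "\<eta> < 1"
  obtains y0 where "y0 > 0" "\<And>y. 0 \<le> y \<Longrightarrow> y \<le> y0 \<Longrightarrow> y / (1 + \<eta>) \<le> Psi_sqrt (Suc r) \<phi> y \<and> Psi_sqrt (Suc r) \<phi> y \<le> y / (1 - \<eta>)"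
proof -
  note \<phi>' = C01D[OF \<phi>]
  let ?s = "\<lambda>\<theta>. sqrt (e_sym (Suc r) \<theta>)"
  obtain \<delta> where \<delta>: "\<delta> > 0" "\<delta> < pi"
    and up: "\<And>\<theta>. \<theta> \<in> {0..\<delta>} \<Longrightarrow> ?s \<theta> \<le> (1 + \<eta>) * \<theta>"
    and lo: "\<And>\<theta>. \<theta> \<in> {0..pi} \<Longrightarrow> ?s \<theta> \<le> \<delta> \<Longrightarrow> (1 - \<eta>) * \<theta> \<le> ?s \<theta>"
    using sqrt_e_sym_near_0[OF \<eta>, of r] by blast
  obtain b where b: "b > 0" "\<And>x. x \<in> {0..1} \<Longrightarrow> D01 \<phi> x \<le> b"
  proof -
    have "\<exists>x\<in>{0..1}. \<forall>y\<in>{0..1}. D01 \<phi> y \<le> D01 \<phi> x"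
      using \<phi>'(2) by (intro continuous_attains_sup) auto
    then show ?thesis using that \<phi>'(3) by blast
  qed
  define U where "U c = {(x, \<theta>). x \<in> {0..1} \<and> \<theta> \<in> {0..c * D01 \<phi> x}}" for c
  define A where "A y = {z \<in> sym_domain. sqrt (omega (Suc r) \<phi> z) \<le> y}" for y
  have A_eq: "A y = {z \<in> sym_domain. ?s (snd z) \<le> y * D01 \<phi> (fst z)}" for y
    using \<phi>'(3) by (force simp: A_def omega_def real_sqrt_divide field_simps)
  have U: "U c \<in> lmeasurable" "measure lebesgue (U c) = c" if "c \<ge> 0" for c
    using measure_under_graph[OF \<phi>'(2,3,6) that] unfolding U_def fmeasurable_def by (auto simp: emeasure_completion)
  have "closed (A y)" for y
  proof -
    have "closed {z \<in> sym_domain. ?s (snd z) \<le> y * D01 \<phi> (fst z)}"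
      by (intro continuous_on_closed_Collect_le continuous_intros closed_Times
        continuous_on_compose2[OF \<phi>'(2)] continuous_on_compose2[OF continuous_on_e_sym[of r]]) auto
    then show ?thesis by (simp add: A_eq)
  qed
  then have A_meas: "A y \<in> sets lebesgue" for y by simp
  show ?thesis
  proof (rule that[of "\<delta> / b"])
    show "\<delta> / b > 0" using \<delta> b by simp
    fix y assume y: "0 \<le> y" "y \<le> \<delta> / b"
    have yD: "y * D01 \<phi> x \<le> \<delta>" if "x \<in> {0..1}" for x
    proof -
      have "y * D01 \<phi> x \<le> (\<delta> / b) * b" using y b that \<phi>'(3)[OF that] by (intro mult_mono) auto
      then show ?thesis using b by simp
    qed
    have sub1: "U (y / (1 + \<eta>)) \<subseteq> A y"
    proof
      fix z assume "z \<in> U (y / (1 + \<eta>))"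
      then obtain x \<theta> where z: "z = (x, \<theta>)" "x \<in> {0..1}" "0 \<le> \<theta>" "\<theta> \<le> y / (1 + \<eta>) * D01 \<phi> x"
        by (auto simp: U_def)
      then have t: "(1 + \<eta>) * \<theta> \<le> y * D01 \<phi> x" using \<eta> by (simp add: field_simps)
      have "\<theta> \<le> (1 + \<eta>) * \<theta>" using \<eta> z(3) by (simp add: algebra_simps)
      then have "\<theta> \<in> {0..\<delta>}" using t yD[OF z(2)] z(3) by auto
      then have "?s \<theta> \<le> y * D01 \<phi> x" "\<theta> \<le> pi" using up[of \<theta>] t \<delta> by auto
      then show "z \<in> A y" using z by (simp add: A_eq)
    qed
    have sub2: "A y \<subseteq> U (y / (1 - \<eta>))"
    proof
      fix z assume "z \<in> A y"
      then obtain x \<theta> where z: "z = (x, \<theta>)" "x \<in> {0..1}" "\<theta> \<in> {0..pi}" "?s \<theta> \<le> y * D01 \<phi> x"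
        by (auto simp: A_eq)
      then have "(1 - \<eta>) * \<theta> \<le> y * D01 \<phi> x" using lo[of \<theta>] yD[of x] by force
      then have "\<theta> \<le> y / (1 - \<eta>) * D01 \<phi> x" using \<eta> by (simp add: field_simps)
      then show "z \<in> U (y / (1 - \<eta>))" using z by (auto simp: U_def)
    qed
    have "A y \<in> lmeasurable" using fmeasurableI2[OF U(1) sub2 A_meas] y \<eta> by simp
    then have "measure lebesgue (U (y / (1 + \<eta>))) \<le> measure lebesgue (A y)"
      using sub1 U(1)[of "y / (1 + \<eta>)"] y \<eta> by (intro measure_mono_fmeasurable) (auto simp: fmeasurableD)
    moreover have "measure lebesgue (A y) \<le> measure lebesgue (U (y / (1 - \<eta>)))"
      using sub2 A_meas U(1)[of "y / (1 - \<eta>)"] y \<eta> by (intro measure_mono_fmeasurable) auto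
    ultimately show "y / (1 + \<eta>) \<le> Psi_sqrt (Suc r) \<phi> y \<and> Psi_sqrt (Suc r) \<phi> y \<le> y / (1 - \<eta>)"
      using U(2)[of "y / (1 + \<eta>)"] U(2)[of "y / (1 - \<eta>)"] y \<eta> by (simp add: Psi_sqrt_def A_def)
  qed
qed

lemma Psi_sqrt_derivative_at_0:
  assumes "p \<ge> 1" "\<phi> \<in> C01"
  shows "(Psi_sqrt p \<phi> has_vector_derivative 1) (at 0 within {0..})"
proof -
  obtain r where r: "p = Suc r" using assms(1) by (cases p) auto
  let ?P = "Psi_sqrt p \<phi>"
  have P0: "?P 0 = 0"
    using Psi_sqrt_bounds[OF assms(2), of "1/2" r] unfolding r by (smt (verit) div_0 field_sum_of_halves half_gt_zero_iff)
  have "\<forall>\<^sub>F y in at_right 0. \<bar>?P y / y - 1\<bar> < e" if e: "e > 0" for e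
  proof -
    define \<eta> where "\<eta> = min (e / 4) (1 / 4)"
    have \<eta>: "0 < \<eta>" "\<eta> < 1" "\<eta> \<le> e / 4" "\<eta> \<le> 1 / 4" using e by (auto simp: \<eta>_def)
    obtain y0 where y0: "y0 > 0" "\<And>y. 0 \<le> y \<Longrightarrow> y \<le> y0 \<Longrightarrow> y / (1 + \<eta>) \<le> ?P y \<and> ?P y \<le> y / (1 - \<eta>)"
      using Psi_sqrt_bounds[OF assms(2) \<eta>(1,2), of r] unfolding r by blast
    have a: "1 / (1 + \<eta>) \<ge> 1 - \<eta>" using \<eta> by (simp add: field_simps)
    have b: "1 / (1 - \<eta>) \<le> 1 + 2 * \<eta>"
    proof -
      have "\<eta> * \<eta> \<le> \<eta> * (1 / 4)" using \<eta> by (intro mult_left_mono) auto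
      then show ?thesis using \<eta> by (simp add: field_simps)
    qed
    have "\<bar>?P y / y - 1\<bar> < e" if "0 < y" "y < y0" for y
    proof -
      have "1 / (1 + \<eta>) \<le> ?P y / y" "?P y / y \<le> 1 / (1 - \<eta>)"
        using y0(2)[of y] that \<eta> by (simp_all add: field_simps)
      then show ?thesis using a b \<eta> e by linarith
    qed
    then show ?thesis unfolding eventually_at_right_field using y0(1) by blast
  qed
  then have "((\<lambda>y. ?P y / y) \<longlongrightarrow> 1) (at_right 0)" by (simp add: tendsto_iff dist_real_def)
  then have "((\<lambda>y. (?P y - ?P 0) / (y - 0)) \<longlongrightarrow> 1) (at 0 within {0<..})" using P0 by simp
  then have "((\<lambda>y. (?P y - ?P 0) / (y - 0)) \<longlongrightarrow> 1) (at 0 within {0..})"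
    by (simp add: at_within_Ici_at_right)
  then show ?thesis
    by (simp add: has_real_derivative_iff_has_vector_derivative[symmetric] has_field_derivative_iff)
qed

lemma gam_eq_pi:
  assumes "p \<ge> 1" "\<phi> \<in> C01"
  shows "Psi_sqrt p \<phi> differentiable (at 0 within {0..})" "gam p \<phi> = pi"
proof -
  note d = Psi_sqrt_derivative_at_0[OF assms]
  show "Psi_sqrt p \<phi> differentiable (at 0 within {0..})"
    using d by (rule differentiableI_vector)
  have "vector_derivative (Psi_sqrt p \<phi>) (at 0 within {0..}) = 1"
    using d by (intro vector_derivative_within) (auto simp: at_within_Ici_at_right)
  then show "gam p \<phi> = pi" by (simp add: gam_def)
qed

section \<open>Galerkin forms and the variational principle\<close>

text \<open>The coefficient \<open>c i\<close> belongs to the spline of index \<open>i + 1\<close>: the first and the last spline, which do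
  not tend to 0 at the end points, are left out.\<close>

definition spl :: "nat \<Rightarrow> nat \<Rightarrow> (nat \<Rightarrow> real) \<Rightarrow> real \<Rightarrow> real" where
  "spl p n c t = (\<Sum>i<dimN p n. c i * bspline n p p (i + 1) t)"

text \<open>The derivative of \<open>spl p n c\<close> by the explicit formula; unlike \<open>deriv\<close> it is a bounded Borel function
  on the whole line.\<close>

definition dspl :: "nat \<Rightarrow> nat \<Rightarrow> (nat \<Rightarrow> real) \<Rightarrow> real \<Rightarrow> real" where
  "dspl p n c t = (\<Sum>i<dimN p n. c i * bspline_diff n p p (i + 1) t)"

definition mass_entry :: "nat \<Rightarrow> (real \<Rightarrow> real) \<Rightarrow> nat \<Rightarrow> nat \<Rightarrow> nat \<Rightarrow> real" where
  "mass_entry p \<phi> n i j =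
     integral {0..1} (\<lambda>x. \<bar>D01 \<phi> x\<bar> * bspline n p p (i + 1) x * bspline n p p (j + 1) x)"

definition stiff_entry :: "nat \<Rightarrow> (real \<Rightarrow> real) \<Rightarrow> nat \<Rightarrow> nat \<Rightarrow> nat \<Rightarrow> real" where
  "stiff_entry p \<phi> n i j = integral {0..1} (\<lambda>x. 1 / \<bar>D01 \<phi> x\<bar> *
       deriv (bspline n p p (i + 1)) x * deriv (bspline n p p (j + 1)) x)"

abbreviation mass_form :: "nat \<Rightarrow> (real \<Rightarrow> real) \<Rightarrow> nat \<Rightarrow> (nat \<Rightarrow> real) \<Rightarrow> (nat \<Rightarrow> real) \<Rightarrow> real" where
  "mass_form p \<phi> n \<equiv> qform (dimN p n) (mass_entry p \<phi> n)"

abbreviation stiff_form :: "nat \<Rightarrow> (real \<Rightarrow> real) \<Rightarrow> nat \<Rightarrow> (nat \<Rightarrow> real) \<Rightarrow> (nat \<Rightarrow> real) \<Rightarrow> real" where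
  "stiff_form p \<phi> n \<equiv> qform (dimN p n) (stiff_entry p \<phi> n)"

lemma spl_index: "i < dimN p n \<Longrightarrow> p \<ge> 1 \<Longrightarrow> n \<ge> 1 \<Longrightarrow> 1 \<le> i + 1 \<and> i + 1 + 2 \<le> p + n"
  by (auto simp: dimN_def)

lemma continuous_on_spl: "p \<ge> 1 \<Longrightarrow> n \<ge> 1 \<Longrightarrow> continuous_on {0..1} (spl p n c)"
  unfolding spl_def[abs_def] using spl_index[of _ p n]
  by (intro continuous_on_sum continuous_on_mult continuous_on_const continuous_on_bspline) auto

lemma spl_ends: "p \<ge> 1 \<Longrightarrow> n \<ge> 1 \<Longrightarrow> spl p n c 0 = 0 \<and> spl p n c 1 = 0"
  unfolding spl_def using spl_index[of _ p n] bspline_vanish_ends[of n _ p]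
  by (auto intro!: sum.neutral)

lemma spl_has_derivative:
  "n \<ge> 1 \<Longrightarrow> t \<notin> range (knot n p) \<Longrightarrow> (spl p n c has_real_derivative dspl p n c t) (at t)"
  unfolding spl_def[abs_def] dspl_def
  by (intro DERIV_sum DERIV_cmult bspline_has_derivative)

lemma bspline_diff_bounded: "n \<ge> 1 \<Longrightarrow> \<exists>C. \<forall>t. \<bar>bspline_diff n p q j t\<bar> \<le> C"
proof (cases "q = 0")
  case False
  assume n: "n \<ge> 1"
  define a where "a = knot n p (j + q) - knot n p j"
  define b where "b = knot n p (j + q + 1) - knot n p (j + 1)"
  have "\<bar>bspline_diff n p q j t\<bar> \<le> real q * (2 ^ (q - 1) / \<bar>a\<bar> + 2 ^ (q - 1) / \<bar>b\<bar>)" for t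
  proof -
    have "\<bar>bspline n p (q - 1) j t / a - bspline n p (q - 1) (j + 1) t / b\<bar>
      \<le> \<bar>bspline n p (q - 1) j t / a\<bar> + \<bar>bspline n p (q - 1) (j + 1) t / b\<bar>" by (rule abs_triangle_ineq4)
    also have "\<dots> \<le> 2 ^ (q - 1) / \<bar>a\<bar> + 2 ^ (q - 1) / \<bar>b\<bar>"
      using bspline_bounds[OF n] by (intro add_mono) (auto simp: abs_divide intro!: divide_right_mono)
    finally have "real q * \<bar>bspline n p (q - 1) j t / a - bspline n p (q - 1) (j + 1) t / b\<bar>
      \<le> real q * (2 ^ (q - 1) / \<bar>a\<bar> + 2 ^ (q - 1) / \<bar>b\<bar>)" by (intro mult_left_mono) auto
    then show ?thesis using False by (simp add: bspline_diff_def abs_mult a_def b_def)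
  qed
  then show ?thesis by blast
qed (auto simp: bspline_diff_def)

lemma dspl_bounded: 
  assumes "n \<ge> 1"
  obtains C where "C \<ge> 0" "\<And>t. \<bar>dspl p n c t\<bar> \<le> C"
proof -
  obtain B where B: "\<And>i t. \<bar>bspline_diff n p p (i + 1) t\<bar> \<le> B i"   proof -
    have "\<forall>i. \<exists>B. \<forall>t. \<bar>bspline_diff n p p (i + 1) t\<bar> \<le> B" using bspline_diff_bounded[OF assms] by blast
    then show ?thesis using that by metis
  qed
  have "\<bar>dspl p n c t\<bar> \<le> (\<Sum>i<dimN p n. \<bar>c i\<bar> * B i)" for t
    unfolding dspl_def by (rule order_trans[OF sum_abs]) (auto intro!: sum_mono mult_left_mono simp: abs_mult B[simplified])
  moreover have "0 \<le> \<bar>dspl p n c t\<bar>" for t by simp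
  ultimately show ?thesis using that order_trans by blast
qed

lemma borel_measurable_bspline_diff [measurable]: "bspline_diff n p q j \<in> borel_measurable borel"
  unfolding bspline_diff_def[abs_def] by measurable

lemma borel_imp_lebesgue_on:
  "f \<in> borel_measurable borel \<Longrightarrow> f \<in> borel_measurable (lebesgue_on S)" for f :: "real \<Rightarrow> real"
  by (intro measurable_restrict_space1 measurable_completion) simp

lemma weighted_product_integrable:
  fixes w f g :: "real \<Rightarrow> real"
  assumes w: "continuous_on {0..1} w"
    and f: "f \<in> borel_measurable borel" "\<And>t. \<bar>f t\<bar> \<le> C1" and g: "g \<in> borel_measurable borel" "\<And>t. \<bar>g t\<bar> \<le> C2"
  shows "(\<lambda>x. w x * f x * g x) integrable_on {0..1}"
proof -
  obtain b where b: "\<And>x. x \<in> {0..1} \<Longrightarrow> \<bar>w x\<bar> \<le> b"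
  proof -
    have "bounded (w ` {0..1})" by (intro compact_imp_bounded compact_continuous_image[OF w]) simp
    then obtain a where "\<forall>x\<in>w ` {0..1}. \<bar>x\<bar> \<le> a" unfolding bounded_real by blast
    then show ?thesis using that by blast
  qed
  show ?thesis
  proof (rule measurable_bounded_by_integrable_imp_integrable)
    show "(\<lambda>x. w x * f x * g x) \<in> borel_measurable (lebesgue_on {0..1})"
      by (intro borel_measurable_times borel_imp_lebesgue_on f g continuous_imp_measurable_on_sets_lebesgue[OF w]) auto
    show "(\<lambda>x. b * C1 * C2) integrable_on {0..1::real}" by (rule integrable_const_ivl)
    show "norm (w x * f x * g x) \<le> b * C1 * C2" if "x \<in> {0..1}" for x
    proof -
      have "\<bar>w x\<bar> \<le> b" "\<bar>f x\<bar> \<le> C1" "\<bar>g x\<bar> \<le> C2" using b f g that by auto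
      then show ?thesis unfolding real_norm_def abs_mult
        by (intro mult_mono) (auto intro: order_trans[OF abs_ge_zero] mult_nonneg_nonneg)
    qed
  qed auto
qed

lemma integral_double_sum:
  fixes f :: "nat \<Rightarrow> nat \<Rightarrow> real \<Rightarrow> real"
  assumes "\<And>i j. i < N \<Longrightarrow> j < N \<Longrightarrow> f i j integrable_on S"
  shows "(\<Sum>i<N. \<Sum>j<N. a i j * integral S (f i j)) = integral S (\<lambda>x. \<Sum>i<N. \<Sum>j<N. a i j * f i j x)"
  using assms by (intro integral_unique[symmetric] has_integral_sum has_integral_mult_right integrable_integral) auto

lemma continuous_weight:
  assumes "\<phi> \<in> C01"
  shows "continuous_on {0..1} (\<lambda>x. 1 / D01 \<phi> x)"
  using C01D(2,3)[OF assms] by (intro continuous_intros) force+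

context
  fixes p n :: nat
  assumes p: "p \<ge> 1" and n: "n \<ge> 1"
begin

lemma spline_without_end_terms:
  fixes a :: "nat \<Rightarrow> real"
  assumes "a 0 = 0" "a (p + n - 1) = 0"
  shows "(\<Sum>j = 0..<p + n. a j * bspline n p p j t) = spl p n (\<lambda>i. a (i + 1)) t"
proof -
  have pn: "p + n = Suc (Suc (dimN p n))" using p n by (simp add: dimN_def)
  then have l: "a (Suc (dimN p n)) = 0" using assms(2) by simp
  show ?thesis
    unfolding spl_def pn atLeast0LessThan sum.lessThan_Suc[of _ "Suc (dimN p n)"] sum.lessThan_Suc_shift[of _ "dimN p n"]
    using assms(1) l by simp
qed

text \<open>Linear independence, which makes the mass matrix positive definite.\<close>

lemma spl_eq_0_imp:
  assumes "\<And>t. t \<in> {0..1} \<Longrightarrow> spl p n c t = 0" "i < dimN p n"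
  shows "c i = 0"
proof -
  define a where "a j = (if 1 \<le> j \<and> j \<le> dimN p n then c (j - 1) else 0)" for j
  have e: "a 0 = 0" "a (p + n - 1) = 0" using p n by (auto simp: a_def dimN_def)
  have "a (i + 1) = 0"
  proof (rule bspline_independent[OF n, of p p])
    show "i + 1 \<in> {p - p..<p + n}" using assms(2) by (auto simp: dimN_def)
    fix t :: real assume "t \<in> {0<..<1}"
    then have "spl p n c t = 0" using assms(1)[of t] by simp
    moreover have "spl p n (\<lambda>i. a (i + 1)) t = spl p n c t" unfolding spl_def by (intro sum.cong) (auto simp: a_def)
    ultimately show "(\<Sum>j = p - p..<p + n. a j * bspline n p p j t) = 0" using spline_without_end_terms[OF e, of t] by simp
  qed simp
  then show ?thesis using assms(2) by (simp add: a_def)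
qed

lemma spl_lipschitz:
  obtains C where "C \<ge> 0" "\<And>s t. s \<in> {0..1} \<Longrightarrow> t \<in> {0..1} \<Longrightarrow> \<bar>spl p n c t - spl p n c s\<bar> \<le> C * \<bar>t - s\<bar>"
proof -
  obtain C where C: "C \<ge> 0" "\<And>t. \<bar>dspl p n c t\<bar> \<le> C" using dspl_bounded[OF n] by blast
  have main: "\<bar>spl p n c t - spl p n c s\<bar> \<le> C * (t - s)" if "s \<in> {0..1}" "t \<in> {0..1}" "s \<le> t" for s t
  proof -
    have "(dspl p n c has_integral (spl p n c t - spl p n c s)) {s..t}"
    proof (rule fundamental_theorem_of_calculus_interior_strong[OF finite_knots[OF n, of p] that(3)])
      show "(spl p n c has_vector_derivative dspl p n c x) (at x)" if "x \<in> {s<..<t} - range (knot n p)" for x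
        using spl_has_derivative[OF n, of x p c] that by (simp add: has_real_derivative_iff_has_vector_derivative)
      show "continuous_on {s..t} (spl p n c)" using that by (intro continuous_on_subset[OF continuous_on_spl[OF p n]]) auto
    qed
    then have "norm (spl p n c t - spl p n c s) \<le> C * measure lborel (cbox s t)"
      by (intro has_integral_bound[OF C(1)]) (auto intro: C(2))
    then show ?thesis using that(3) by simp
  qed
  show ?thesis
  proof (rule that[OF C(1)])
    fix s t :: real assume "s \<in> {0..1}" "t \<in> {0..1}"
    then show "\<bar>spl p n c t - spl p n c s\<bar> \<le> C * \<bar>t - s\<bar>"
      using main[of s t] main[of t s] by (cases "s \<le> t") (auto simp: abs_minus_commute)
  qed
qed

end

context
  fixes p n :: nat and \<phi> :: "real \<Rightarrow> real"
  assumes p: "p \<ge> 1" and n: "n \<ge> 1" and \<phi>: "\<phi> \<in> C01"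
begin

lemma mass_qform:
  "mass_form p \<phi> n v w = integral {0..1} (\<lambda>x. D01 \<phi> x * spl p n v x * spl p n w x)"
  "(\<lambda>x. D01 \<phi> x * spl p n v x * spl p n w x) integrable_on {0..1}"
proof -
  let ?B = "\<lambda>i. bspline n p p (i + 1)"
  have cont: "continuous_on {0..1} (\<lambda>x. D01 \<phi> x * ?B i x * ?B j x)" if "i < dimN p n" "j < dimN p n" for i j
    using spl_index[OF that(1) p n] spl_index[OF that(2) p n]
    by (intro continuous_intros C01D(2)[OF \<phi>] continuous_on_bspline n p) auto
  have eq: "mass_entry p \<phi> n i j = integral {0..1} (\<lambda>x. D01 \<phi> x * ?B i x * ?B j x)" for i j
    unfolding mass_entry_def by (intro integral_cong arg_cong2[where f = "(*)"] abs_of_pos C01D(3)[OF \<phi>] refl)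
  have "mass_form p \<phi> n v w
      = (\<Sum>i<dimN p n. \<Sum>j<dimN p n. (v i * w j) * integral {0..1} (\<lambda>x. D01 \<phi> x * ?B i x * ?B j x))"
    unfolding qform_def eq by (intro sum.cong refl) (simp only: mult_ac)
  also have "\<dots> = integral {0..1} (\<lambda>x. \<Sum>i<dimN p n. \<Sum>j<dimN p n. (v i * w j) * (D01 \<phi> x * ?B i x * ?B j x))"
    by (intro integral_double_sum integrable_continuous_interval cont)
  also have "(\<lambda>x. \<Sum>i<dimN p n. \<Sum>j<dimN p n. (v i * w j) * (D01 \<phi> x * ?B i x * ?B j x))
      = (\<lambda>x. D01 \<phi> x * spl p n v x * spl p n w x)"
    unfolding spl_def sum_distrib_left sum_distrib_right
    by (intro ext, subst sum.swap, intro sum.cong refl) (simp only: mult_ac)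
  finally show "mass_form p \<phi> n v w = integral {0..1} (\<lambda>x. D01 \<phi> x * spl p n v x * spl p n w x)" .
  show "(\<lambda>x. D01 \<phi> x * spl p n v x * spl p n w x) integrable_on {0..1}"
    by (intro integrable_continuous_interval continuous_intros continuous_on_spl C01D(2)[OF \<phi>] p n)
qed

text \<open>Replacing \<open>deriv\<close> by the explicit formula changes the integrands only at the finitely many knots.\<close>

lemma stiff_qform:
  "stiff_form p \<phi> n v w = integral {0..1} (\<lambda>x. 1 / D01 \<phi> x * dspl p n v x * dspl p n w x)"
  "(\<lambda>x. 1 / D01 \<phi> x * dspl p n v x * dspl p n w x) integrable_on {0..1}"
proof -
  let ?B = "\<lambda>i. bspline_diff n p p (i + 1)"
  have int: "(\<lambda>x. 1 / D01 \<phi> x * ?B i x * ?B j x) integrable_on {0..1}" for i j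
  proof -
    obtain C1 C2 where "\<And>t. \<bar>?B i t\<bar> \<le> C1" "\<And>t. \<bar>?B j t\<bar> \<le> C2" using bspline_diff_bounded[OF n] by metis
    then show ?thesis
      by (intro weighted_product_integrable[OF continuous_weight[OF \<phi>]] borel_measurable_bspline_diff) auto
  qed
  have eq: "stiff_entry p \<phi> n i j = integral {0..1} (\<lambda>x. 1 / D01 \<phi> x * ?B i x * ?B j x)" for i j
    unfolding stiff_entry_def
  proof (rule integral_spike[OF negligible_finite[OF finite_knots[OF n, of p]]])
    fix x assume x: "x \<in> {0..1} - range (knot n p)"
    then have "deriv (bspline n p p i) x = bspline_diff n p p i x" for i
      by (intro DERIV_imp_deriv bspline_has_derivative n) auto
    then show "1 / D01 \<phi> x * ?B i x * ?B j x = 1 / \<bar>D01 \<phi> x\<bar> * deriv (bspline n p p (i + 1)) x * deriv (bspline n p p (j + 1)) x"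
      using C01D(3)[OF \<phi>, of x] x by simp
  qed
  have "stiff_form p \<phi> n v w
      = (\<Sum>i<dimN p n. \<Sum>j<dimN p n. (v i * w j) * integral {0..1} (\<lambda>x. 1 / D01 \<phi> x * ?B i x * ?B j x))"
    unfolding qform_def eq by (intro sum.cong refl) (simp only: mult_ac)
  also have "\<dots> = integral {0..1} (\<lambda>x. \<Sum>i<dimN p n. \<Sum>j<dimN p n. (v i * w j) * (1 / D01 \<phi> x * ?B i x * ?B j x))"
    by (intro integral_double_sum int)
  also have fe: "(\<lambda>x. \<Sum>i<dimN p n. \<Sum>j<dimN p n. (v i * w j) * (1 / D01 \<phi> x * ?B i x * ?B j x))
      = (\<lambda>x. 1 / D01 \<phi> x * dspl p n v x * dspl p n w x)"
    unfolding dspl_def sum_distrib_left sum_distrib_right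
    by (intro ext, subst sum.swap, intro sum.cong refl) (simp only: mult_ac)
  finally show "stiff_form p \<phi> n v w = integral {0..1} (\<lambda>x. 1 / D01 \<phi> x * dspl p n v x * dspl p n w x)" .
  show "(\<lambda>x. 1 / D01 \<phi> x * dspl p n v x * dspl p n w x) integrable_on {0..1}"
    unfolding fe[symmetric] by (intro integrable_sum integrable_on_mult_right int) auto
qed

lemma mass_pos:
  assumes "\<exists>i<dimN p n. c i \<noteq> 0"
  shows "0 < mass_form p \<phi> n c c"
proof -
  let ?f = "\<lambda>x. D01 \<phi> x * spl p n c x * spl p n c x"
  have nn: "0 \<le> ?f x" if "x \<in> {0..1}" for x using C01D(3)[OF \<phi> that] by (simp add: mult.assoc)
  have cont: "continuous_on {0..1} ?f" by (intro continuous_intros continuous_on_spl C01D(2)[OF \<phi>] p n)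
  have "integral {0..1} ?f \<noteq> 0"
  proof
    assume "integral {0..1} ?f = 0"
    then have "\<forall>x\<in>{0..1}. ?f x = 0" using integral_eq_0_iff[OF cont] nn by simp
    then have "spl p n c x = 0" if "x \<in> {0..1}" for x using that C01D(3)[OF \<phi> that] by force
    with assms spl_eq_0_imp[OF p n] show False by blast
  qed
  moreover have "0 \<le> integral {0..1} ?f" using nn by (intro integral_nonneg integrable_continuous_interval cont) auto
  ultimately show ?thesis by (simp add: mass_qform)
qed

text \<open>The eigenvalues \<open>lam\<close>, defined through the characteristic polynomial, are the successive minima of
  the Rayleigh quotient.\<close>

lemma eigenpairs:
  obtains v where
    "\<And>i j. i < dimN p n \<Longrightarrow> j < dimN p n \<Longrightarrow> mass_form p \<phi> n (v i) (v j) = (if i = j then 1 else 0)"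
    "\<And>i w. i < dimN p n \<Longrightarrow> stiff_form p \<phi> n (v i) w
        = lam p \<phi> n (Suc i) * mass_form p \<phi> n (v i) w"
    "\<And>i w. i < dimN p n \<Longrightarrow> (\<And>j. j < i \<Longrightarrow> mass_form p \<phi> n (v j) w = 0) \<Longrightarrow>
        lam p \<phi> n (Suc i) * mass_form p \<phi> n w w \<le> stiff_form p \<phi> n w w"
proof -
  let ?N = "dimN p n" and ?M = "mass_entry p \<phi> n" and ?K = "stiff_entry p \<phi> n"
  have symM: "?M i j = ?M j i" for i j by (simp add: mass_entry_def mult_ac)
  have symK: "?K i j = ?K j i" for i j by (simp add: stiff_entry_def mult_ac)
  obtain v d where
    on': "\<forall>i<?N. \<forall>j<?N. qform ?N ?M (v i) (v j) = (if i = j then 1 else 0)" and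
    ev': "\<forall>i<?N. \<forall>w. qform ?N ?K (v i) w = d i * qform ?N ?M (v i) w" and
    mn': "\<forall>i<?N. \<forall>w. (\<forall>j<i. qform ?N ?M (v j) w = 0) \<longrightarrow> d i * qform ?N ?M w w \<le> qform ?N ?K w w"
    using generalized_eigenvectors[of ?N ?M ?K ?N, OF symM symK mass_pos order_refl] by blast
  have on: "\<And>i j. i < ?N \<Longrightarrow> j < ?N \<Longrightarrow> qform ?N ?M (v i) (v j) = (if i = j then 1 else 0)" and
    ev: "\<And>i w. i < ?N \<Longrightarrow> qform ?N ?K (v i) w = d i * qform ?N ?M (v i) w" and
    mn: "\<And>i w. i < ?N \<Longrightarrow> (\<forall>j<i. qform ?N ?M (v j) w = 0) \<Longrightarrow> d i * qform ?N ?M w w \<le> qform ?N ?K w w"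
    using on' ev' mn' by blast+
  have "M_mat p \<phi> n = Matrix.mat ?N ?N (\<lambda>(i, j). ?M i j)" "K_mat p \<phi> n = Matrix.mat ?N ?N (\<lambda>(i, j). ?K i j)"
    by (simp_all add: M_mat_def K_mat_def mass_entry_def stiff_entry_def)
  then have "sorted_list_of_multiset (proots (char_poly (L_mat p \<phi> n))) = map d [0..<?N]"
    unfolding L_mat_def using sorted_eigenvalues_of_pencil[of ?N ?M v ?K d, OF symM on ev mn] by simp
  then have "lam p \<phi> n (Suc i) = d i" if "i < ?N" for i using that by (simp add: lam_def)
  then show ?thesis using that[of v] on ev mn by simp
qed

text \<open>The span of the first \<open>k + 1\<close> eigenvectors contains a non-zero spline with \<open>k\<close> prescribed zeros, and its
  Rayleigh quotient is at most the largest of the \<open>k + 1\<close> eigenvalues.\<close>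

lemma lam_ge_if_rayleigh_ge:
  assumes k: "k < dimN p n"
    and R: "\<And>c. \<exists>i<dimN p n. c i \<noteq> 0 \<Longrightarrow> (\<And>j. j < k \<Longrightarrow> spl p n c (x j) = 0) \<Longrightarrow>
      \<mu> * mass_form p \<phi> n c c \<le> stiff_form p \<phi> n c c"
  shows "\<mu> \<le> lam p \<phi> n (Suc k)"
proof -
  let ?N = "dimN p n" and ?M = "mass_entry p \<phi> n" and ?K = "stiff_entry p \<phi> n"
  obtain v where
    on: "\<And>i j. i < ?N \<Longrightarrow> j < ?N \<Longrightarrow> qform ?N ?M (v i) (v j) = (if i = j then 1 else 0)" and
    ev: "\<And>i w. i < ?N \<Longrightarrow> qform ?N ?K (v i) w = lam p \<phi> n (Suc i) * qform ?N ?M (v i) w" and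
    mn: "\<And>i w. i < ?N \<Longrightarrow> (\<And>j. j < i \<Longrightarrow> qform ?N ?M (v j) w = 0) \<Longrightarrow> lam p \<phi> n (Suc i) * qform ?N ?M w w \<le> qform ?N ?K w w"
    using eigenpairs by blast
  obtain y where y: "\<exists>j<Suc k. y j \<noteq> 0" "\<And>i. i < k \<Longrightarrow> (\<Sum>j<Suc k. spl p n (v j) (x i) * y j) = 0"
    by (rule homogeneous_system_nontrivial[of k "Suc k" "\<lambda>i j. spl p n (v j) (x i)"]) auto
  define c where "c = (\<lambda>i. \<Sum>j<Suc k. y j * v j i)"
  have sq: "qform ?N ?M c c = (\<Sum>j<Suc k. (y j)\<^sup>2)" "qform ?N ?K c c = (\<Sum>j<Suc k. lam p \<phi> n (Suc j) * (y j)\<^sup>2)"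
  proof -
    have on': "\<And>i j. i < Suc k \<Longrightarrow> j < Suc k \<Longrightarrow> qform ?N ?M (v i) (v j) = (if i = j then 1 else 0)"
      by (rule on; use k in simp)
    have ev': "\<And>i w. i < Suc k \<Longrightarrow> qform ?N ?K (v i) w = lam p \<phi> n (Suc i) * qform ?N ?M (v i) w"
      by (rule ev; use k in simp)
    show "qform ?N ?M c c = (\<Sum>j<Suc k. (y j)\<^sup>2)" "qform ?N ?K c c = (\<Sum>j<Suc k. lam p \<phi> n (Suc j) * (y j)\<^sup>2)"
      unfolding c_def
      by (rule qform_eigen_combination(1)[where k = "Suc k" and N = ?N and M = ?M and v = v, OF on' ev'], assumption+)
        (rule qform_eigen_combination(2)[where k = "Suc k" and N = ?N and M = ?M and v = v and K = ?K
            and d = "\<lambda>i. lam p \<phi> n (Suc i)", OF on' ev'], assumption+)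
  qed
  have Ypos: "0 < (\<Sum>j<Suc k. (y j)\<^sup>2)"
  proof -
    obtain j where "j < Suc k" "y j \<noteq> 0" using y(1) by blast
    then show ?thesis by (intro sum_pos2[of _ j]) auto
  qed
  have "\<exists>i<?N. c i \<noteq> 0"
  proof (rule ccontr)
    assume "\<not> (\<exists>i<?N. c i \<noteq> 0)"
    then have "qform ?N ?M c c = 0" by (simp add: qform_def)
    then show False using sq(1) Ypos by simp
  qed
  moreover have "spl p n c (x i) = 0" if "i < k" for i
  proof -
    have "spl p n c (x i) = (\<Sum>l<?N. \<Sum>j<Suc k. y j * (v j l * bspline n p p (l + 1) (x i)))"
      unfolding spl_def c_def sum_distrib_right by (simp only: mult.assoc)
    also have "\<dots> = (\<Sum>j<Suc k. \<Sum>l<?N. y j * (v j l * bspline n p p (l + 1) (x i)))"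
      by (rule sum.swap)
    also have "\<dots> = (\<Sum>j<Suc k. spl p n (v j) (x i) * y j)"
      unfolding spl_def sum_distrib_left[symmetric] by (intro sum.cong refl) (simp add: mult.commute)
    finally show ?thesis using y(2)[OF that] by simp
  qed
  ultimately have "\<mu> * qform ?N ?M c c \<le> qform ?N ?K c c" by (rule R)
  also have "\<dots> \<le> (\<Sum>j<Suc k. lam p \<phi> n (Suc k) * (y j)\<^sup>2)"
    unfolding sq
  proof (intro sum_mono mult_right_mono)
    fix j assume "j \<in> {..<Suc k}"
    then have j: "j \<le> k" "j < ?N" using k by auto
    have "lam p \<phi> n (Suc j) * qform ?N ?M (v k) (v k) \<le> qform ?N ?K (v k) (v k)"
    proof (rule mn[OF j(2)])
      show "qform ?N ?M (v i) (v k) = 0" if "i < j" for i using on[of i k] that j k by simp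
    qed
    then show "lam p \<phi> n (Suc j) \<le> lam p \<phi> n (Suc k)" using on[of k k] ev[of k "v k"] k by simp
  qed auto
  finally have "\<mu> * (\<Sum>j<Suc k. (y j)\<^sup>2) \<le> lam p \<phi> n (Suc k) * (\<Sum>j<Suc k. (y j)\<^sup>2)"
    unfolding sq by (simp only: sum_distrib_left)
  then show ?thesis using Ypos by (rule mult_right_le_imp_le)
qed

text \<open>A trial space of dimension \<open>k + 1\<close> contains a non-zero vector orthogonal to the first \<open>k\<close> eigenvectors,
  and on such vectors the Rayleigh quotient is at least the next eigenvalue.\<close>

lemma lam_le_if_rayleigh_le:
  assumes k: "k < dimN p n"
    and R: "\<And>y c. \<exists>l<Suc k. y l \<noteq> 0 \<Longrightarrow> c = (\<lambda>i. \<Sum>l<Suc k. y l * w l i) \<Longrightarrow>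
      0 < mass_form p \<phi> n c c \<and> stiff_form p \<phi> n c c \<le> \<mu> * mass_form p \<phi> n c c"
  shows "lam p \<phi> n (Suc k) \<le> \<mu>"
proof -
  let ?N = "dimN p n" and ?M = "mass_entry p \<phi> n" and ?K = "stiff_entry p \<phi> n"
  obtain v where
    on: "\<And>i j. i < ?N \<Longrightarrow> j < ?N \<Longrightarrow> qform ?N ?M (v i) (v j) = (if i = j then 1 else 0)" and
    ev: "\<And>i w. i < ?N \<Longrightarrow> qform ?N ?K (v i) w = lam p \<phi> n (Suc i) * qform ?N ?M (v i) w" and
    mn: "\<And>i w. i < ?N \<Longrightarrow> (\<And>j. j < i \<Longrightarrow> qform ?N ?M (v j) w = 0) \<Longrightarrow> lam p \<phi> n (Suc i) * qform ?N ?M w w \<le> qform ?N ?K w w"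
    using eigenpairs by blast
  obtain y where y: "\<exists>j<Suc k. y j \<noteq> 0" "\<And>i. i < k \<Longrightarrow> (\<Sum>j<Suc k. qform ?N ?M (v i) (w j) * y j) = 0"
    by (rule homogeneous_system_nontrivial[of k "Suc k" "\<lambda>i j. qform ?N ?M (v i) (w j)"]) auto
  define c where "c = (\<lambda>i. \<Sum>l<Suc k. y l * w l i)"
  have z: "qform ?N ?M (v i) c = 0" if "i < k" for i
  proof -
    have "qform ?N ?M (v i) c = (\<Sum>j<Suc k. y j * qform ?N ?M (v i) (w j))" unfolding c_def by (rule qform_sum_right)
    also have "\<dots> = (\<Sum>j<Suc k. qform ?N ?M (v i) (w j) * y j)" by (intro sum.cong refl mult.commute)
    finally show ?thesis using y(2)[OF that] by (simp only:)
  qed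
  note R' = R[OF y(1) c_def]
  have "lam p \<phi> n (Suc k) * qform ?N ?M c c \<le> qform ?N ?K c c" using z by (rule mn[OF k])
  also have "\<dots> \<le> \<mu> * qform ?N ?M c c" by (rule conjunct2[OF R'])
  finally show ?thesis by (rule mult_right_le_imp_le) (rule conjunct1[OF R'])
qed

end

section \<open>The lower bound: Picone's identity between prescribed zeros\<close>

lemma C01_calculus:
  assumes \<phi>: "\<phi> \<in> C01"
  shows "continuous_on {0..1} \<phi>"
    "\<And>x. x \<in> {0<..<1} \<Longrightarrow> (\<phi> has_real_derivative D01 \<phi> x) (at x)"
    "\<And>x. x \<in> {0..1} \<Longrightarrow> (\<phi> has_real_derivative D01 \<phi> x) (at x within {0..1})"
    "\<And>a b. 0 \<le> a \<Longrightarrow> a < b \<Longrightarrow> b \<le> 1 \<Longrightarrow> \<phi> a < \<phi> b"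
    "\<And>y. y \<in> {0..1} \<Longrightarrow> \<exists>x\<in>{0..1}. \<phi> x = y"
proof -
  show d: "(\<phi> has_real_derivative D01 \<phi> x) (at x within {0..1})" if "x \<in> {0..1}" for x
    using C01D(1)[OF \<phi> that] by (simp add: has_real_derivative_iff_has_vector_derivative)
  then show c: "continuous_on {0..1} \<phi>" by (rule DERIV_continuous_on)
  show d': "(\<phi> has_real_derivative D01 \<phi> x) (at x)" if "x \<in> {0<..<1}" for x
  proof -
    have "(\<phi> has_real_derivative D01 \<phi> x) (at x within {0<..<1})"
      using that by (intro DERIV_subset[OF d]) auto
    then show ?thesis using at_within_open[OF that] by simp
  qed
  show "\<phi> a < \<phi> b" if ab: "0 \<le> a" "a < b" "b \<le> 1" for a b
  proof -
    obtain z where z: "a < z" "z < b" "\<phi> b - \<phi> a = D01 \<phi> z * (b - a)"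
    proof (rule mvt[OF ab(2), of \<phi> "\<lambda>z. (*) (D01 \<phi> z)"])
      show "continuous_on {a..b} \<phi>" using ab by (intro continuous_on_subset[OF c]) auto
      show "(\<phi> has_derivative (*) (D01 \<phi> z)) (at z)" if "a < z" "z < b" for z
        using d'[of z] that ab by (simp add: has_field_derivative_def)
    qed blast
    have "0 < D01 \<phi> z * (b - a)" using C01D(3)[OF \<phi>, of z] z ab by (intro mult_pos_pos) auto
    then show ?thesis using z(3) by simp
  qed
  show "\<exists>x\<in>{0..1}. \<phi> x = y" if "y \<in> {0..1}" for y
    using IVT'[of \<phi> 0 y 1] that c C01D(4,5)[OF \<phi>] by force
qed

text \<open>A double zero of the numerator beats a simple zero of the denominator. This gives the limits of
  Picone's function at the end points.\<close>

lemma square_over_simple_zero_tendsto: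
  fixes g h u :: "real \<Rightarrow> real"
  assumes g: "(g has_real_derivative G) (at e within T)" "G \<noteq> 0" "g e = 0"
    and u: "\<And>t. t \<in> T \<Longrightarrow> \<bar>u t\<bar> \<le> C * \<bar>t - e\<bar>" and h: "\<And>t. \<bar>h t\<bar> \<le> K"
  shows "((\<lambda>t. h t * (u t)\<^sup>2 / g t) \<longlongrightarrow> 0) (at e within T)"
proof (rule Lim_null_comparison)
  have "((\<lambda>t. \<bar>(g t - g e) / (t - e)\<bar>) \<longlongrightarrow> \<bar>G\<bar>) (at e within T)"
    using g(1) by (intro tendsto_rabs) (simp add: has_field_derivative_iff)
  moreover have "\<bar>G\<bar> / 2 < \<bar>G\<bar>" using g(2) by simp
  ultimately have "\<forall>\<^sub>F t in at e within T. \<bar>G\<bar> / 2 < \<bar>(g t - g e) / (t - e)\<bar>" by (rule order_tendstoD(1))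
  moreover have "\<forall>\<^sub>F t in at e within T. t \<in> T \<and> t \<noteq> e" by (auto simp: eventually_at_filter)
  ultimately show "\<forall>\<^sub>F t in at e within T. norm (h t * (u t)\<^sup>2 / g t) \<le> (2 * K * C\<^sup>2 / \<bar>G\<bar>) * \<bar>t - e\<bar>"
  proof eventually_elim
    case (elim t)
    define d where "d = \<bar>t - e\<bar>"
    have d: "d > 0" using elim by (simp add: d_def)
    have gd: "\<bar>G\<bar> / 2 * d \<le> \<bar>g t\<bar>" using elim g(3) d by (simp add: abs_divide d_def[symmetric] field_simps)
    have K: "0 \<le> K" using h[of 0] by linarith
    have "\<bar>u t\<bar>\<^sup>2 \<le> (C * d)\<^sup>2" using u[of t] elim unfolding d_def by (intro power_mono) auto
    then have "\<bar>h t\<bar> * \<bar>u t\<bar>\<^sup>2 \<le> K * (C * d)\<^sup>2" using h K by (intro mult_mono) auto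
    then have "\<bar>h t\<bar> * \<bar>u t\<bar>\<^sup>2 / \<bar>g t\<bar> \<le> K * (C * d)\<^sup>2 / (\<bar>G\<bar> / 2 * d)"
      using gd d g(2) K by (intro frac_le) auto
    also have "\<dots> = (2 * K * C\<^sup>2 / \<bar>G\<bar>) * d" using d g(2) by (simp add: field_simps power2_eq_square)
    finally show ?case by (simp add: abs_mult abs_divide d_def)
  qed
  have "((\<lambda>t. X * \<bar>t - e\<bar>) \<longlongrightarrow> X * \<bar>e - e\<bar>) (at e within T)" for X
    by (intro tendsto_intros)
  from this[of "2 * K * C\<^sup>2 / \<bar>G\<bar>"]
  show "((\<lambda>t. (2 * K * C\<^sup>2 / \<bar>G\<bar>) * \<bar>t - e\<bar>) \<longlongrightarrow> 0) (at e within T)"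
    by (simp only: diff_self abs_zero mult_zero_right)
qed

context
  fixes p n :: nat and \<phi> :: "real \<Rightarrow> real"
  assumes p: "p \<ge> 1" and n: "n \<ge> 1" and \<phi>: "\<phi> \<in> C01"
begin

lemma rayleigh_defect_integrable:
  "(\<lambda>x. 1 / D01 \<phi> x * dspl p n c x * dspl p n c x - \<kappa>\<^sup>2 * (D01 \<phi> x * spl p n c x * spl p n c x)) integrable_on {0..1}"
  by (intro integrable_diff integrable_on_mult_right stiff_qform(2) mass_qform(2) p n \<phi>)

text \<open>Picone's identity with \<open>sin (\<kappa> (\<phi> - \<phi> a))\<close>, which solves the continuous problem and has no zero inside
  the interval: the integrand differs from a non-negative square by the derivative of
  \<open>\<kappa> cot (\<kappa> (\<phi> - \<phi> a)) u\<^sup>2\<close>, and that function vanishes at both ends together with \<open>u\<close>.\<close>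

lemma picone_interval:
  assumes ab: "0 \<le> a" "a < b" "b \<le> 1" and \<kappa>: "\<kappa> > 0" "\<kappa> * (\<phi> b - \<phi> a) = pi"
    and u0: "spl p n c a = 0" "spl p n c b = 0"
  shows "0 \<le> integral {a..b} (\<lambda>x. 1 / D01 \<phi> x * dspl p n c x * dspl p n c x - \<kappa>\<^sup>2 * (D01 \<phi> x * spl p n c x * spl p n c x))"
proof -
  define u where "u = spl p n c"
  define u' where "u' = dspl p n c"
  define D where "D = D01 \<phi>"
  define s where "s t = \<kappa> * (\<phi> t - \<phi> a)" for t
  \<comment> \<open>Picone's function. At the end points the denominator is 0, and the value \<open>x / 0 = 0\<close> is the limit.\<close>
  define F where "F t = \<kappa> * cos (s t) * (u t)\<^sup>2 / sin (s t)" for t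
  define G where "G x = 1 / D x * u' x * u' x - \<kappa>\<^sup>2 * (D x * u x * u x)" for x
  define F' where "F' x = 2 * \<kappa> * cos (s x) * u x * u' x / sin (s x) - \<kappa>\<^sup>2 * D x * (u x)\<^sup>2 / (sin (s x))\<^sup>2" for x
  define X where "X = range (knot n p) \<union> {a, b}"
  have finX: "finite X" using finite_knots[OF n] by (simp add: X_def)
  have s_in: "s t \<in> {0<..<pi}" if "t \<in> {a<..<b}" for t
  proof -
    have "\<phi> a < \<phi> t" "\<phi> t < \<phi> b" using that ab by (intro C01_calculus(4)[OF \<phi>]; simp)+
    then have "0 < \<kappa> * (\<phi> t - \<phi> a)" "\<kappa> * (\<phi> t - \<phi> a) < \<kappa> * (\<phi> b - \<phi> a)"
      using \<kappa>(1) by (auto intro!: mult_pos_pos mult_strict_left_mono)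
    then show ?thesis using \<kappa>(2) by (simp add: s_def)
  qed
  have sin_pos: "sin (s t) > 0" if "t \<in> {a<..<b}" for t using s_in[OF that] by (intro sin_gt_zero) auto
  have s_der: "(s has_real_derivative \<kappa> * D t) (at t within {a..b})" if "t \<in> {a..b}" for t
  proof -
    have "(\<phi> has_real_derivative D t) (at t within {a..b})"
      unfolding D_def using that ab by (intro DERIV_subset[OF C01_calculus(3)[OF \<phi>]]) auto
    then have "((\<lambda>t. \<kappa> * (\<phi> t - \<phi> a)) has_real_derivative \<kappa> * (D t - 0)) (at t within {a..b})"
      by (intro DERIV_cmult DERIV_diff DERIV_const)
    then show ?thesis by (simp add: s_def[abs_def])
  qed
  have cont_u: "continuous_on {a..b} u" unfolding u_def using ab by (intro continuous_on_subset[OF continuous_on_spl[OF p n]]) auto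
  have cont_s: "continuous_on {a..b} s" using s_der by (rule DERIV_continuous_on)
  obtain C where C: "\<And>x y. x \<in> {0..1} \<Longrightarrow> y \<in> {0..1} \<Longrightarrow> \<bar>u y - u x\<bar> \<le> C * \<bar>y - x\<bar>"
  proof (rule spl_lipschitz[OF p n, where c = c])
    fix C assume "\<And>s t. s \<in> {0..1} \<Longrightarrow> t \<in> {0..1} \<Longrightarrow> \<bar>spl p n c t - spl p n c s\<bar> \<le> C * \<bar>t - s\<bar>"
    then show thesis by (intro that[of C]) (simp only: u_def)
  qed
  have ends: "s a = 0" "s b = pi" using \<kappa>(2) by (simp_all add: s_def)
  have end_tends: "(F \<longlongrightarrow> 0) (at e within {a..b})" if e: "e \<in> {a, b}" for e
  proof -
    have "((\<lambda>t. sin (s t)) has_real_derivative cos (s e) * (\<kappa> * D e)) (at e within {a..b})"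
      by (rule DERIV_chain2[OF DERIV_sin s_der]) (use e ab in auto)
    moreover have "cos (s e) * (\<kappa> * D e) \<noteq> 0"
      using e ends \<kappa>(1) C01D(3)[OF \<phi>, of e] ab unfolding D_def by auto
    moreover have "sin (s e) = 0" using e ends by auto
    moreover have "\<bar>u t\<bar> \<le> C * \<bar>t - e\<bar>" if "t \<in> {a..b}" for t
      using C[of e t] e u0 that ab by (auto simp: u_def)
    moreover have "\<bar>\<kappa> * cos (s t)\<bar> \<le> \<kappa>" for t using \<kappa>(1) by (simp add: abs_mult)
    ultimately show ?thesis unfolding F_def[abs_def] by (rule square_over_simple_zero_tendsto)
  qed
  have F_ends: "F a = 0" "F b = 0" by (simp_all add: F_def ends)
  have contF: "continuous_on {a..b} F"
    unfolding continuous_on_def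
  proof
    fix x assume x: "x \<in> {a..b}"
    show "(F \<longlongrightarrow> F x) (at x within {a..b})"
    proof (cases "x \<in> {a, b}")
      case True
      then show ?thesis using end_tends[OF True] F_ends by auto
    next
      case False
      then have "sin (s x) \<noteq> 0" using sin_pos[of x] x by auto
      then show ?thesis using cont_u cont_s x unfolding F_def continuous_on_def
        by (intro tendsto_intros) auto
    qed
  qed
  have derF: "(F has_vector_derivative F' x) (at x)" if x: "x \<in> {a<..<b} - X" for x
  proof -
    have S: "sin (s x) \<noteq> 0" using sin_pos[of x] x by auto
    have "(s has_real_derivative \<kappa> * D x) (at x within {a<..<b})"
      using x by (intro DERIV_subset[OF s_der]) auto
    then have sd: "(s has_real_derivative \<kappa> * D x) (at x)" using at_within_open[of x "{a<..<b}"] x by auto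
    have ud: "(u has_real_derivative u' x) (at x)"
      unfolding u_def u'_def using x by (intro spl_has_derivative[OF n]) (auto simp: X_def)
    have "((\<lambda>t. \<kappa> * cos (s t)) has_real_derivative \<kappa> * (- sin (s x) * (\<kappa> * D x))) (at x)"
      by (rule DERIV_cmult[OF DERIV_chain2[OF DERIV_cos sd]])
    moreover have "((\<lambda>t. (u t)\<^sup>2) has_real_derivative 2 * u x * u' x) (at x)"
      by (rule DERIV_cong[OF DERIV_power[OF ud]]) simp
    ultimately have num: "((\<lambda>t. \<kappa> * cos (s t) * (u t)\<^sup>2) has_real_derivative
      \<kappa> * (- sin (s x) * (\<kappa> * D x)) * (u x)\<^sup>2 + 2 * u x * u' x * (\<kappa> * cos (s x))) (at x)"
      by (rule DERIV_mult)
    have den: "((\<lambda>t. sin (s t)) has_real_derivative cos (s x) * (\<kappa> * D x)) (at x)"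
      by (rule DERIV_chain2[OF DERIV_sin sd])
    have alg: "((\<kappa> * (- S * (\<kappa> * d)) * v\<^sup>2 + 2 * v * v' * (\<kappa> * C)) * S - \<kappa> * C * v\<^sup>2 * (C * (\<kappa> * d))) / (S * S)
       = 2 * \<kappa> * C * v * v' / S - \<kappa>\<^sup>2 * d * v\<^sup>2 / S\<^sup>2"
      if "S \<noteq> 0" "S\<^sup>2 + C\<^sup>2 = 1" for S C d v v' :: real
    proof -
      have "(\<kappa> * (- S * (\<kappa> * d)) * v\<^sup>2 + 2 * v * v' * (\<kappa> * C)) * S - \<kappa> * C * v\<^sup>2 * (C * (\<kappa> * d))
        = 2 * \<kappa> * C * v * v' * S - \<kappa>\<^sup>2 * d * v\<^sup>2 * (S\<^sup>2 + C\<^sup>2)"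
        by (simp add: power2_eq_square algebra_simps)
      then show ?thesis using that by (simp add: diff_divide_distrib power2_eq_square)
    qed
    have "(F has_real_derivative F' x) (at x)"
      unfolding F_def[abs_def] F'_def
      by (rule DERIV_cong[OF DERIV_divide[OF num den S]]) (rule alg[OF S], simp)
    then show ?thesis by (simp add: has_real_derivative_iff_has_vector_derivative)
  qed
  have intF: "(F' has_integral 0) {a..b}"
    using fundamental_theorem_of_calculus_interior_strong[OF finX less_imp_le[OF ab(2)] derF contF] F_ends by simp
  have "G integrable_on {0..1}" unfolding G_def D_def u_def u'_def by (rule rayleigh_defect_integrable)
  then have "G integrable_on {a..b}" by (rule integrable_on_subinterval) (use ab in auto)
  then have "((\<lambda>x. G x - F' x) has_integral integral {a..b} G - 0) {a..b}"
    by (intro has_integral_diff intF integrable_integral)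
  then have I: "((\<lambda>x. G x - F' x) has_integral integral {a..b} G) {a..b}" by (simp only: diff_0_right)
  have "((\<lambda>x. if x \<in> X then 0 else G x - F' x) has_integral integral {a..b} G) {a..b}"
    by (rule has_integral_spike_finite[OF finX _ I]) simp
  moreover have "0 \<le> (if x \<in> X then 0 else G x - F' x)" if "x \<in> {a..b}" for x
  proof (cases "x \<in> X")
    case False
    then have "x \<noteq> a" "x \<noteq> b" unfolding X_def by blast+
    then have x: "x \<in> {a<..<b}" using that by simp
    then have S: "sin (s x) > 0" by (rule sin_pos)
    have Dp: "D x > 0" using C01D(3)[OF \<phi>, of x] x ab by (simp add: D_def)
    \<comment> \<open>The square is \<open>(u' - \<kappa> \<phi>' cot (s x) u)\<^sup>2 / \<phi>'\<close>.\<close>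
    have alg: "1 / d * v' * v' - \<kappa>\<^sup>2 * (d * v * v) - (2 * \<kappa> * C * v * v' / S - \<kappa>\<^sup>2 * d * v\<^sup>2 / S\<^sup>2)
        = (v' - \<kappa> * d * v * (C / S))\<^sup>2 / d" if "S \<noteq> 0" "d \<noteq> 0" "S\<^sup>2 + C\<^sup>2 = 1" for S C d v v' :: real
    proof -
      define r where "r = C / S"
      define q where "q = 1 / S\<^sup>2"
      have "C\<^sup>2 = 1 - S\<^sup>2" using that(3) by linarith
      then have "r\<^sup>2 = (1 - S\<^sup>2) / S\<^sup>2" by (simp only: r_def power_divide)
      then have c: "r\<^sup>2 = q - 1" using that(1) by (simp add: q_def diff_divide_distrib)
      have "(v' - \<kappa> * d * v * r)\<^sup>2 = v'\<^sup>2 - d * (2 * \<kappa> * v * v' * r) + d * (\<kappa>\<^sup>2 * d * v\<^sup>2 * r\<^sup>2)"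
        by (simp add: power2_eq_square algebra_simps)
      then have sq: "(v' - \<kappa> * d * v * r)\<^sup>2 / d = v'\<^sup>2 / d - 2 * \<kappa> * v * v' * r + \<kappa>\<^sup>2 * d * v\<^sup>2 * r\<^sup>2"
        by (simp only: diff_divide_distrib add_divide_distrib nonzero_mult_div_cancel_left[OF that(2)])
      have e1: "2 * \<kappa> * C * v * v' / S = 2 * \<kappa> * v * v' * r" by (simp add: r_def)
      have e2: "\<kappa>\<^sup>2 * d * v\<^sup>2 / S\<^sup>2 = \<kappa>\<^sup>2 * d * v\<^sup>2 * q" by (simp add: q_def)
      have e3: "1 / d * v' * v' = v'\<^sup>2 / d" by (simp add: power2_eq_square)
      have e4: "\<kappa>\<^sup>2 * (d * v * v) = \<kappa>\<^sup>2 * d * v\<^sup>2" by (simp only: power2_eq_square mult.assoc)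
      have "v'\<^sup>2 / d - \<kappa>\<^sup>2 * d * v\<^sup>2 - (2 * \<kappa> * v * v' * r - \<kappa>\<^sup>2 * d * v\<^sup>2 * q)
        = v'\<^sup>2 / d - 2 * \<kappa> * v * v' * r + \<kappa>\<^sup>2 * d * v\<^sup>2 * (q - 1)"
        unfolding right_diff_distrib mult_1_right by linarith
      then show ?thesis unfolding e1 e2 e3 e4 r_def[symmetric] sq c .
    qed
    have "G x - F' x = (u' x - \<kappa> * D x * u x * (cos (s x) / sin (s x)))\<^sup>2 / D x"
      unfolding G_def F'_def by (rule alg) (use S Dp in simp_all)
    then show ?thesis using False Dp by simp
  qed simp
  ultimately have "0 \<le> integral {a..b} G" by (rule has_integral_nonneg)
  moreover have "G = (\<lambda>x. 1 / D01 \<phi> x * dspl p n c x * dspl p n c x - \<kappa>\<^sup>2 * (D01 \<phi> x * spl p n c x * spl p n c x))"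
    by (rule ext) (simp only: G_def D_def u_def u'_def)
  ultimately show ?thesis by (simp only:)
qed

text \<open>Prescribing zeros at the preimages of \<open>j / (k + 1)\<close> under \<open>\<phi>\<close> splits the interval into \<open>k + 1\<close> pieces on
  which \<open>\<phi>\<close> grows by the same amount; on each of them Picone's identity bounds the Rayleigh quotient.\<close>

lemma lam_ge_laplace:
  assumes k: "k < dimN p n"
  shows "(real (Suc k) * pi)\<^sup>2 \<le> lam p \<phi> n (Suc k)"
proof -
  define m where "m = Suc k"
  define \<kappa> where "\<kappa> = real m * pi"
  have "\<forall>j. \<exists>x. j \<le> m \<longrightarrow> x \<in> {0..1} \<and> \<phi> x = real j / real m"
  proof
    fix j show "\<exists>x. j \<le> m \<longrightarrow> x \<in> {0..1} \<and> \<phi> x = real j / real m"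
      using C01_calculus(5)[OF \<phi>, of "real j / real m"] by (cases "j \<le> m") (auto simp: m_def)
  qed
  then obtain x where x: "\<And>j. j \<le> m \<Longrightarrow> x j \<in> {0..1} \<and> \<phi> (x j) = real j / real m" by metis
  have mono: "x j < x (Suc j)" if "Suc j \<le> m" for j
  proof (rule ccontr)
    assume "\<not> x j < x (Suc j)"
    then have "\<phi> (x (Suc j)) \<le> \<phi> (x j)"
      using x[of j] x[of "Suc j"] that C01_calculus(4)[OF \<phi>, of "x (Suc j)" "x j"] by (cases "x j = x (Suc j)") auto
    moreover have "real j / real m < real (Suc j) / real m" using that by (intro divide_strict_right_mono) auto
    ultimately show False using x[of j] x[of "Suc j"] that by simp
  qed
  have x0: "x 0 = 0"
  proof (rule ccontr)
    assume "x 0 \<noteq> 0"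
    then have "\<phi> 0 < \<phi> (x 0)" using x[of 0] by (intro C01_calculus(4)[OF \<phi>]) auto
    then show False using x[of 0] C01D(4)[OF \<phi>] by simp
  qed
  have xm: "x m = 1"
  proof (rule ccontr)
    assume "x m \<noteq> 1"
    then have "\<phi> (x m) < \<phi> 1" using x[of m] by (intro C01_calculus(4)[OF \<phi>]) auto
    then show False using x[of m] C01D(5)[OF \<phi>] by (simp add: m_def)
  qed
  show ?thesis
  proof (rule lam_ge_if_rayleigh_ge[OF p n \<phi> k, where x = "\<lambda>j. x (Suc j)"])
    fix c assume z: "\<And>j. j < k \<Longrightarrow> spl p n c (x (Suc j)) = 0"
    have z': "spl p n c (x j) = 0" if "j \<le> m" for j
    proof -
      consider "j = 0" | "j = m" | i where "j = Suc i" "i < k" using \<open>j \<le> m\<close> by (cases j) (auto simp: m_def le_less)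
      then show ?thesis using z spl_ends[OF p n, of c] x0 xm by cases auto
    qed
    define G where "G = (\<lambda>x. 1 / D01 \<phi> x * dspl p n c x * dspl p n c x - \<kappa>\<^sup>2 * (D01 \<phi> x * spl p n c x * spl p n c x))"
    have intG: "G integrable_on {0..1}" unfolding G_def by (rule rayleigh_defect_integrable)
    have "0 \<le> integral {0..x j} G" if "j \<le> m" for j
      using that
    proof (induction j)
      case 0
      then show ?case by (simp add: x0)
    next
      case (Suc j)
      have xs: "0 \<le> x j" "x j < x (Suc j)" "x (Suc j) \<le> 1" using x[of j] x[of "Suc j"] mono[of j] Suc.prems by auto
      have "\<kappa> * (\<phi> (x (Suc j)) - \<phi> (x j)) = pi"
      proof -
        have "\<phi> (x (Suc j)) - \<phi> (x j) = real (Suc j) / real m - real j / real m"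
          using x[of j] x[of "Suc j"] Suc.prems by simp
        also have "\<dots> = 1 / real m" by (simp add: diff_divide_distrib[symmetric])
        finally show ?thesis by (simp only: \<kappa>_def) (simp add: m_def)
      qed
      then have "0 \<le> integral {x j..x (Suc j)} G"
        unfolding G_def using xs z' Suc.prems by (intro picone_interval) (auto simp: \<kappa>_def m_def)
      moreover have "integral {0..x j} G + integral {x j..x (Suc j)} G = integral {0..x (Suc j)} G"
        using xs by (intro Henstock_Kurzweil_Integration.integral_combine integrable_on_subinterval[OF intG]) auto
      ultimately show ?case using Suc by simp
    qed
    from this[of m] have "0 \<le> integral {0..1} G" using xm by simp
    also have "integral {0..1} G = integral {0..1} (\<lambda>x. 1 / D01 \<phi> x * dspl p n c x * dspl p n c x)
        - integral {0..1} (\<lambda>x. \<kappa>\<^sup>2 * (D01 \<phi> x * spl p n c x * spl p n c x))"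
      unfolding G_def by (intro integral_diff integrable_on_mult_right stiff_qform(2) mass_qform(2) p n \<phi>)
    also have "\<dots> = stiff_form p \<phi> n c c - \<kappa>\<^sup>2 * mass_form p \<phi> n c c"
      unfolding mass_qform(1)[OF p n \<phi>] stiff_qform(1)[OF p n \<phi>] integral_mult_right ..
    finally show "(real (Suc k) * pi)\<^sup>2 * mass_form p \<phi> n c c \<le> stiff_form p \<phi> n c c"
      by (simp add: \<kappa>_def m_def)
  qed
qed

end

section \<open>The upper bound: splines near the sine modes\<close>

text \<open>The eigenfunctions of the continuous problem; \<open>l\<close> counts from 0.\<close>

definition sine_mode :: "(real \<Rightarrow> real) \<Rightarrow> nat \<Rightarrow> real \<Rightarrow> real" where
  "sine_mode \<phi> l x = sin (real (Suc l) * pi * \<phi> x)"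

definition sine_mode_deriv :: "(real \<Rightarrow> real) \<Rightarrow> nat \<Rightarrow> real \<Rightarrow> real" where
  "sine_mode_deriv \<phi> l x = real (Suc l) * pi * D01 \<phi> x * cos (real (Suc l) * pi * \<phi> x)"

text \<open>The substitution \<open>s = \<phi> x\<close> reduces this to the integral of \<open>cos (j \<pi> s)\<close> over \<open>[0,1]\<close>.\<close>

lemma cosine_integral:
  assumes \<phi>: "\<phi> \<in> C01"
  shows "((\<lambda>x. D01 \<phi> x * cos (of_int j * pi * \<phi> x)) has_integral (if j = 0 then 1 else 0)) {0..1}"
proof (cases "j = 0")
  case True
  then show ?thesis using C01D(6)[OF \<phi>] by simp
next
  case False
  have "((\<lambda>x. D01 \<phi> x * cos (of_int j * pi * \<phi> x)) has_integral
      (sin (of_int j * pi * \<phi> 1) / (of_int j * pi) - sin (of_int j * pi * \<phi> 0) / (of_int j * pi))) {0..1}"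
  proof (rule fundamental_theorem_of_calculus)
    fix x :: real assume x: "x \<in> {0..1}"
    have "((\<lambda>x. sin (of_int j * pi * \<phi> x)) has_real_derivative cos (of_int j * pi * \<phi> x) * (of_int j * pi * D01 \<phi> x)) (at x within {0..1})"
      by (rule DERIV_chain2[OF DERIV_sin DERIV_cmult[OF C01_calculus(3)[OF \<phi> x]]])
    then have "((\<lambda>x. sin (of_int j * pi * \<phi> x) / (of_int j * pi)) has_real_derivative
        cos (of_int j * pi * \<phi> x) * (of_int j * pi * D01 \<phi> x) / (of_int j * pi)) (at x within {0..1})"
      by (rule DERIV_cdivide)
    then show "((\<lambda>x. sin (of_int j * pi * \<phi> x) / (of_int j * pi)) has_vector_derivative D01 \<phi> x * cos (of_int j * pi * \<phi> x)) (at x within {0..1})"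
      using False by (simp add: has_real_derivative_iff_has_vector_derivative mult.commute)
  qed simp
  then show ?thesis using False C01D(4,5)[OF \<phi>] sin_npi_int[of j] by (simp add: mult.commute)
qed

lemma sine_mode_mass:
  assumes \<phi>: "\<phi> \<in> C01"
  shows "((\<lambda>x. D01 \<phi> x * sine_mode \<phi> l x * sine_mode \<phi> m x) has_integral (if l = m then 1 / 2 else 0)) {0..1}"
proof -
  note c = cosine_integral[OF \<phi>, THEN has_integral_mult_right[where c = "1/2"]]
  have "((\<lambda>x. 1 / 2 * (D01 \<phi> x * cos (of_int (int l - int m) * pi * \<phi> x)) - 1 / 2 * (D01 \<phi> x * cos (of_int (int l + int m + 2) * pi * \<phi> x)))
    has_integral (1 / 2 * (if int l - int m = 0 then 1 else 0) - 1 / 2 * (if int l + int m + 2 = 0 then 1 else 0))) {0..1}"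
    by (rule has_integral_diff[OF c c])
  moreover have "1 / 2 * (d * cos (of_int (int l - int m) * pi * y)) - 1 / 2 * (d * cos (of_int (int l + int m + 2) * pi * y))
      = d * sin (real (Suc l) * pi * y) * sin (real (Suc m) * pi * y)" for d y :: real
  proof -
    define a where "a = real (Suc l) * pi * y"
    define b where "b = real (Suc m) * pi * y"
    have ab: "of_int (int l - int m) * pi * y = a - b" "of_int (int l + int m + 2) * pi * y = a + b"
      by (simp_all add: a_def b_def algebra_simps)
    show ?thesis unfolding a_def[symmetric] b_def[symmetric] ab by (simp add: cos_add cos_diff algebra_simps)
  qed
  ultimately show ?thesis by (auto simp: sine_mode_def)
qed

lemma sine_mode_stiff:
  assumes \<phi>: "\<phi> \<in> C01"
  shows "((\<lambda>x. 1 / D01 \<phi> x * sine_mode_deriv \<phi> l x * sine_mode_deriv \<phi> m x) has_integral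
    (if l = m then (real (Suc l) * pi)\<^sup>2 / 2 else 0)) {0..1}"
proof -
  define \<alpha> where "\<alpha> = real (Suc l) * pi"
  define \<beta> where "\<beta> = real (Suc m) * pi"
  note c = cosine_integral[OF \<phi>, THEN has_integral_mult_right[where c = "\<alpha> * \<beta> / 2"]]
  have I: "((\<lambda>x. \<alpha> * \<beta> / 2 * (D01 \<phi> x * cos (of_int (int l - int m) * pi * \<phi> x)) + \<alpha> * \<beta> / 2 * (D01 \<phi> x * cos (of_int (int l + int m + 2) * pi * \<phi> x)))
    has_integral (\<alpha> * \<beta> / 2 * (if int l - int m = 0 then 1 else 0) + \<alpha> * \<beta> / 2 * (if int l + int m + 2 = 0 then 1 else 0))) {0..1}"
    by (rule has_integral_add[OF c c])
  have "((\<lambda>x. 1 / D01 \<phi> x * sine_mode_deriv \<phi> l x * sine_mode_deriv \<phi> m x) has_integral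
     (\<alpha> * \<beta> / 2 * (if int l - int m = 0 then 1 else 0) + \<alpha> * \<beta> / 2 * (if int l + int m + 2 = 0 then 1 else 0))) {0..1}"
  proof (rule has_integral_eq[OF _ I])
    fix x :: real assume "x \<in> {0..1}"
    then have d: "D01 \<phi> x \<noteq> 0" using C01D(3)[OF \<phi>, of x] by auto
    define y where "y = \<phi> x"
    have ab: "of_int (int l - int m) * pi * y = \<alpha> * y - \<beta> * y" "of_int (int l + int m + 2) * pi * y = \<alpha> * y + \<beta> * y"
      by (simp_all add: \<alpha>_def \<beta>_def algebra_simps)
    show "\<alpha> * \<beta> / 2 * (D01 \<phi> x * cos (of_int (int l - int m) * pi * \<phi> x)) + \<alpha> * \<beta> / 2 * (D01 \<phi> x * cos (of_int (int l + int m + 2) * pi * \<phi> x))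
      = 1 / D01 \<phi> x * sine_mode_deriv \<phi> l x * sine_mode_deriv \<phi> m x"
      unfolding sine_mode_deriv_def \<alpha>_def[symmetric] \<beta>_def[symmetric] y_def[symmetric] ab using d
      by (simp add: cos_add cos_diff field_simps)
  qed
  moreover have "\<alpha> * \<beta> / 2 * (if int l - int m = 0 then 1 else 0) + \<alpha> * \<beta> / 2 * (if int l + int m + 2 = 0 then 1 else 0)
     = (if l = m then (real (Suc l) * pi)\<^sup>2 / 2 else 0)"
    by (auto simp: \<alpha>_def \<beta>_def power2_eq_square)
  ultimately show ?thesis by simp
qed

lemma product_integral_close:
  fixes W S1 S2 F1 F2 :: "real \<Rightarrow> real"
  assumes "(\<lambda>x. W x * S1 x * S2 x) integrable_on {0..1}" and J: "((\<lambda>x. W x * F1 x * F2 x) has_integral J) {0..1}"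
    and X: "finite X" and e: "0 \<le> e" "e \<le> 1" and b: "0 \<le> b" "0 \<le> G"
    and pt: "\<And>x. x \<in> {0..1} - X \<Longrightarrow> \<bar>W x\<bar> \<le> b \<and> \<bar>S1 x - F1 x\<bar> \<le> e \<and> \<bar>S2 x - F2 x\<bar> \<le> e \<and> \<bar>F1 x\<bar> \<le> G \<and> \<bar>F2 x\<bar> \<le> G"
  shows "\<bar>integral {0..1} (\<lambda>x. W x * S1 x * S2 x) - J\<bar> \<le> b * (e * (2 * G + 1))"
proof -
  have I: "((\<lambda>x. W x * S1 x * S2 x - W x * F1 x * F2 x) has_integral (integral {0..1} (\<lambda>x. W x * S1 x * S2 x) - J)) (cbox 0 1)"
    using has_integral_diff[OF integrable_integral[OF assms(1)] J] by simp
  have B: "0 \<le> b * (e * (2 * G + 1))" using e b by simp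
  have "norm (integral {0..1} (\<lambda>x. W x * S1 x * S2 x) - J) \<le> b * (e * (2 * G + 1)) * measure lborel (cbox 0 (1::real))"
  proof (rule has_integral_bound_spike_finite[OF B X I])
    fix x :: real assume "x \<in> cbox 0 1 - X"
    then have P: "\<bar>W x\<bar> \<le> b" "\<bar>S1 x - F1 x\<bar> \<le> e" "\<bar>S2 x - F2 x\<bar> \<le> e" "\<bar>F1 x\<bar> \<le> G" "\<bar>F2 x\<bar> \<le> G"
      using pt[of x] by auto
    have "\<bar>S2 x\<bar> \<le> G + 1" using P e by linarith
    then have "\<bar>S1 x - F1 x\<bar> * \<bar>S2 x\<bar> + \<bar>F1 x\<bar> * \<bar>S2 x - F2 x\<bar> \<le> e * (G + 1) + G * e"
      using P e b by (intro add_mono mult_mono) auto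
    moreover have "S1 x * S2 x - F1 x * F2 x = (S1 x - F1 x) * S2 x + F1 x * (S2 x - F2 x)" by (simp add: algebra_simps)
    ultimately have "\<bar>S1 x * S2 x - F1 x * F2 x\<bar> \<le> e * (G + 1) + G * e"
      using abs_triangle_ineq[of "(S1 x - F1 x) * S2 x" "F1 x * (S2 x - F2 x)"] unfolding abs_mult by linarith
    also have "\<dots> = e * (2 * G + 1)" by (simp add: algebra_simps)
    finally have "\<bar>S1 x * S2 x - F1 x * F2 x\<bar> \<le> e * (2 * G + 1)" .
    then have "\<bar>W x\<bar> * \<bar>S1 x * S2 x - F1 x * F2 x\<bar> \<le> b * (e * (2 * G + 1))"
      using P(1) b by (intro mult_mono) auto
    moreover have "W x * S1 x * S2 x - W x * F1 x * F2 x = W x * (S1 x * S2 x - F1 x * F2 x)" by (simp add: algebra_simps)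
    ultimately show "norm (W x * S1 x * S2 x - W x * F1 x * F2 x) \<le> b * (e * (2 * G + 1))" by (simp add: abs_mult)
  qed
  then show ?thesis by simp
qed

text \<open>The coefficients of Schoenberg's spline of the sine mode. Its end coefficients vanish with the mode,
  so it belongs to the Galerkin space.\<close>

definition mode_coeff :: "nat \<Rightarrow> (real \<Rightarrow> real) \<Rightarrow> nat \<Rightarrow> nat \<Rightarrow> nat \<Rightarrow> real" where
  "mode_coeff p \<phi> n l i = sine_mode \<phi> l (greville n p (i + 1))"

lemma sine_mode_cont:
  assumes \<phi>: "\<phi> \<in> C01"
  shows "continuous_on {0..1} (sine_mode \<phi> l)" "continuous_on {0..1} (sine_mode_deriv \<phi> l)"
    "\<And>x. x \<in> {0<..<1} \<Longrightarrow> (sine_mode \<phi> l has_real_derivative sine_mode_deriv \<phi> l x) (at x)"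
proof -
  show "continuous_on {0..1} (sine_mode \<phi> l)" unfolding sine_mode_def[abs_def]
    by (intro continuous_intros C01_calculus(1)[OF \<phi>])
  show "continuous_on {0..1} (sine_mode_deriv \<phi> l)" unfolding sine_mode_deriv_def[abs_def]
    by (intro continuous_intros C01_calculus(1)[OF \<phi>] C01D(2)[OF \<phi>])
  show "(sine_mode \<phi> l has_real_derivative sine_mode_deriv \<phi> l x) (at x)" if "x \<in> {0<..<1}" for x
    unfolding sine_mode_def[abs_def] sine_mode_deriv_def
    by (rule DERIV_cong[OF DERIV_chain2[OF DERIV_sin DERIV_cmult[OF C01_calculus(2)[OF \<phi> that]]]]) (simp only: mult_ac)
qed

lemma uniform_modulus:
  fixes f :: "real \<Rightarrow> real"
  assumes "continuous_on {0..1} f" "e > 0"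
  shows "\<forall>\<^sub>F n in sequentially. \<forall>x\<in>{0..1}. \<forall>t\<in>{0..1}. \<bar>x - t\<bar> \<le> real (p + 1) / real n \<longrightarrow> \<bar>f x - f t\<bar> \<le> e"
proof -
  have "uniformly_continuous_on {0..1} f" using assms(1) by (intro compact_uniformly_continuous) auto
  then obtain d where d: "d > 0" "\<And>x t. x \<in> {0..1} \<Longrightarrow> t \<in> {0..1} \<Longrightarrow> dist x t < d \<Longrightarrow> dist (f x) (f t) < e"
    using assms(2) unfolding uniformly_continuous_on_def by metis
  have "(\<lambda>n. real (p + 1) / real n) \<longlonglongrightarrow> 0" by (rule lim_const_over_n)
  then have "\<forall>\<^sub>F n in sequentially. real (p + 1) / real n < d" using d(1) by (rule order_tendstoD(2))
  then show ?thesis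
  proof eventually_elim
    case (elim n)
    show ?case
    proof (intro ballI impI)
      fix x t :: real assume "x \<in> {0..1}" "t \<in> {0..1}" "\<bar>x - t\<bar> \<le> real (p + 1) / real n"
      then show "\<bar>f x - f t\<bar> \<le> e" using d(2)[of x t] elim by (simp add: dist_real_def)
    qed
  qed
qed

lemma mode_approximation:
  assumes p: "p \<ge> 1" and \<phi>: "\<phi> \<in> C01" and e: "e > 0"
  shows "\<forall>\<^sub>F n in sequentially. n \<ge> 1 \<and>
    (\<forall>t\<in>{0..1} - ({0, 1} \<union> range (knot n p)). \<bar>spl p n (mode_coeff p \<phi> n l) t - sine_mode \<phi> l t\<bar> \<le> e
      \<and> \<bar>dspl p n (mode_coeff p \<phi> n l) t - sine_mode_deriv \<phi> l t\<bar> \<le> e)"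
  using uniform_modulus[OF sine_mode_cont(1)[OF \<phi>, of l] e, of p]
    uniform_modulus[OF sine_mode_cont(2)[OF \<phi>, of l] e, of p] eventually_ge_at_top[of 1]
proof eventually_elim
  case (elim n)
  note n = elim(3)
  let ?a = "\<lambda>j. sine_mode \<phi> l (greville n p j)"
  have "sin (real (Suc l) * pi) = 0" by (rule sin_npi)
  then have a0: "?a 0 = 0" "?a (p + n - 1) = 0"
    using greville_ends[OF n p] C01D(4,5)[OF \<phi>] by (simp_all add: sine_mode_def del: of_nat_Suc)
  have S: "(\<lambda>t. \<Sum>j = 0..<p + n. ?a j * bspline n p p j t) = spl p n (mode_coeff p \<phi> n l)"
    using spline_without_end_terms[OF p n, of ?a, OF a0] by (simp add: fun_eq_iff mode_coeff_def[abs_def])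
  show ?case
  proof (intro conjI ballI n)
    fix t assume "t \<in> {0..1} - ({0, 1} \<union> range (knot n p))"
    then have t: "t \<in> {0<..<1}" "t \<notin> range (knot n p)" by auto
    then have t': "t \<in> {0..<1}" "t \<in> {0..1}" by auto
    show "\<bar>spl p n (mode_coeff p \<phi> n l) t - sine_mode \<phi> l t\<bar> \<le> e"
    proof -
      have F: "\<bar>sine_mode \<phi> l x - sine_mode \<phi> l t\<bar> \<le> e"
        if "x \<in> {0..1}" "\<bar>x - t\<bar> \<le> real (p + 1) / real n" for x
        using elim(1) t'(2) that by blast
      from schoenberg_value[where f = "sine_mode \<phi> l" and e = e, OF n p t'(1) F]
      show ?thesis unfolding fun_cong[OF S, of t] by blast
    qed
    have F': "\<bar>sine_mode_deriv \<phi> l x - sine_mode_deriv \<phi> l t\<bar> \<le> e"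
      if "x \<in> {0..1}" "\<bar>x - t\<bar> \<le> real (p + 1) / real n" for x
      using elim(2) t'(2) that by blast
    obtain D where D: "((\<lambda>t. \<Sum>j = 0..<p + n. ?a j * bspline n p p j t) has_real_derivative D) (at t)"
      "\<bar>D - sine_mode_deriv \<phi> l t\<bar> \<le> e"
      by (rule schoenberg_derivative[OF n p t sine_mode_cont(1,3)[OF \<phi>, where l = l] F'])
    have "D = dspl p n (mode_coeff p \<phi> n l) t"
      using D(1) spl_has_derivative[OF n t(2)] unfolding S by (rule DERIV_unique)
    then show "\<bar>dspl p n (mode_coeff p \<phi> n l) t - sine_mode_deriv \<phi> l t\<bar> \<le> e" using D(2) by simp
  qed
qed

text \<open>On the Schoenberg splines of the sine modes both Galerkin forms converge to the diagonal forms of the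
  modes themselves.\<close>

lemma mode_entries:
  assumes p: "p \<ge> 1" and \<phi>: "\<phi> \<in> C01" and \<eta>: "\<eta> > 0"
  shows "\<forall>\<^sub>F n in sequentially.
    \<bar>mass_form p \<phi> n (mode_coeff p \<phi> n l) (mode_coeff p \<phi> n m) - (if l = m then 1 / 2 else 0)\<bar> \<le> \<eta> \<and>
    \<bar>stiff_form p \<phi> n (mode_coeff p \<phi> n l) (mode_coeff p \<phi> n m) - (if l = m then (real (Suc l) * pi)\<^sup>2 / 2 else 0)\<bar> \<le> \<eta>"
proof -
  have bnd: "\<exists>a>0. \<forall>x\<in>{0..1}. \<bar>f x\<bar> \<le> a" if "continuous_on {0..1} f" for f :: "real \<Rightarrow> real"
  proof -
    have "bounded (f ` {0..1})" using that by (intro compact_imp_bounded compact_continuous_image) auto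
    then show ?thesis unfolding bounded_pos real_norm_def by blast
  qed
  obtain b1 where b1: "b1 > 0" "\<forall>x\<in>{0..1}. \<bar>D01 \<phi> x\<bar> \<le> b1"
    using bnd[OF C01D(2)[OF \<phi>]] by blast
  obtain b2 where b2: "b2 > 0" "\<forall>x\<in>{0..1}. \<bar>1 / D01 \<phi> x\<bar> \<le> b2"
    using bnd[OF continuous_weight[OF \<phi>]] by blast
  obtain g1 where g1: "g1 > 0" "\<forall>x\<in>{0..1}. \<bar>sine_mode_deriv \<phi> l x\<bar> \<le> g1"
    using bnd[OF sine_mode_cont(2)[OF \<phi>, of l]] by blast
  obtain g2 where g2: "g2 > 0" "\<forall>x\<in>{0..1}. \<bar>sine_mode_deriv \<phi> m x\<bar> \<le> g2"
    using bnd[OF sine_mode_cont(2)[OF \<phi>, of m]] by blast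
  define b where "b = b1 + b2"
  define G where "G = 1 + g1 + g2"
  have bG: "0 < b" "0 \<le> b" "0 \<le> G" using b1(1) b2(1) g1(1) g2(1) by (simp_all add: b_def G_def)
  have bb: "\<bar>D01 \<phi> x\<bar> \<le> b" "\<bar>1 / D01 \<phi> x\<bar> \<le> b" "\<bar>sine_mode_deriv \<phi> l x\<bar> \<le> G" "\<bar>sine_mode_deriv \<phi> m x\<bar> \<le> G" if "x \<in> {0..1}" for x
    using bspec[OF b1(2) that] bspec[OF b2(2) that] bspec[OF g1(2) that] bspec[OF g2(2) that] b1(1) b2(1) g1(1) g2(1)
    unfolding b_def G_def by linarith+
  have sG: "\<bar>sine_mode \<phi> i x\<bar> \<le> G" for i x
    using g1(1) g2(1) abs_sin_le_one[of "real (Suc i) * pi * \<phi> x"] unfolding sine_mode_def G_def by linarith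
  define e where "e = min 1 (\<eta> / (b * (2 * G + 1)))"
  have e: "0 < e" "e \<le> 1" "0 \<le> e" "b * (e * (2 * G + 1)) \<le> \<eta>"
  proof -
    define Q where "Q = b * (2 * G + 1)"
    have pos: "0 < Q" using bG by (simp add: Q_def)
    then show "0 < e" "e \<le> 1" "0 \<le> e" using \<eta> by (simp_all add: e_def Q_def[symmetric])
    have "b * (e * (2 * G + 1)) = e * Q" by (simp add: Q_def)
    also have "\<dots> \<le> \<eta> / Q * Q" using pos by (intro mult_right_mono) (auto simp: e_def Q_def)
    also have "\<dots> = \<eta>" using pos by simp
    finally show "b * (e * (2 * G + 1)) \<le> \<eta>" .
  qed
  show ?thesis
    using mode_approximation[OF p \<phi> e(1), of l] mode_approximation[OF p \<phi> e(1), of m]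
  proof eventually_elim
    case (elim n)
    then have n: "n \<ge> 1" by simp
    have X: "finite ({0, 1} \<union> range (knot n p))" using finite_knots[OF n] by simp
    have "\<bar>mass_form p \<phi> n (mode_coeff p \<phi> n l) (mode_coeff p \<phi> n m) - (if l = m then 1 / 2 else 0)\<bar> \<le> b * (e * (2 * G + 1))"
      unfolding mass_qform(1)[OF p n \<phi>]
      by (rule product_integral_close[OF mass_qform(2)[OF p n \<phi>] sine_mode_mass[OF \<phi>] X e(3,2) bG(2,3)])
        (use bb(1) sG elim in blast)
    moreover have "\<bar>stiff_form p \<phi> n (mode_coeff p \<phi> n l) (mode_coeff p \<phi> n m) - (if l = m then (real (Suc l) * pi)\<^sup>2 / 2 else 0)\<bar> \<le> b * (e * (2 * G + 1))"
      unfolding stiff_qform(1)[OF p n \<phi>]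
      by (rule product_integral_close[OF stiff_qform(2)[OF p n \<phi>] sine_mode_stiff[OF \<phi>] X e(3,2) bG(2,3)])
        (use bb(2-4) elim in blast)
    ultimately show ?case using e(4) by linarith
  qed
qed

text \<open>Each of the \<open>k\<^sup>2\<close> perturbations contributes at most \<open>\<eta> (y\<^sub>l\<^sup>2 + y\<^sub>m\<^sup>2) / 2\<close>.\<close>

lemma quadratic_form_perturbation:
  fixes A :: "nat \<Rightarrow> nat \<Rightarrow> real"
  assumes A: "\<And>l m. l < k \<Longrightarrow> m < k \<Longrightarrow> \<bar>A l m - (if l = m then T l else 0)\<bar> \<le> \<eta>"
  shows "\<bar>(\<Sum>l<k. \<Sum>m<k. y l * y m * A l m) - (\<Sum>l<k. T l * (y l)\<^sup>2)\<bar> \<le> \<eta> * real k * (\<Sum>l<k. (y l)\<^sup>2)"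
proof -
  have "(\<Sum>l<k. T l * (y l)\<^sup>2) = (\<Sum>l<k. \<Sum>m<k. y l * y m * (if l = m then T l else 0))"
    by (intro sum.cong refl) (simp add: if_distrib[of "\<lambda>x. _ * x"] power2_eq_square mult_ac cong: if_cong)
  then have "(\<Sum>l<k. \<Sum>m<k. y l * y m * A l m) - (\<Sum>l<k. T l * (y l)\<^sup>2)
      = (\<Sum>l<k. \<Sum>m<k. y l * y m * (A l m - (if l = m then T l else 0)))"
    by (simp only: right_diff_distrib sum_subtractf)
  also have "\<bar>\<dots>\<bar> \<le> (\<Sum>l<k. \<Sum>m<k. \<eta> * ((y l)\<^sup>2 / 2 + (y m)\<^sup>2 / 2))"
  proof (rule order_trans[OF sum_abs], intro sum_mono, rule order_trans[OF sum_abs], intro sum_mono)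
    fix l m assume lm: "l \<in> {..<k}" "m \<in> {..<k}"
    have "0 \<le> (\<bar>y l\<bar> - \<bar>y m\<bar>)\<^sup>2" by simp
    then have "\<bar>y l\<bar> * \<bar>y m\<bar> \<le> (y l)\<^sup>2 / 2 + (y m)\<^sup>2 / 2" by (simp add: power2_diff)
    then have "(\<bar>y l\<bar> * \<bar>y m\<bar>) * \<bar>A l m - (if l = m then T l else 0)\<bar> \<le> ((y l)\<^sup>2 / 2 + (y m)\<^sup>2 / 2) * \<eta>"
      using A[of l m] lm by (intro mult_mono) auto
    then show "\<bar>y l * y m * (A l m - (if l = m then T l else 0))\<bar> \<le> \<eta> * ((y l)\<^sup>2 / 2 + (y m)\<^sup>2 / 2)"
      by (simp only: abs_mult mult.commute)
  qed
  also have "\<dots> = \<eta> * real k * (\<Sum>l<k. (y l)\<^sup>2)"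
    by (simp add: sum_distrib_left[symmetric] sum.distrib sum_divide_distrib[symmetric] algebra_simps)
  finally show ?thesis .
qed

text \<open>The Schoenberg splines of the first \<open>k + 1\<close> sine modes span a trial space on which the Rayleigh quotient
  is at most \<open>((k + 1) \<pi>)\<^sup>2\<close> up to an error that tends to 0.\<close>

lemma lam_eventually_le_laplace:
  assumes p: "p \<ge> 1" and \<phi>: "\<phi> \<in> C01" and \<epsilon>: "\<epsilon> > 0"
  shows "\<forall>\<^sub>F n in sequentially. lam p \<phi> n (Suc k) \<le> (real (Suc k) * pi)\<^sup>2 + \<epsilon>"
proof -
  define K where "K = Suc k"
  define a where "a = (real K * pi)\<^sup>2"
  \<comment> \<open>Chosen so that \<open>a / 2 + \<eta> K = (a + \<epsilon>) (1 / 2 - \<eta> K)\<close>.\<close>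
  define \<eta> where "\<eta> = \<epsilon> / (2 * real K * (1 + a + \<epsilon>))"
  have a0: "0 \<le> a" by (simp add: a_def)
  have K0: "real K > 0" by (simp add: K_def)
  have \<eta>0: "\<eta> > 0" using \<epsilon> a0 K0 by (simp add: \<eta>_def)
  have \<eta>K: "\<eta> * real K * (1 + a + \<epsilon>) = \<epsilon> / 2"
  proof -
    define Q where "Q = 1 + a + \<epsilon>"
    have "Q > 0" using \<epsilon> a0 by (simp add: Q_def)
    then show ?thesis unfolding \<eta>_def Q_def[symmetric] using K0 by simp
  qed
  have "\<eta> * real K * (1 + a + \<epsilon>) < 1 / 2 * (1 + a + \<epsilon>)" unfolding \<eta>K using a0 by simp
  then have \<eta>K2: "\<eta> * real K < 1 / 2" using a0 \<epsilon> by (simp only: mult_less_cancel_right)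
  have "\<forall>\<^sub>F n in sequentially. \<forall>l\<in>{..<K}. \<forall>m\<in>{..<K}.
    \<bar>mass_form p \<phi> n (mode_coeff p \<phi> n l) (mode_coeff p \<phi> n m) - (if l = m then 1 / 2 else 0)\<bar> \<le> \<eta> \<and>
    \<bar>stiff_form p \<phi> n (mode_coeff p \<phi> n l) (mode_coeff p \<phi> n m) - (if l = m then (real (Suc l) * pi)\<^sup>2 / 2 else 0)\<bar> \<le> \<eta>"
    by (intro eventually_ball_finite ballI mode_entries[OF p \<phi> \<eta>0]) auto
  with eventually_ge_at_top[of "Suc (Suc K)"] show ?thesis
  proof eventually_elim
    case (elim n)
    then have n: "n \<ge> 1" "k < dimN p n" using p by (auto simp: dimN_def K_def)
    let ?M = "mass_form p \<phi> n" and ?S = "stiff_form p \<phi> n"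
    let ?w = "mode_coeff p \<phi> n"
    have "lam p \<phi> n (Suc k) \<le> a + \<epsilon>"
    proof (rule lam_le_if_rayleigh_le[OF p n(1) \<phi> n(2), where w = ?w])
      fix y c :: "nat \<Rightarrow> real"
      assume y: "\<exists>l<Suc k. y l \<noteq> 0" and c_def: "c = (\<lambda>i. \<Sum>l<Suc k. y l * ?w l i)"
      define Y where "Y = (\<Sum>l<K. (y l)\<^sup>2)"
      have Y: "Y > 0"
      proof -
        obtain l where "l < K" "y l \<noteq> 0" using y by (auto simp: K_def)
        then show ?thesis unfolding Y_def by (intro sum_pos2[of _ l]) auto
      qed
      have expand: "qform N A c c = (\<Sum>l<K. \<Sum>m<K. y l * y m * qform N A (?w l) (?w m))" for N A
        unfolding c_def K_def qform_sum_left qform_sum_right by (simp only: sum_distrib_left mult.assoc)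
      have "\<bar>?M c c - (\<Sum>l<K. 1 / 2 * (y l)\<^sup>2)\<bar> \<le> \<eta> * real K * Y"
        unfolding expand Y_def using elim(2) by (intro quadratic_form_perturbation) auto
      moreover have "(\<Sum>l<K. 1 / 2 * (y l)\<^sup>2) = 1 / 2 * Y" by (simp only: Y_def sum_distrib_left)
      ultimately have M: "(1 / 2 - \<eta> * real K) * Y \<le> ?M c c" unfolding left_diff_distrib by linarith
      have "\<bar>?S c c - (\<Sum>l<K. (real (Suc l) * pi)\<^sup>2 / 2 * (y l)\<^sup>2)\<bar> \<le> \<eta> * real K * Y"
        unfolding expand Y_def using elim(2) by (intro quadratic_form_perturbation) auto
      moreover have "(\<Sum>l<K. (real (Suc l) * pi)\<^sup>2 / 2 * (y l)\<^sup>2) \<le> (\<Sum>l<K. a / 2 * (y l)\<^sup>2)"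
        unfolding a_def by (intro sum_mono mult_right_mono divide_right_mono power_mono) auto
      moreover have "(\<Sum>l<K. a / 2 * (y l)\<^sup>2) = a / 2 * Y" by (simp only: Y_def sum_distrib_left)
      ultimately have S: "?S c c \<le> (a / 2 + \<eta> * real K) * Y" unfolding distrib_right by linarith
      have "0 < (1 / 2 - \<eta> * real K) * Y" using \<eta>K2 Y by simp
      then have Mpos: "0 < ?M c c" using M by linarith
      have "a / 2 + \<eta> * real K = (a + \<epsilon>) * (1 / 2 - \<eta> * real K)" using \<eta>K by (simp add: algebra_simps)
      then have "(a / 2 + \<eta> * real K) * Y = (a + \<epsilon>) * ((1 / 2 - \<eta> * real K) * Y)" by simp
      also have "\<dots> \<le> (a + \<epsilon>) * ?M c c" using M a0 \<epsilon> by (intro mult_left_mono) auto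
      finally have "?S c c \<le> (a + \<epsilon>) * ?M c c" using S by linarith
      with Mpos show "0 < ?M c c \<and> ?S c c \<le> (a + \<epsilon>) * ?M c c" by blast
    qed
    then show ?case by (simp only: a_def K_def)
  qed
qed

section \<open>The minimal gap\<close>

text \<open>For a fixed index the root of the eigenvalue of index \<open>k + 1\<close> is at least \<open>(k + 1) \<pi>\<close>, and the one of
  index \<open>k\<close> is eventually at most \<open>k \<pi> + e\<close>.\<close>

lemma sqrt_gap_ge:
  assumes p: "p \<ge> 1" and \<phi>: "\<phi> \<in> C01" and k: "k \<ge> 1" and e: "e > 0"
  shows "\<forall>\<^sub>F n in sequentially. k < dimN p n \<longrightarrow> pi - e \<le> sqrt_gap p \<phi> n k"
proof -
  obtain k' where k': "k = Suc k'" using k by (cases k) auto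
  define a where "a = real k * pi"
  have a: "a \<ge> 0" by (simp add: a_def)
  \<comment> \<open>\<open>2 a e + e\<^sup>2\<close> is the tolerance that moves the root of the eigenvalue from \<open>a\<close> to \<open>a + e\<close>.\<close>
  have "2 * a * e + e\<^sup>2 > 0" using a e by (intro add_nonneg_pos) auto
  from lam_eventually_le_laplace[OF p \<phi> this, of k'] eventually_ge_at_top[of 1] show ?thesis
  proof eventually_elim
    case (elim n)
    show ?case
    proof
      assume "k < dimN p n"
      from lam_ge_laplace[OF p elim(2) \<phi> this] have "(real (Suc k) * pi)\<^sup>2 \<le> lam p \<phi> n (k + 1)" by simp
      then have "real (Suc k) * pi \<le> sqrt (lam p \<phi> n (k + 1))" by (rule real_le_rsqrt)
      moreover have "lam p \<phi> n k \<le> (a + e)\<^sup>2"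
        using elim(1) unfolding k'[symmetric] a_def[symmetric] by (simp add: power2_sum)
      then have "sqrt (lam p \<phi> n k) \<le> a + e" using a e by (intro real_le_lsqrt) auto
      ultimately show "pi - e \<le> sqrt_gap p \<phi> n k" by (simp add: sqrt_gap_def a_def algebra_simps)
    qed
  qed
qed

lemma min_gap_attained:
  assumes "dimN p n \<ge> 2"
  shows "min_gap_index p \<phi> n \<in> {1..dimN p n - 1}" "sqrt_gap p \<phi> n (min_gap_index p \<phi> n) = min_gap p \<phi> n"
proof -
  have ne: "{1..dimN p n - 1} \<noteq> {}" using assms by auto
  have "min_gap p \<phi> n = Min (sqrt_gap p \<phi> n ` {1..dimN p n - 1})"
    unfolding min_gap_def using ne by (intro cInf_eq_Min) auto
  also have "\<dots> \<in> sqrt_gap p \<phi> n ` {1..dimN p n - 1}" using ne by (intro Min_in) auto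
  finally have "\<exists>k. k \<in> {1..dimN p n - 1} \<and> sqrt_gap p \<phi> n k = min_gap p \<phi> n" by auto
  then have "min_gap_index p \<phi> n \<in> {1..dimN p n - 1} \<and> sqrt_gap p \<phi> n (min_gap_index p \<phi> n) = min_gap p \<phi> n"
    unfolding min_gap_index_def by (rule LeastI_ex)
  then show "min_gap_index p \<phi> n \<in> {1..dimN p n - 1}" "sqrt_gap p \<phi> n (min_gap_index p \<phi> n) = min_gap p \<phi> n" by auto
qed

theorem theorem4p1:
  fixes p :: nat and \<phi> :: "real \<Rightarrow> real"
  assumes "p \<ge> 1" and "\<phi> \<in> C01"
    and "eig_distributed p \<phi>"
  shows "Psi_sqrt p \<phi> differentiable (at 0 within {0..})
    \<and> gam p \<phi> > 0
    \<and> (bdd_above (min_gap_index p \<phi> ` {n. n \<ge> 1 \<and> dimN p n \<ge> 2})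
        \<longrightarrow> liminf (\<lambda>n. ereal (min_gap p \<phi> n)) \<ge> ereal (gam p \<phi>))"
proof (intro conjI impI)
  note p = assms(1) and \<phi> = assms(2)
  show "Psi_sqrt p \<phi> differentiable (at 0 within {0..})" by (rule gam_eq_pi(1)[OF p \<phi>])
  show "gam p \<phi> > 0" by (simp add: gam_eq_pi(2)[OF p \<phi>])
  assume "bdd_above (min_gap_index p \<phi> ` {n. n \<ge> 1 \<and> dimN p n \<ge> 2})"
  then obtain C where C: "\<And>n. n \<ge> 1 \<Longrightarrow> dimN p n \<ge> 2 \<Longrightarrow> min_gap_index p \<phi> n \<le> C"
    unfolding bdd_above_def by auto
  have ev: "\<forall>\<^sub>F n in sequentially. pi - e \<le> min_gap p \<phi> n" if e: "e > 0" for e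
  proof -
    have "\<forall>\<^sub>F n in sequentially. \<forall>k\<in>{1..C}. k < dimN p n \<longrightarrow> pi - e \<le> sqrt_gap p \<phi> n k"
      by (intro eventually_ball_finite ballI sqrt_gap_ge[OF p \<phi> _ e]) auto
    with eventually_ge_at_top[of 3] show ?thesis
    proof eventually_elim
      case (elim n)
      then have n: "n \<ge> 1" "dimN p n \<ge> 2" using p by (auto simp: dimN_def)
      note m = min_gap_attained[OF n(2), of \<phi>]
      have "pi - e \<le> sqrt_gap p \<phi> n (min_gap_index p \<phi> n)"
        using elim(2) m(1) C[OF n] n(2) by auto
      then show ?case using m(2) by simp
    qed
  qed
  show "liminf (\<lambda>n. ereal (min_gap p \<phi> n)) \<ge> ereal (gam p \<phi>)"
    unfolding gam_eq_pi(2)[OF p \<phi>] le_Liminf_iff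
  proof (intro allI impI)
    fix y assume y: "y < ereal pi"
    show "\<forall>\<^sub>F n in sequentially. y < ereal (min_gap p \<phi> n)"
    proof (cases y)
      case (real r)
      then have r: "r < pi" using y by simp
      have "\<forall>\<^sub>F n in sequentially. pi - (pi - r) / 2 \<le> min_gap p \<phi> n" using r by (intro ev) simp
      then show ?thesis
      proof eventually_elim
        case (elim n)
        have "r < pi - (pi - r) / 2" using r by (simp add: field_simps)
        then show ?case using elim real by simp
      qed
    qed (use y in auto)
  qed
qed

end
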